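(* Let $M$ be a smooth connected $m$-manifold without boundary ($m\ge 1$), possibly noncompact, let $f:M\to\mathbb{R}$ be a Morse function, let $v$ be an $f$-gradient, and let $q:M\to M/\!\sim$ be the quotient map onto the orbit space of $v$. Then $q$ is a weak homotopy equivalence.
   Context: Smooth means $C^\infty$. Manifolds are Hausdorff with a countable basis. A Morse function is a smooth function all of whose critical points are non-degenerate; $S(f)$ denotes the set of critical points of $f$. For a smooth vector field $v:M\to TM$, let $v(f):M\to\mathbb{R}$ be the smooth function $v(f)(p)=df_p(v(p))$. The vector field $v$ is an $f$-gradient if: (1) $v(f)>0$ on $M-S(f)$; and (2) each $p\in S(f)$ is a non-degenerate minimum of $v(f)$ (that is, $p$ is a local minimum of $v(f)$ which is a non-degenerate critical point of $v(f)$). For $p\in M$, $[p]$ denotes the orbit of $p$, i.e. the image in $M$ of the maximal integral curve of $v$ through $p$. The orbits are the classes of an equivalence relation $\sim$ on $M$. The orbit space $M/\!\sim$ carries the quotient topology: $U\subset M/\!\sim$ is open if and only if $q^{-1}(U)\subset M$ is open, where $q:M\to M/\!\sim$, $q(p)=[p]$. The orbit space is typically non-Hausdorff. A weak homotopy equivalence is a continuous map $h:X\to Y$ of topological spaces that induces isomorphisms $h_\sharp:\pi_i(X,x)\to\pi_i(Y,h(x))$ for all $x\in X$ and all $i\ge 0$ (when $i=0$, isomorphism means bijection). *)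

theory Defs
  imports "HOL-Analysis.Analysis" "HOL-Algebra.Group"
begin

section \<open>Smooth maps between normed spaces\<close>

text \<open>
  \<open>Ck_on k S g\<close> is the class \<open>C\<^sup>k\<close> on an \<^emph>\<open>open\<close> set \<open>S\<close> of a finite-dimensional space: \<open>g\<close> is
  differentiable and all its directional derivatives are of class \<open>C\<^sup>k\<^sup>-\<^sup>1\<close>. It is used for open
  \<open>S\<close> only, where being differentiable within \<open>S\<close> and at a point of \<open>S\<close> agree.
\<close>

primrec Ck_on ::
  "nat \<Rightarrow> 'e::real_normed_vector set \<Rightarrow> ('e \<Rightarrow> 'b::real_normed_vector) \<Rightarrow> bool" where
  "Ck_on 0 S g \<longleftrightarrow> continuous_on S g"
| "Ck_on (Suc k) S g \<longleftrightarrow>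
     g differentiable_on S \<and> (\<forall>u. Ck_on k S (\<lambda>x. frechet_derivative g (at x) u))"

definition smooth_on ::
  "'e::real_normed_vector set \<Rightarrow> ('e \<Rightarrow> 'b::real_normed_vector) \<Rightarrow> bool" where
  "smooth_on S g \<longleftrightarrow> (\<forall>k. Ck_on k S g)"


section \<open>Smooth manifolds\<close>

text \<open>
  A chart is a pair of its domain and its coordinate map. The model space is a type
  \<open>'e::euclidean_space\<close>, so the dimension of the manifold is \<open>DIM('e)\<close>, which is positive.
\<close>

type_synonym ('a, 'e) chart = "'a set \<times> ('a \<Rightarrow> 'e)"

abbreviation chart_dom :: "('a, 'e) chart \<Rightarrow> 'a set" where
  "chart_dom c \<equiv> fst c"

abbreviation chart_map :: "('a, 'e) chart \<Rightarrow> 'a \<Rightarrow> 'e" where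
  "chart_map c \<equiv> snd c"

abbreviation chart_im :: "('a, 'e) chart \<Rightarrow> 'e set" where
  "chart_im c \<equiv> chart_map c ` chart_dom c"

abbreviation chart_inv :: "('a, 'e) chart \<Rightarrow> 'e \<Rightarrow> 'a" where
  "chart_inv c \<equiv> inv_into (chart_dom c) (chart_map c)"

definition is_chart :: "'a topology \<Rightarrow> ('a, 'e::euclidean_space) chart \<Rightarrow> bool" where
  "is_chart M c \<longleftrightarrow>
     openin M (chart_dom c) \<and> open (chart_im c) \<and>
     homeomorphic_map (subtopology M (chart_dom c)) (top_of_set (chart_im c)) (chart_map c)"

text \<open>The manifold is all of \<open>topspace M\<close>; it has no boundary, as charts have open images.\<close>

definition smooth_manifold ::
  "'a topology \<Rightarrow> ('a, 'e::euclidean_space) chart set \<Rightarrow> bool" where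
  "smooth_manifold M A \<longleftrightarrow>
     Hausdorff_space M \<and> second_countable M \<and>
     (\<forall>c\<in>A. is_chart M c) \<and>
     (\<Union>c\<in>A. chart_dom c) = topspace M \<and>
     (\<forall>c\<in>A. \<forall>d\<in>A.
        smooth_on (chart_map c ` (chart_dom c \<inter> chart_dom d)) (chart_map d \<circ> chart_inv c))"

text \<open>
  Constructions that do not depend on the choice of a chart around \<open>p\<close> are made in this one.
\<close>

definition chart_at :: "('a, 'e) chart set \<Rightarrow> 'a \<Rightarrow> ('a, 'e) chart" where
  "chart_at A p = (SOME c. c \<in> A \<and> p \<in> chart_dom c)"

definition smooth_fun ::
  "('a, 'e::euclidean_space) chart set \<Rightarrow> ('a \<Rightarrow> 'b::real_normed_vector) \<Rightarrow> bool" where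
  "smooth_fun A f \<longleftrightarrow> (\<forall>c\<in>A. smooth_on (chart_im c) (f \<circ> chart_inv c))"


section \<open>Tangent vectors and vector fields\<close>

text \<open>
  A tangent vector at \<open>p\<close> is a family of coordinate vectors, one for each chart around \<open>p\<close>,
  transforming by the derivatives of the transition maps. The components at charts whose domain
  does not contain \<open>p\<close> are irrelevant and are never looked at.
\<close>

type_synonym ('a, 'e) tangent_vector = "('a, 'e) chart \<Rightarrow> 'e"

definition tangent_space ::
  "('a, 'e::euclidean_space) chart set \<Rightarrow> 'a \<Rightarrow> ('a, 'e) tangent_vector set" where
  "tangent_space A p =
     {\<xi>. \<forall>c\<in>A. \<forall>d\<in>A. p \<in> chart_dom c \<longrightarrow> p \<in> chart_dom d \<longrightarrow>
        \<xi> d = frechet_derivative (chart_map d \<circ> chart_inv c) (at (chart_map c p)) (\<xi> c)}"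

text \<open>\<open>differential A f p \<xi>\<close> is \<open>df\<^sub>p(\<xi>)\<close>.\<close>

definition differential ::
  "('a, 'e::euclidean_space) chart set \<Rightarrow> ('a \<Rightarrow> real) \<Rightarrow> 'a \<Rightarrow> ('a, 'e) tangent_vector \<Rightarrow> real" where
  "differential A f p \<xi> =
     (let c = chart_at A p
      in frechet_derivative (f \<circ> chart_inv c) (at (chart_map c p)) (\<xi> c))"

text \<open>
  A smooth section of the tangent bundle: smoothness is tested in the bundle charts induced by
  the charts of the manifold.
\<close>

definition smooth_vector_field ::
  "'a topology \<Rightarrow> ('a, 'e::euclidean_space) chart set \<Rightarrow> ('a \<Rightarrow> ('a, 'e) tangent_vector) \<Rightarrow> bool"
  where
  "smooth_vector_field M A v \<longleftrightarrow>
     (\<forall>p\<in>topspace M. v p \<in> tangent_space A p) \<and>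
     (\<forall>c\<in>A. smooth_on (chart_im c) (\<lambda>x. v (chart_inv c x) c))"

definition field_deriv ::
  "('a, 'e::euclidean_space) chart set \<Rightarrow> ('a \<Rightarrow> ('a, 'e) tangent_vector) \<Rightarrow> ('a \<Rightarrow> real) \<Rightarrow> 'a \<Rightarrow> real"
  where
  "field_deriv A v f p = differential A f p (v p)"


section \<open>Morse functions and gradients\<close>

definition critical_points ::
  "'a topology \<Rightarrow> ('a, 'e::euclidean_space) chart set \<Rightarrow> ('a \<Rightarrow> real) \<Rightarrow> 'a set" where
  "critical_points M A f =
     {p \<in> topspace M. \<forall>\<xi>\<in>tangent_space A p. differential A f p \<xi> = 0}"

text \<open>The Hessian of \<open>f\<close> at \<open>p\<close> in the coordinates of the chart \<open>c\<close>, as a bilinear form.\<close>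

definition hessian ::
  "('a, 'e::euclidean_space) chart \<Rightarrow> ('a \<Rightarrow> real) \<Rightarrow> 'a \<Rightarrow> 'e \<Rightarrow> 'e \<Rightarrow> real" where
  "hessian c f p u w =
     frechet_derivative (\<lambda>x. frechet_derivative (f \<circ> chart_inv c) (at x) u)
       (at (chart_map c p)) w"

definition nondegenerate_critical_point ::
  "'a topology \<Rightarrow> ('a, 'e::euclidean_space) chart set \<Rightarrow> ('a \<Rightarrow> real) \<Rightarrow> 'a \<Rightarrow> bool" where
  "nondegenerate_critical_point M A f p \<longleftrightarrow>
     p \<in> critical_points M A f \<and>
     (\<forall>u. (\<forall>w. hessian (chart_at A p) f p u w = 0) \<longrightarrow> u = 0)"

definition morse_function ::
  "'a topology \<Rightarrow> ('a, 'e::euclidean_space) chart set \<Rightarrow> ('a \<Rightarrow> real) \<Rightarrow> bool" where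
  "morse_function M A f \<longleftrightarrow>
     smooth_fun A f \<and> (\<forall>p\<in>critical_points M A f. nondegenerate_critical_point M A f p)"

definition local_minimum :: "'a topology \<Rightarrow> ('a \<Rightarrow> real) \<Rightarrow> 'a \<Rightarrow> bool" where
  "local_minimum M g p \<longleftrightarrow> (\<exists>U. openin M U \<and> p \<in> U \<and> (\<forall>x\<in>U. g p \<le> g x))"

definition f_gradient ::
  "'a topology \<Rightarrow> ('a, 'e::euclidean_space) chart set \<Rightarrow> ('a \<Rightarrow> real) \<Rightarrow>
   ('a \<Rightarrow> ('a, 'e) tangent_vector) \<Rightarrow> bool" where
  "f_gradient M A f v \<longleftrightarrow>
     smooth_vector_field M A v \<and>
     (\<forall>p\<in>topspace M - critical_points M A f. field_deriv A v f p > 0) \<and>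
     (\<forall>p\<in>critical_points M A f.
        local_minimum M (field_deriv A v f) p \<and>
        nondegenerate_critical_point M A (field_deriv A v f) p)"


section \<open>Orbits and the orbit space\<close>

definition integral_curve ::
  "'a topology \<Rightarrow> ('a, 'e::euclidean_space) chart set \<Rightarrow> ('a \<Rightarrow> ('a, 'e) tangent_vector) \<Rightarrow>
   real set \<Rightarrow> (real \<Rightarrow> 'a) \<Rightarrow> bool" where
  "integral_curve M A v J \<gamma> \<longleftrightarrow>
     open J \<and> is_interval J \<and> continuous_map (top_of_set J) M \<gamma> \<and>
     (\<forall>t\<in>J. \<forall>c\<in>A. \<gamma> t \<in> chart_dom c \<longrightarrow>
        ((chart_map c \<circ> \<gamma>) has_vector_derivative v (\<gamma> t) c) (at t))"

definition maximal_integral_curve ::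
  "'a topology \<Rightarrow> ('a, 'e::euclidean_space) chart set \<Rightarrow> ('a \<Rightarrow> ('a, 'e) tangent_vector) \<Rightarrow>
   'a \<Rightarrow> real set \<Rightarrow> (real \<Rightarrow> 'a) \<Rightarrow> bool" where
  "maximal_integral_curve M A v p J \<gamma> \<longleftrightarrow>
     integral_curve M A v J \<gamma> \<and> 0 \<in> J \<and> \<gamma> 0 = p \<and>
     (\<forall>K \<delta>. integral_curve M A v K \<delta> \<and> J \<subseteq> K \<and> (\<forall>t\<in>J. \<delta> t = \<gamma> t) \<longrightarrow> K = J)"

text \<open>
  On a manifold and for a smooth vector field, the maximal integral curve through \<open>p\<close> is unique
  (up to the values of \<open>\<gamma>\<close> outside its domain \<open>J\<close>), so this is its image.
\<close>

definition orbit ::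
  "'a topology \<Rightarrow> ('a, 'e::euclidean_space) chart set \<Rightarrow> ('a \<Rightarrow> ('a, 'e) tangent_vector) \<Rightarrow>
   'a \<Rightarrow> 'a set" where
  "orbit M A v p = {x. \<exists>J \<gamma>. maximal_integral_curve M A v p J \<gamma> \<and> x \<in> \<gamma> ` J}"

definition quotient_topology :: "'a topology \<Rightarrow> ('a \<Rightarrow> 'b) \<Rightarrow> 'b topology" where
  "quotient_topology X q =
     topology (\<lambda>V. V \<subseteq> q ` topspace X \<and> openin X {x \<in> topspace X. q x \<in> V})"

lemma openin_quotient_topology:
  "openin (quotient_topology X q) V \<longleftrightarrow>
     V \<subseteq> q ` topspace X \<and> openin X {x \<in> topspace X. q x \<in> V}"
proof -
  have "istopology (\<lambda>V. V \<subseteq> q ` topspace X \<and> openin X {x \<in> topspace X. q x \<in> V})"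
    unfolding istopology_def
  proof (intro conjI allI impI, goal_cases)
    case (2 S T)
    then show ?case
      using openin_Int[of X "{x \<in> topspace X. q x \<in> S}" "{x \<in> topspace X. q x \<in> T}"]
      by (simp add: Collect_conj_eq[symmetric] Int_def conj_ac cong: conj_cong)
  next
    case (4 \<K>)
    then have "openin X (\<Union>V\<in>\<K>. {x \<in> topspace X. q x \<in> V})"
      by blast
    moreover have "(\<Union>V\<in>\<K>. {x \<in> topspace X. q x \<in> V}) = {x \<in> topspace X. q x \<in> \<Union>\<K>}"
      by blast
    ultimately show ?case by simp
  qed blast+
  then show ?thesis
    by (simp add: quotient_topology_def topology_inverse')
qed

lemma topspace_quotient_topology: "topspace (quotient_topology X q) = q ` topspace X"
proof -
  have "{x \<in> topspace X. q x \<in> q ` topspace X} = topspace X" by blast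
  then have "openin (quotient_topology X q) (q ` topspace X)"
    by (simp add: openin_quotient_topology)
  then show ?thesis
    using openin_subset openin_quotient_topology openin_topspace by (metis subset_antisym)
qed

lemma quotient_map_quotient_topology: "quotient_map X (quotient_topology X q) q"
  by (simp add: quotient_map_def topspace_quotient_topology openin_quotient_topology)

definition orbit_space ::
  "'a topology \<Rightarrow> ('a, 'e::euclidean_space) chart set \<Rightarrow> ('a \<Rightarrow> ('a, 'e) tangent_vector) \<Rightarrow>
   'a set topology" where
  "orbit_space M A v = quotient_topology M (orbit M A v)"


section \<open>Homotopy groups and weak homotopy equivalences\<close>

text \<open>
  Elements of the homotopy group \<open>\<pi>\<^sub>n(X, x)\<close> are homotopy classes, relative to the boundary of
  the cube, of maps \<open>([0,1]\<^sup>n, \<partial>[0,1]\<^sup>n) \<rightarrow> (X, x)\<close>. The coordinates are indexed by \<open>{..<n}\<close>. For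
  \<open>n = 0\<close> the cube is a point with empty boundary, so \<open>\<pi>\<^sub>0(X, x)\<close> is the set of path components
  of \<open>X\<close>.
\<close>

definition cube :: "nat \<Rightarrow> (nat \<Rightarrow> real) topology" where
  "cube n = product_topology (\<lambda>_. top_of_set {0..1}) {..<n}"

definition cube_boundary :: "nat \<Rightarrow> (nat \<Rightarrow> real) set" where
  "cube_boundary n = {t \<in> topspace (cube n). \<exists>i<n. t i = 0 \<or> t i = 1}"

definition spheroids :: "nat \<Rightarrow> 'a topology \<Rightarrow> 'a \<Rightarrow> ((nat \<Rightarrow> real) \<Rightarrow> 'a) set" where
  "spheroids n X x = {g. continuous_map (cube n) X g \<and> g ` cube_boundary n \<subseteq> {x}}"

definition homotopy_class ::
  "nat \<Rightarrow> 'a topology \<Rightarrow> 'a \<Rightarrow> ((nat \<Rightarrow> real) \<Rightarrow> 'a) \<Rightarrow> ((nat \<Rightarrow> real) \<Rightarrow> 'a) set" where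
  "homotopy_class n X x g =
     {h. homotopic_with (\<lambda>k. k ` cube_boundary n \<subseteq> {x}) (cube n) X g h}"

text \<open>Concatenation in the first coordinate; it is used for \<open>n \<ge> 1\<close> only.\<close>

definition spheroid_concat ::
  "((nat \<Rightarrow> real) \<Rightarrow> 'a) \<Rightarrow> ((nat \<Rightarrow> real) \<Rightarrow> 'a) \<Rightarrow> (nat \<Rightarrow> real) \<Rightarrow> 'a" where
  "spheroid_concat g h t =
     (if t 0 \<le> 1/2 then g (t(0 := 2 * t 0)) else h (t(0 := 2 * t 0 - 1)))"

text \<open>For \<open>n = 0\<close> only the carrier is meaningful.\<close>

definition homotopy_group ::
  "nat \<Rightarrow> 'a topology \<Rightarrow> 'a \<Rightarrow> ((nat \<Rightarrow> real) \<Rightarrow> 'a) set monoid" where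
  "homotopy_group n X x =
     \<lparr>carrier = homotopy_class n X x ` spheroids n X x,
      mult = (\<lambda>C D. \<Union>g\<in>C. \<Union>h\<in>D. homotopy_class n X x (spheroid_concat g h)),
      one = homotopy_class n X x (\<lambda>_. x)\<rparr>"

definition induced_map ::
  "nat \<Rightarrow> 'b topology \<Rightarrow> ('a \<Rightarrow> 'b) \<Rightarrow> 'a \<Rightarrow>
   ((nat \<Rightarrow> real) \<Rightarrow> 'a) set \<Rightarrow> ((nat \<Rightarrow> real) \<Rightarrow> 'b) set" where
  "induced_map n Y h x C = (\<Union>g\<in>C. homotopy_class n Y (h x) (h \<circ> g))"

definition weak_homotopy_equivalence ::
  "'a topology \<Rightarrow> 'b topology \<Rightarrow> ('a \<Rightarrow> 'b) \<Rightarrow> bool" where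
  "weak_homotopy_equivalence X Y h \<longleftrightarrow>
     continuous_map X Y h \<and>
     (\<forall>x\<in>topspace X.
        bij_betw (induced_map 0 Y h x)
          (carrier (homotopy_group 0 X x)) (carrier (homotopy_group 0 Y (h x))) \<and>
        (\<forall>i\<ge>1. induced_map i Y h x \<in> iso (homotopy_group i X x) (homotopy_group i Y (h x))))"

end

theory Submission
  imports Defs
begin

text \<open>
  The projection \<open>q\<close> onto the orbit space lifts maps exactly, and relative to closed subsets: if
  \<open>K\<close> is a separable metrizable space, \<open>g\<close> a map from \<open>K\<close> to the orbit space and \<open>b\<close> a lift of \<open>g\<close> to
  \<open>M\<close> over a closed subset \<open>B\<close> of \<open>K\<close>, then \<open>b\<close> extends to a lift of \<open>g\<close> over all of \<open>K\<close>. Taking for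
  \<open>(K, B)\<close> a cube with its boundary gives surjectivity on homotopy groups, and taking the cylinder over
  a cube with the whole boundary of the cylinder gives injectivity; this is all that a weak homotopy
  equivalence asks for.

  The lifting property holds because \<open>f\<close> is injective on every orbit and maps it onto an interval: an
  orbit is either a critical point or a curve along which \<open>f\<close> increases strictly. A lift of \<open>g\<close> is
  therefore the same as a choice, for each \<open>k\<close> in \<open>K\<close>, of a level in the interval \<open>f(g(k))\<close>. Two facts
  make the topology fit. First, \<open>q\<close> is open (\<open>open_map_orbit\<close>), by the continuous dependence of
  integral curves on their initial points; hence the intervals \<open>f(g(k))\<close> depend lower
  hemicontinuously on \<open>k\<close>, and a continuous choice of levels exists by a one-dimensional case of
  Michael's selection theorem (\<open>convex_selection\<close>), which also allows the choice to be prescribed on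
  \<open>B\<close>. Second, a continuous choice of levels gives a continuous choice of points, because an orbit that
  passes close to \<open>y\<close> is still close to \<open>y\<close> as long as its level is close to \<open>f(y)\<close>
  (\<open>orbit_trapping\<close>). The second fact rests on the isolation of the critical points of a Morse function:
  \<open>v(f)\<close> is bounded below by a positive constant on a small spherical shell around \<open>y\<close>,
  and a curve crossing this shell gains a definite amount of height, even when \<open>y\<close> itself is critical.
  Critical points are orbits by themselves because \<open>v\<close> vanishes there: differentiating \<open>v(f)\<close> at a critical
  point of both \<open>f\<close> and \<open>v(f)\<close> shows that \<open>v\<close> lies in the kernel of the Hessian of \<open>f\<close>
  (\<open>field_vanishes_critical\<close>).
\<close>


section \<open>Continuous selections of lower hemicontinuous families of intervals\<close>

definition lower_hemicontinuous_on :: "'a::topological_space set \<Rightarrow> ('a \<Rightarrow> real set) \<Rightarrow> bool" where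
  "lower_hemicontinuous_on S \<phi> \<longleftrightarrow>
     (\<forall>U. open U \<longrightarrow> openin (top_of_set S) {k \<in> S. \<phi> k \<inter> U \<noteq> {}})"

text \<open>
  Let \<open>C\<close> be the set of points where the value is a singleton. It is closed, the selection is forced on
  it, and the forced selection is continuous there; let \<open>e\<close> be a continuous extension of it. Off \<open>C\<close> the
  values have interior points, and by lower hemicontinuity and convexity an interior point of one value
  lies in all nearby values. Averaging such locally constant selections with a partition of unity stays
  within the convex values. The selection is continuous at \<open>C\<close> because the local constants are
  taken close to \<open>e\<close>, on neighbourhoods that are small compared with the distance to \<open>C\<close>.
\<close>

lemma convex_selection:
  fixes S :: "'k::{metric_space,second_countable_topology} set" and \<phi> :: "'k \<Rightarrow> real set"
  assumes lsc: "lower_hemicontinuous_on S \<phi>"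
    and ne: "\<And>k. k \<in> S \<Longrightarrow> \<phi> k \<noteq> {}" and cvx: "\<And>k. k \<in> S \<Longrightarrow> convex (\<phi> k)"
  obtains s where "continuous_on S s" "\<And>k. k \<in> S \<Longrightarrow> s k \<in> \<phi> k"
proof -
  have lscD: "openin (top_of_set S) {k \<in> S. \<phi> k \<inter> U \<noteq> {}}" if "open U" for U
    using lsc that by (simp add: lower_hemicontinuous_on_def)
  have iv: "is_interval (\<phi> k)" if "k \<in> S" for k using cvx that by (simp add: is_interval_convex_1)
  define C where "C = {k \<in> S. \<exists>r. \<phi> k = {r}}"
  define s0 where "s0 k = (THE r. \<phi> k = {r})" for k
  have s0: "\<phi> k = {s0 k}" if "k \<in> C" for k
    using that unfolding C_def s0_def by auto
  have "openin (top_of_set S) (S - C)"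
  proof (subst openin_subopen, safe)
    fix k assume k: "k \<in> S" "k \<notin> C"
    obtain a where a: "a \<in> \<phi> k" using ne k by blast
    have "\<phi> k \<noteq> {a}" using k unfolding C_def by blast
    then obtain b where b: "b \<in> \<phi> k" "b \<noteq> a" using a by blast
    then obtain U V where UV: "open U" "open V" "a \<in> U" "b \<in> V" "U \<inter> V = {}"
      using hausdorff by metis
    let ?T = "{k \<in> S. \<phi> k \<inter> U \<noteq> {}} \<inter> {k \<in> S. \<phi> k \<inter> V \<noteq> {}}"
    have "openin (top_of_set S) ?T" using lscD UV by (intro openin_Int) auto
    moreover have "k \<in> ?T" using a b UV k by blast
    moreover have "?T \<subseteq> S - C" using UV unfolding C_def by fastforce
    ultimately show "\<exists>T. openin (top_of_set S) T \<and> k \<in> T \<and> T \<subseteq> S - C" by blast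
  qed
  then have clC: "closedin (top_of_set S) C"
    using closedin_def[of "top_of_set S" C] by (auto simp: C_def)
  have "continuous_on C s0"
  proof (subst continuous_on_open_gen[of _ _ UNIV], force, intro allI impI)
    fix U :: "real set" assume "openin (top_of_set UNIV) U"
    then have "openin (top_of_set S) {k \<in> S. \<phi> k \<inter> U \<noteq> {}}" using lscD by simp
    then obtain T where T: "open T" "{k \<in> S. \<phi> k \<inter> U \<noteq> {}} = S \<inter> T" by (auto simp: openin_open)
    have "s0 k \<in> U \<longleftrightarrow> \<phi> k \<inter> U \<noteq> {}" if "k \<in> C" for k using s0[OF that] by auto
    then have "C \<inter> s0 -` U = C \<inter> {k \<in> S. \<phi> k \<inter> U \<noteq> {}}" by (auto simp: C_def)
    then have "C \<inter> s0 -` U = C \<inter> T" using T(2) by (auto simp: C_def)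
    then show "openin (top_of_set C) (C \<inter> s0 -` U)" using T(1) by auto
  qed
  then obtain e where e: "continuous_on S e" "\<And>k. k \<in> C \<Longrightarrow> e k = s0 k"
    using Tietze_unbounded clC by metis
  have CS: "C \<subseteq> S" by (auto simp: C_def)
  \<comment> \<open>The distance to \<open>C\<close>, made positive when \<open>C\<close> is empty, where \<open>infdist\<close> is \<open>0\<close>.\<close>
  define \<delta> where "\<delta> k = (if C = {} then 1 else infdist k C)" for k
  have \<delta>_pos: "\<delta> k > 0" if "k \<in> S - C" for k
  proof (cases "C = {}")
    case False
    obtain Z where Z: "closed Z" "C = S \<inter> Z" using clC by (auto simp: closedin_closed)
    have "closure C \<subseteq> Z" using Z by (simp add: closure_minimal)
    then have "k \<notin> closure C" using that Z by blast
    then show ?thesis using False in_closure_iff_infdist_zero[OF False, of k] infdist_nonneg[of k C]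
      by (auto simp: \<delta>_def)
  qed (simp add: \<delta>_def)
  have "\<exists>r T. r \<in> \<phi> k \<and> \<bar>r - e k\<bar> < infdist (e k) (\<phi> k) + \<delta> k \<and> open T \<and> k \<in> T \<and>
           T \<subseteq> ball k (\<delta> k / 2) \<and> (\<forall>k'\<in>T \<inter> S. r \<in> \<phi> k')" if k: "k \<in> S - C" for k
  proof -
    have nek: "\<phi> k \<noteq> {}" using ne k by blast
    have "(INF a\<in>\<phi> k. dist (e k) a) < infdist (e k) (\<phi> k) + \<delta> k"
      using \<delta>_pos[OF k] infdist_notempty[OF nek] by simp
    then obtain a where a: "a \<in> \<phi> k" "dist (e k) a < infdist (e k) (\<phi> k) + \<delta> k"
      using cINF_less_iff[OF nek, of "dist (e k)" "infdist (e k) (\<phi> k) + \<delta> k"] by auto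
    have "\<phi> k \<noteq> {a}" using k unfolding C_def by blast
    then obtain b where b: "b \<in> \<phi> k" "b \<noteq> a" using a by blast
    \<comment> \<open>A point of \<open>\<phi> k\<close> near \<open>e k\<close> need not be interior, but interior points are arbitrarily close to it.\<close>
    define I where "I = {min a b<..<max a b}"
    have I: "I \<subseteq> \<phi> k"
    proof
      fix z assume "z \<in> I"
      then show "z \<in> \<phi> k"
        using mem_is_interval_1_I[OF iv a(1) b(1), of z] mem_is_interval_1_I[OF iv b(1) a(1), of z] k
        by (cases "a \<le> b") (auto simp: I_def)
    qed
    have "a \<in> closure I" unfolding I_def using b(2) by (subst closure_greaterThanLessThan) auto
    then obtain r where r: "r \<in> I" "dist r a < infdist (e k) (\<phi> k) + \<delta> k - dist (e k) a"
      using a(2) by (meson closure_approachable diff_gt_0_iff_gt)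
    define T0 where "T0 = {k \<in> S. \<phi> k \<inter> {..<r} \<noteq> {}} \<inter> {k \<in> S. \<phi> k \<inter> {r<..} \<noteq> {}}"
    have "openin (top_of_set S) T0" unfolding T0_def by (intro openin_Int lscD) auto
    then obtain T where T: "open T" "T0 = S \<inter> T" by (auto simp: openin_open)
    have "k \<in> T0" using r(1) a b k unfolding T0_def I_def by (auto simp: min_def max_def split: if_splits)
    moreover have "r \<in> \<phi> k'" if "k' \<in> T0" for k'
    proof -
      obtain y z where "k' \<in> S" "y \<in> \<phi> k'" "y < r" "z \<in> \<phi> k'" "r < z" using \<open>k' \<in> T0\<close> by (auto simp: T0_def)
      then show ?thesis using mem_is_interval_1_I[OF iv, of k' y z r] by simp
    qed
    moreover have "\<bar>r - e k\<bar> < infdist (e k) (\<phi> k) + \<delta> k"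
      using r(2) by (auto simp: dist_real_def)
    ultimately show ?thesis using T I r(1) \<delta>_pos[OF k]
      by (intro exI[of _ r] exI[of _ "T \<inter> ball k (\<delta> k / 2)"]) auto
  qed
  then obtain r T where rT: "\<And>k. k \<in> S - C \<Longrightarrow> r k \<in> \<phi> k \<and> \<bar>r k - e k\<bar> < infdist (e k) (\<phi> k) + \<delta> k \<and>
      open (T k) \<and> k \<in> T k \<and> T k \<subseteq> ball k (\<delta> k / 2) \<and> (\<forall>k'\<in>T k \<inter> S. r k \<in> \<phi> k')"
    by metis
  have "S - C \<subseteq> \<Union>(T ` (S - C))" using rT by blast
  then obtain \<C> where cov: "S - C \<subseteq> \<Union>\<C>"
    and nb: "\<And>U. U \<in> \<C> \<Longrightarrow> open U \<and> (\<exists>V. V \<in> T ` (S - C) \<and> U \<subseteq> V)"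
    and fin: "\<And>x. x \<in> S - C \<Longrightarrow> \<exists>V. open V \<and> x \<in> V \<and> finite {U. U \<in> \<C> \<and> U \<inter> V \<noteq> {}}"
    by (rule paracompact) (use rT in auto)
  from nb have "\<forall>U\<in>\<C>. \<exists>k. k \<in> S - C \<and> U \<subseteq> T k" by blast
  then obtain c where c: "\<And>U. U \<in> \<C> \<Longrightarrow> c U \<in> S - C \<and> U \<subseteq> T (c U)" by metis
  obtain H :: "['k set, 'k] \<Rightarrow> real"
    where Hcont: "\<And>Z. Z \<in> \<C> \<Longrightarrow> continuous_on (S - C) (H Z)"
      and Hge0: "\<And>Z x. \<lbrakk>Z \<in> \<C>; x \<in> S - C\<rbrakk> \<Longrightarrow> 0 \<le> H Z x"
      and Heq0: "\<And>x Z. \<lbrakk>Z \<in> \<C>; x \<in> S - C; x \<notin> Z\<rbrakk> \<Longrightarrow> H Z x = 0"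
      and H1: "\<And>x. x \<in> S - C \<Longrightarrow> supp_sum (\<lambda>W. H W x) \<C> = 1"
      and Hfin: "\<And>x. x \<in> S - C \<Longrightarrow> \<exists>V. open V \<and> x \<in> V \<and> finite {U \<in> \<C>. \<exists>x\<in>V. H U x \<noteq> 0}"
    by (rule subordinate_partition_of_unity [OF cov _ fin]) (use nb in auto)
  define s where "s x = (if x \<in> C then s0 x else supp_sum (\<lambda>U. H U x *\<^sub>R r (c U)) \<C>)" for x
  have average: "s x \<in> K" if "x \<in> S - C" "convex K" "\<And>U. U \<in> \<C> \<Longrightarrow> x \<in> U \<Longrightarrow> r (c U) \<in> K" for x K
  proof -
    have "supp_sum (\<lambda>U. H U x *\<^sub>R r (c U)) \<C> \<in> K"
    proof (rule convex_supp_sum[OF that(2) H1[OF that(1)]])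
      fix U assume "U \<in> \<C>"
      then show "0 \<le> H U x \<and> (H U x = 0 \<or> r (c U) \<in> K)" using that Hge0 Heq0 by metis
    qed
    then show ?thesis using that by (simp add: s_def)
  qed
  show ?thesis
  proof
    fix k assume k: "k \<in> S"
    show "s k \<in> \<phi> k"
    proof (cases "k \<in> C")
      case False
      then have "k \<in> S - C" using k by blast
      then show ?thesis
        by (rule average) (use cvx k rT c in \<open>auto, blast\<close>)
    qed (use s0 in \<open>auto simp: s_def\<close>)
  next
    show "continuous_on S s"
      unfolding continuous_on_eq_continuous_within
    proof
      fix a assume a: "a \<in> S"
      show "continuous (at a within S) s"
      proof (cases "a \<in> C")
        case False
        then obtain N where N: "open N" "a \<in> N" and finN: "finite {U \<in> \<C>. \<exists>x\<in>N. H U x \<noteq> 0}"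
          using Hfin a by blast
        have oSC: "openin (top_of_set S) (S - C)" using clC by (simp add: openin_diff)
        have HS: "continuous (at a within S) (H Z)" if "Z \<in> \<C>" for Z
        proof -
          have "continuous (at a within S - C) (H Z)"
            using Hcont[OF that] a False by (simp add: continuous_on_eq_continuous_within)
          moreover obtain V where "open V" "S - C = S \<inter> V" using oSC by (auto simp: openin_open)
          then have "at a within S - C = at a within S"
            using a False by (intro at_within_nhd[of a V]) auto
          ultimately show ?thesis by simp
        qed
        show ?thesis
        proof (rule continuous_transform_within_openin)
          show "continuous (at a within S) (\<lambda>x. \<Sum>U\<in>{U \<in> \<C>. \<exists>x\<in>N. H U x \<noteq> 0}. H U x *\<^sub>R r (c U))"
            by (force intro: continuous_intros HS)
          show "openin (top_of_set S) ((S - C) \<inter> N)" using N oSC openin_trans by blast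
          show "a \<in> (S - C) \<inter> N" using a False N by blast
          show "(\<Sum>U\<in>{U \<in> \<C>. \<exists>x\<in>N. H U x \<noteq> 0}. H U x *\<^sub>R r (c U)) = s x" if "x \<in> (S - C) \<inter> N" for x
            using that
            by (auto simp: s_def supp_sum_def support_on_def intro: sum.mono_neutral_right[OF finN])
        qed
      next
        case True
        have sa: "s a = e a" "\<phi> a = {e a}" using True e s0 by (auto simp: s_def)
        have "\<exists>d>0. \<forall>x\<in>S. dist x a < d \<longrightarrow> dist (s x) (s a) < \<eta>" if \<eta>: "\<eta> > 0" for \<eta>
        proof -
          obtain d1 where d1: "d1 > 0" "\<And>x. x \<in> S \<Longrightarrow> dist x a < d1 \<Longrightarrow> dist (e x) (e a) < \<eta>/8"
            using e(1) a \<eta> unfolding continuous_on_iff by (metis divide_pos_pos zero_less_numeral)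
          have "openin (top_of_set S) {k \<in> S. \<phi> k \<inter> ball (e a) (\<eta>/8) \<noteq> {}}" by (intro lscD) auto
          moreover have "a \<in> {k \<in> S. \<phi> k \<inter> ball (e a) (\<eta>/8) \<noteq> {}}" using a \<eta> sa by auto
          ultimately obtain d2 where d2: "d2 > 0"
            "\<And>x. x \<in> S \<Longrightarrow> dist x a < d2 \<Longrightarrow> \<phi> x \<inter> ball (e a) (\<eta>/8) \<noteq> {}"
            unfolding openin_euclidean_subtopology_iff by blast
          have m: "infdist (e x) (\<phi> x) < \<eta>/4" if x: "x \<in> S" "dist x a < min d1 d2" for x
          proof -
            obtain y where y: "y \<in> \<phi> x" "dist (e a) y < \<eta>/8" using d2(2) x by fastforce
            have "infdist (e x) (\<phi> x) \<le> dist (e x) y" using y(1) by (rule infdist_le)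
            also have "\<dots> \<le> dist (e x) (e a) + dist (e a) y" by (rule dist_triangle)
            also have "\<dots> < \<eta>/8 + \<eta>/8" using d1 x y by (intro add_strict_mono) auto
            finally show ?thesis by simp
          qed
          define d where "d = Min {d1/2, d2/2, \<eta>/8}"
          have d: "d > 0" "d \<le> d1/2" "d \<le> d2/2" "d \<le> \<eta>/8" using d1(1) d2(1) \<eta> by (auto simp: d_def)
          have near: "dist (s x) (s a) < \<eta>" if x: "x \<in> S" "dist x a < d" for x
          proof (cases "x \<in> C")
            case True
            then have "s x = e x" using e by (simp add: s_def)
            then have "dist (s x) (s a) < \<eta>/8" using d1(2)[OF x(1)] x d sa by auto
            then show ?thesis using \<eta> by simp
          next
            case False
            have "s x \<in> ball (e a) \<eta>"
            proof (rule average)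
              fix U assume U: "U \<in> \<C>" "x \<in> U"
              \<comment> \<open>The centre \<open>c U\<close> of a contributing neighbourhood is at most twice as far from \<open>a\<close> as \<open>x\<close> is.\<close>
              let ?k = "c U"
              have k: "?k \<in> S - C" "dist ?k x < \<delta> ?k / 2" using c[OF U(1)] U(2) rT[of ?k] by auto
              have \<delta>k: "\<delta> ?k \<le> dist ?k a" using True by (auto simp: \<delta>_def intro: infdist_le)
              have ka: "dist ?k a \<le> 2 * dist x a" "\<delta> ?k \<le> 2 * dist x a"
                using k(2) \<delta>k dist_triangle[of ?k a x] by auto
              then have "dist ?k a < min d1 d2" using x d by auto
              then have "infdist (e ?k) (\<phi> ?k) < \<eta>/4" "dist (e ?k) (e a) < \<eta>/8"
                using m d1(2) k(1) by auto
              moreover have "\<delta> ?k \<le> \<eta>/4" using ka(2) x d by auto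
              moreover have "\<bar>r ?k - e ?k\<bar> < infdist (e ?k) (\<phi> ?k) + \<delta> ?k" using rT k(1) by blast
              ultimately have "\<bar>r ?k - e a\<bar> < \<eta>" using \<eta> unfolding dist_real_def by linarith
              then show "r ?k \<in> ball (e a) \<eta>" by (simp add: dist_real_def abs_minus_commute)
            qed (use x False in auto)
            then show ?thesis using sa by (simp add: dist_commute)
          qed
          then show ?thesis using d(1) by blast
        qed
        then show ?thesis unfolding continuous_within_eps_delta by blast
      qed
    qed
  qed
qed

section \<open>Relative lifting\<close>

text \<open>
  Lifts are exact, not just up to homotopy, and may be prescribed on an arbitrary closed set. So
  homotopies with given ends are covered by the same notion.
\<close>

definition lifts_over :: "'k::topological_space set \<Rightarrow> 'a topology \<Rightarrow> 'b topology \<Rightarrow> ('a \<Rightarrow> 'b) \<Rightarrow> bool"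
  where "lifts_over S X Y q \<longleftrightarrow>
    (\<forall>B g b. closedin (top_of_set S) B \<longrightarrow> continuous_map (top_of_set S) Y g \<longrightarrow>
       continuous_map (top_of_set B) X b \<longrightarrow> (\<forall>k\<in>B. q (b k) = g k) \<longrightarrow>
       (\<exists>G. continuous_map (top_of_set S) X G \<and> (\<forall>k\<in>S. q (G k) = g k) \<and> (\<forall>k\<in>B. G k = b k)))"

text \<open>The quotient lifting.\<close>

text \<open>
  As \<open>f\<close> is injective on the fibres of \<open>q\<close>, a lift of \<open>g\<close> is determined by its levels, so it suffices to
  select levels continuously; the partial lift is taken care of by replacing the interval of
  available levels by a single level over \<open>B\<close>. The hypothesis \<open>loc\<close> turns continuity of the levels into
  continuity of the lift: near \<open>k\<close>, the fibre over \<open>g k'\<close> meets every neighbourhood of \<open>G k\<close> since \<open>q\<close> is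
  open, and the point of this fibre at the level \<open>s k'\<close> cannot be far away.
\<close>

lemma relative_lifting:
  fixes S :: "'k::{metric_space,second_countable_topology} set"
    and X :: "'a topology" and f :: "'a \<Rightarrow> real" and q :: "'a \<Rightarrow> 'b"
  assumes f: "continuous_map X euclideanreal f"
    and q: "open_map X Y q" "q ` topspace X = topspace Y"
    and inj: "\<And>y. inj_on f {x \<in> topspace X. q x = y}"
    and cvx: "\<And>y. convex (f ` {x \<in> topspace X. q x = y})"
    and loc: "\<And>y W. openin X W \<Longrightarrow> y \<in> W \<Longrightarrow> \<exists>W' \<delta>. openin X W' \<and> y \<in> W' \<and> 0 < \<delta> \<and>
       (\<forall>x\<in>W'. \<forall>z\<in>topspace X. q z = q x \<and> \<bar>f z - f y\<bar> < \<delta> \<longrightarrow> z \<in> W)"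
  shows "lifts_over S X Y q"
  unfolding lifts_over_def
proof (intro allI impI)
  fix B g b
  assume B: "closedin (top_of_set S) B" and g: "continuous_map (top_of_set S) Y g"
    and b': "continuous_map (top_of_set B) X b" "\<forall>k\<in>B. q (b k) = g k"
  note b = b'(1) b'(2)[rule_format]
  define \<phi> where "\<phi> k = (if k \<in> B then {f (b k)} else f ` {x \<in> topspace X. q x = g k})" for k
  have BS: "B \<subseteq> S" using closedin_subset[OF B] by simp
  have gS: "g k \<in> topspace Y" if "k \<in> S" for k using continuous_map_funspace[OF g] that by auto
  have bX: "b k \<in> topspace X" if "k \<in> B" for k using continuous_map_funspace[OF b(1)] that by auto
  have meets: "openin (top_of_set S) {k \<in> S. \<exists>x\<in>U. q x = g k}" if "openin X U" for U
  proof -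
    have "openin Y (q ` U)" using q(1) that by (simp add: open_map_def)
    then have "openin (top_of_set S) {k \<in> topspace (top_of_set S). g k \<in> q ` U}"
      by (rule openin_continuous_map_preimage[OF g])
    moreover have "{k \<in> topspace (top_of_set S). g k \<in> q ` U} = {k \<in> S. \<exists>x\<in>U. q x = g k}" by force
    ultimately show ?thesis by simp
  qed
  have fb: "continuous_on B (f \<circ> b)"
    using continuous_map_compose[OF b(1) f] by simp
  have lsc: "lower_hemicontinuous_on S \<phi>"
    unfolding lower_hemicontinuous_on_def
  proof (intro allI impI)
    fix U :: "real set" assume U: "open U"
    have "openin X {x \<in> topspace X. f x \<in> U}" 
      using openin_continuous_map_preimage[OF f] U by simp
    note m = meets[OF this]
    obtain V where V: "open V" "B \<inter> (f \<circ> b) -` U = B \<inter> V"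
      using continuous_openin_preimage_gen[OF fb U] by (auto simp: openin_open)
    have *: "{k \<in> S. \<phi> k \<inter> U \<noteq> {}} = {k \<in> S. \<exists>x\<in>{x \<in> topspace X. f x \<in> U}. q x = g k} \<inter> ((S - B) \<union> (S \<inter> V))"
    proof (rule Set.set_eqI)
      fix k
      have "k \<in> B \<Longrightarrow> f (b k) \<in> U \<longleftrightarrow> k \<in> V" using V(2) by auto
      then show "k \<in> {k \<in> S. \<phi> k \<inter> U \<noteq> {}} \<longleftrightarrow> k \<in> {k \<in> S. \<exists>x\<in>{x \<in> topspace X. f x \<in> U}. q x = g k} \<inter> ((S - B) \<union> (S \<inter> V))"
        using b(2) bX inj_onD[OF inj] by (cases "k \<in> B") (auto simp: \<phi>_def)
    qed
    show "openin (top_of_set S) {k \<in> S. \<phi> k \<inter> U \<noteq> {}}"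
      unfolding * using B openin_open_Int[OF V(1)] by (intro openin_Int[OF m] openin_Un) (auto simp: openin_diff)
  qed
  obtain s where s: "continuous_on S s" "\<And>k. k \<in> S \<Longrightarrow> s k \<in> \<phi> k"
  proof (rule convex_selection[OF lsc])
    fix k assume k: "k \<in> S"
    show "convex (\<phi> k)" using cvx by (simp add: \<phi>_def)
    obtain x where "x \<in> topspace X" "g k = q x" using gS[OF k] q(2) by (metis imageE)
    then show "\<phi> k \<noteq> {}" by (auto simp: \<phi>_def)
  qed blast
  have "\<exists>x. x \<in> topspace X \<and> q x = g k \<and> f x = s k" if "k \<in> S" for k
    using s(2)[OF that] b(2) bX by (cases "k \<in> B") (auto simp: \<phi>_def)
  then obtain G where G: "\<And>k. k \<in> S \<Longrightarrow> G k \<in> topspace X \<and> q (G k) = g k \<and> f (G k) = s k"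
    by metis
  show "\<exists>G. continuous_map (top_of_set S) X G \<and> (\<forall>k\<in>S. q (G k) = g k) \<and> (\<forall>k\<in>B. G k = b k)"
  proof (intro exI conjI ballI)
    show "q (G k) = g k" if "k \<in> S" for k using G that by blast
    show "G k = b k" if "k \<in> B" for k
      using G[of k] s(2)[of k] that BS b(2)[OF that] bX[OF that]
      by (intro inj_onD[OF inj[of "g k"]]) (auto simp: \<phi>_def)
    show "continuous_map (top_of_set S) X G"
      unfolding continuous_map_def
    proof (intro conjI allI impI)
      show "G \<in> topspace (top_of_set S) \<rightarrow> topspace X" using G by auto
      fix W assume W: "openin X W"
      show "openin (top_of_set S) {k \<in> topspace (top_of_set S). G k \<in> W}"
      proof (subst openin_subopen, clarsimp)
        fix k assume k: "k \<in> S" "G k \<in> W"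
        obtain W' \<delta> where W': "openin X W'" "G k \<in> W'" "0 < \<delta>"
          "\<And>x z. x \<in> W' \<Longrightarrow> z \<in> topspace X \<Longrightarrow> q z = q x \<Longrightarrow> \<bar>f z - f (G k)\<bar> < \<delta> \<Longrightarrow> z \<in> W"
          using loc[OF W k(2)] by metis
        let ?T = "{k' \<in> S. \<exists>x\<in>W'. q x = g k'} \<inter> (S \<inter> s -` ball (s k) \<delta>)"
        have "openin (top_of_set S) ?T"
          using meets[OF W'(1)] s(1) by (intro openin_Int continuous_openin_preimage_gen) auto
        moreover have "k \<in> ?T" using k W' G by force
        moreover have "G k' \<in> W" if k': "k' \<in> ?T" for k'
        proof -
          obtain x where "x \<in> W'" "q x = g k'" using k' by auto
          then show ?thesis using k' G[of k'] G[OF k(1)]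
            by (intro W'(4)[of x]) (auto simp: dist_real_def abs_minus_commute)
        qed
        ultimately show "\<exists>T. openin (top_of_set S) T \<and> k \<in> T \<and> T \<subseteq> {k \<in> S. G k \<in> W}"
          by blast
      qed
    qed
  qed
qed

section \<open>Weak homotopy equivalences from relative lifting\<close>

text \<open>
  The type \<open>nat \<Rightarrow> real\<close> is a separable metric space, so this makes the cubes, and the cylinders over
  them, accessible to selections.
\<close>

lemma cube_eq_top_of_set: "cube n = top_of_set (PiE {..<n} (\<lambda>_. {0..1}))"
proof -
  let ?P = "PiE {..<n} (\<lambda>_. {0..1::real})"
  have top: "topspace (cube n) = ?P" by (simp add: cube_def)
  have 1: "continuous_map (top_of_set ?P) (cube n) id"
    unfolding cube_def
  proof (subst continuous_map_componentwise, intro conjI ballI)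
    fix k assume "k \<in> {..<n}"
    then show "continuous_map (top_of_set ?P) (top_of_set {0..1}) (\<lambda>x. id x k)"
      by (auto simp: continuous_map_in_subtopology PiE_def Pi_def intro!: continuous_on_product_then_coordinatewise continuous_on_id)
  qed (auto simp: PiE_def)
  have "continuous_map (cube n) (product_topology (\<lambda>i. euclideanreal) UNIV) id"
  proof (subst continuous_map_componentwise_UNIV, intro allI)
    fix k
    show "continuous_map (cube n) euclideanreal (\<lambda>x. id x k)"
    proof (cases "k < n")
      case True
      then have "continuous_map (cube n) (top_of_set {0..1}) (\<lambda>x. x k)"
        unfolding cube_def by (intro continuous_map_product_projection) auto
      then show ?thesis by (simp add: continuous_map_in_subtopology)
    next
      case False
      then show ?thesis
        by (intro continuous_map_eq[OF continuous_map_const[THEN iffD2], of _ undefined])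
           (auto simp: top PiE_def extensional_def)
    qed
  qed
  then have 2: "continuous_map (cube n) (top_of_set ?P) id"
    by (simp add: euclidean_product_topology continuous_map_in_subtopology top image_subset_iff)
  show ?thesis
  proof (rule topology_eq[THEN iffD2], intro allI iffI)
    fix U assume U: "openin (cube n) U"
    then have "{x \<in> ?P. id x \<in> U} = U" using openin_subset[OF U] top by auto
    then show "openin (top_of_set ?P) U"
      using openin_continuous_map_preimage[OF 1 U] by simp
  next
    fix U assume U: "openin (top_of_set ?P) U"
    then have "{x \<in> topspace (cube n). id x \<in> U} = U" using openin_subset[OF U] top by auto
    then show "openin (cube n) U"
      using openin_continuous_map_preimage[OF 2 U] by simp
  qed
qed

lemma topspace_cube: "topspace (cube n) = PiE {..<n} (\<lambda>_. {0..1})"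
  by (simp add: cube_def)

lemma cube_boundary_subset: "cube_boundary n \<subseteq> topspace (cube n)"
  by (auto simp: cube_boundary_def)

lemma closedin_cube_boundary: "closedin (cube n) (cube_boundary n)"
proof -
  have "cube_boundary n = (\<Union>i<n. {t \<in> topspace (cube n). t i \<in> {0,1}})"
    by (auto simp: cube_boundary_def)
  moreover have "closedin (cube n) {t \<in> topspace (cube n). t i \<in> {0,1}}" if "i < n" for i
  proof (rule closedin_continuous_map_preimage)
    show "continuous_map (cube n) (top_of_set {0..1}) (\<lambda>t. t i)"
      unfolding cube_def using that by (intro continuous_map_product_projection) auto
    show "closedin (top_of_set {0..1}) {0, 1::real}" by (auto intro: closed_subset)
  qed
  ultimately show ?thesis by (auto intro!: closedin_Union)
qed

abbreviation spheroid_homotopic ::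
  "nat \<Rightarrow> 'a topology \<Rightarrow> 'a \<Rightarrow> ((nat \<Rightarrow> real) \<Rightarrow> 'a) \<Rightarrow> ((nat \<Rightarrow> real) \<Rightarrow> 'a) \<Rightarrow> bool" where
  "spheroid_homotopic n X x \<equiv> homotopic_with (\<lambda>k. k ` cube_boundary n \<subseteq> {x}) (cube n) X"

lemma spheroid_homotopic:
  "spheroid_homotopic n X x g h \<longleftrightarrow>
     (\<exists>H. continuous_map (prod_topology (top_of_set {0..1::real}) (cube n)) X H \<and>
        (\<forall>k\<in>topspace (cube n). H (0, k) = g k) \<and> (\<forall>k\<in>topspace (cube n). H (1, k) = h k) \<and>
        (\<forall>t\<in>{0..1}. \<forall>k\<in>cube_boundary n. H (t, k) = x))"
proof (subst homotopic_with)
  show "(u ` cube_boundary n \<subseteq> {x}) = (w ` cube_boundary n \<subseteq> {x})"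
    if "\<And>k. k \<in> topspace (cube n) \<Longrightarrow> u k = w k" for u w :: "(nat \<Rightarrow> real) \<Rightarrow> 'a"
    using that cube_boundary_subset[of n] by (auto simp: image_subset_iff subset_iff)
qed (simp add: image_subset_iff)

lemma spheroid_homotopic_spheroids:
  assumes "spheroid_homotopic n X x g h"
  shows "g \<in> spheroids n X x" "h \<in> spheroids n X x"
  using homotopic_with_imp_continuous_maps[OF assms] homotopic_with_imp_property[OF assms]
  by (auto simp: spheroids_def)

lemma spheroid_homotopic_refl: "g \<in> spheroids n X x \<Longrightarrow> spheroid_homotopic n X x g g"
  by (simp add: spheroids_def)

lemma spheroid_homotopic_if_equal_on_cube:
  assumes "g \<in> spheroids n X x" "\<And>k. k \<in> topspace (cube n) \<Longrightarrow> g k = h k"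
  shows "spheroid_homotopic n X x g h"
  by (rule homotopic_with_equal)
     (use assms cube_boundary_subset[of n] in \<open>auto simp: spheroids_def image_subset_iff subset_iff\<close>)

lemma mem_homotopy_class: "h \<in> homotopy_class n X x g \<longleftrightarrow> spheroid_homotopic n X x g h"
  by (simp add: homotopy_class_def)

lemma homotopy_class_eq_iff:
  assumes "g \<in> spheroids n X x"
  shows "homotopy_class n X x g = homotopy_class n X x h \<longleftrightarrow> spheroid_homotopic n X x g h"
proof
  assume "homotopy_class n X x g = homotopy_class n X x h"
  then have "spheroid_homotopic n X x h g"
    using spheroid_homotopic_refl[OF assms] unfolding set_eq_iff mem_homotopy_class by blast
  then show "spheroid_homotopic n X x g h" by (rule homotopic_with_symD)
next
  assume "spheroid_homotopic n X x g h"
  then show "homotopy_class n X x g = homotopy_class n X x h"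
    unfolding set_eq_iff mem_homotopy_class
    by (blast intro: homotopic_with_trans homotopic_with_symD)
qed

lemma spheroids_compose:
  assumes "continuous_map X Y q" "g \<in> spheroids n X x"
  shows "q \<circ> g \<in> spheroids n Y (q x)"
  using assms by (auto simp: spheroids_def intro: continuous_map_compose)

lemma spheroid_homotopic_compose:
  assumes "continuous_map X Y q" "spheroid_homotopic n X x g h"
  shows "spheroid_homotopic n Y (q x) (q \<circ> g) (q \<circ> h)"
  by (rule homotopic_with_compose_continuous_map_left[OF assms(2,1)]) auto

text \<open>
  The induced map is a union over all representatives, which all contribute the same class.
\<close>

lemma induced_map_homotopy_class:
  assumes q: "continuous_map X Y q" and g: "g \<in> spheroids n X x"
  shows "induced_map n Y q x (homotopy_class n X x g) = homotopy_class n Y (q x) (q \<circ> g)"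
proof -
  have "homotopy_class n Y (q x) (q \<circ> g') = homotopy_class n Y (q x) (q \<circ> g)"
    if "g' \<in> homotopy_class n X x g" for g'
    using spheroid_homotopic_compose[OF q] that homotopy_class_eq_iff[OF spheroids_compose[OF q g]]
    unfolding mem_homotopy_class by metis
  moreover have "g \<in> homotopy_class n X x g"
    unfolding mem_homotopy_class using g by (rule spheroid_homotopic_refl)
  ultimately show ?thesis unfolding induced_map_def by blast
qed

text \<open>
  The two homotopies are glued along the hyperplane where the first coordinate is \<open>1/2\<close>. Both of them
  are constantly \<open>x\<close> there, because the reparametrisations send this hyperplane to the boundary of
  the cube.
\<close>

lemma spheroid_homotopic_concat:
  assumes n: "1 \<le> n" and g: "spheroid_homotopic n X x g g'" and h: "spheroid_homotopic n X x h h'"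
  shows "spheroid_homotopic n X x (spheroid_concat g h) (spheroid_concat g' h')"
proof -
  let ?I = "top_of_set {0..1::real}" and ?C = "cube n"
  let ?Z = "prod_topology ?I ?C"
  obtain G where G: "continuous_map ?Z X G"
    "\<And>k. k \<in> topspace ?C \<Longrightarrow> G (0, k) = g k" "\<And>k. k \<in> topspace ?C \<Longrightarrow> G (1, k) = g' k"
    "\<And>t k. t \<in> {0..1} \<Longrightarrow> k \<in> cube_boundary n \<Longrightarrow> G (t, k) = x"
    using g unfolding spheroid_homotopic by auto
  obtain H where H: "continuous_map ?Z X H"
    "\<And>k. k \<in> topspace ?C \<Longrightarrow> H (0, k) = h k" "\<And>k. k \<in> topspace ?C \<Longrightarrow> H (1, k) = h' k"
    "\<And>t k. t \<in> {0..1} \<Longrightarrow> k \<in> cube_boundary n \<Longrightarrow> H (t, k) = x"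
    using h unfolding spheroid_homotopic by auto
  define l where "l k = k(0 := 2 * k 0)" for k :: "nat \<Rightarrow> real"
  define r where "r k = k(0 := 2 * k 0 - 1)" for k :: "nat \<Rightarrow> real"
  have l_in: "l k \<in> topspace ?C" if "k \<in> topspace ?C" "k 0 \<le> 1/2" for k
    using that n by (auto simp: l_def topspace_cube PiE_def Pi_def extensional_def)
  have r_in: "r k \<in> topspace ?C" if "k \<in> topspace ?C" "1/2 \<le> k 0" for k
    using that n by (auto simp: r_def topspace_cube PiE_def Pi_def extensional_def)
  have l_bd: "l k \<in> cube_boundary n" if k: "k \<in> topspace ?C" "k 0 \<le> 1/2" 
      "k \<in> cube_boundary n \<or> k 0 = 1/2" for k
  proof -
    have "\<exists>i<n. l k i = 0 \<or> l k i = 1"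
    proof (cases "k 0 = 0 \<or> k 0 = 1/2")
      case True
      then show ?thesis using n by (intro exI[of _ 0]) (auto simp: l_def)
    next
      case False
      then obtain i where "i < n" "k i = 0 \<or> k i = 1" using k(3) by (auto simp: cube_boundary_def)
      moreover have "i \<noteq> 0" using False k(2) calculation by (cases "i = 0") auto
      ultimately show ?thesis by (intro exI[of _ i]) (auto simp: l_def)
    qed
    then show ?thesis using l_in k by (auto simp: cube_boundary_def)
  qed
  have r_bd: "r k \<in> cube_boundary n" if k: "k \<in> topspace ?C" "1/2 \<le> k 0" 
      "k \<in> cube_boundary n \<or> k 0 = 1/2" for k
  proof -
    have "\<exists>i<n. r k i = 0 \<or> r k i = 1"
    proof (cases "k 0 = 1 \<or> k 0 = 1/2")
      case True
      then show ?thesis using n by (intro exI[of _ 0]) (auto simp: r_def)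
    next
      case False
      then obtain i where "i < n" "k i = 0 \<or> k i = 1" using k(3) by (auto simp: cube_boundary_def)
      moreover have "i \<noteq> 0" using False k(2) calculation by (cases "i = 0") auto
      ultimately show ?thesis by (intro exI[of _ i]) (auto simp: r_def)
    qed
    then show ?thesis using r_in k by (auto simp: cube_boundary_def)
  qed
  have proj: "continuous_map ?Z euclideanreal (\<lambda>z. snd z i)" if "i < n" for i
  proof -
    have "continuous_map ?C (top_of_set {0..1}) (\<lambda>k. k i)"
      unfolding cube_def using that by (intro continuous_map_product_projection) auto
    then have "continuous_map ?C euclideanreal (\<lambda>k. k i)"
      by (simp add: continuous_map_in_subtopology)
    then have "continuous_map ?Z euclideanreal ((\<lambda>k. k i) \<circ> snd)"
      by (rule continuous_map_compose[OF continuous_map_snd])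
    then show ?thesis by (simp add: o_def)
  qed
  have reparam: "continuous_map (subtopology ?Z S) ?Z (\<lambda>z. (fst z, m (snd z)))"
    if S: "\<And>z. z \<in> S \<Longrightarrow> z \<in> topspace ?Z \<Longrightarrow> m (snd z) \<in> topspace ?C"
      and m: "m = (\<lambda>k. k(0 := 2 * k 0 - c))" for S m and c :: real
  proof (rule continuous_map_pairedI)
    show "continuous_map (subtopology ?Z S) ?I fst"
      by (intro continuous_map_from_subtopology continuous_map_fst)
    show "continuous_map (subtopology ?Z S) ?C (\<lambda>z. m (snd z))"
      unfolding cube_def
    proof (subst continuous_map_componentwise, intro conjI ballI)
      show "(\<lambda>z. m (snd z)) ` topspace (subtopology (prod_topology ?I (product_topology (\<lambda>_. ?I) {..<n})) S) \<subseteq> extensional {..<n}"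
        using S unfolding cube_def by (fastforce simp: PiE_def)
      fix i assume i: "i \<in> {..<n}"
      have base: "continuous_map (subtopology ?Z S) euclideanreal (\<lambda>z. snd z j)" if "j < n" for j
        using proj[OF that] by (rule continuous_map_from_subtopology)
      have "continuous_map (subtopology ?Z S) euclideanreal (\<lambda>z. 2 * snd z 0 - c)"
        using n by (intro continuous_intros base) auto
      then have "continuous_map (subtopology ?Z S) euclideanreal (\<lambda>z. if i = 0 then 2 * snd z 0 - c else snd z i)"
        using i base[of i] by (cases "i = 0") auto
      moreover have "m (snd z) i \<in> {0..1}" if "z \<in> topspace (subtopology ?Z S)" for z
        using S[of z] that i unfolding topspace_cube by (auto simp: PiE_def Pi_def)
      ultimately have "continuous_map (subtopology ?Z S) ?I (\<lambda>z. m (snd z) i)"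
        unfolding continuous_map_in_subtopology m 
        by (auto simp: fun_upd_def image_subset_iff cong: if_cong)
      then show "continuous_map (subtopology (prod_topology ?I (product_topology (\<lambda>_. ?I) {..<n})) S) ?I (\<lambda>z. m (snd z) i)"
        by (simp add: cube_def)
    qed
  qed
  define K where "K z = (if snd z 0 \<le> 1/2 then G (fst z, l (snd z)) else H (fst z, r (snd z)))" for z
  have "continuous_map ?Z X K"
    unfolding K_def
  proof (rule continuous_map_cases_le)
    show "continuous_map ?Z euclideanreal (\<lambda>z. snd z 0)" using proj n by simp
    show "continuous_map ?Z euclideanreal (\<lambda>z. 1/2)" by simp
    have "continuous_map (subtopology ?Z {z \<in> topspace ?Z. snd z 0 \<le> 1 / 2}) ?Z (\<lambda>z. (fst z, l (snd z)))"
    proof (rule reparam)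
      show "l = (\<lambda>k. k(0 := 2 * k 0 - 0))" by (simp add: l_def fun_eq_iff)
    qed (simp add: l_in mem_Times_iff)
    then show "continuous_map (subtopology ?Z {z \<in> topspace ?Z. snd z 0 \<le> 1 / 2}) X (\<lambda>z. G (fst z, l (snd z)))"
      using continuous_map_compose[OF _ G(1)] by (simp add: o_def)
    have "continuous_map (subtopology ?Z {z \<in> topspace ?Z. 1 / 2 \<le> snd z 0}) ?Z (\<lambda>z. (fst z, r (snd z)))"
    proof (rule reparam)
      show "r = (\<lambda>k. k(0 := 2 * k 0 - 1))" by (simp add: r_def fun_eq_iff)
    qed (simp add: r_in mem_Times_iff)
    then show "continuous_map (subtopology ?Z {z \<in> topspace ?Z. 1 / 2 \<le> snd z 0}) X (\<lambda>z. H (fst z, r (snd z)))"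
      using continuous_map_compose[OF _ H(1)] by (simp add: o_def)
    show "G (fst z, l (snd z)) = H (fst z, r (snd z))" if "z \<in> topspace ?Z" "snd z 0 = 1/2" for z
      using that by (subst G(4)[OF _ l_bd]; simp add: mem_Times_iff H(4)[OF _ r_bd])
  qed
  moreover have "K (0, k) = spheroid_concat g h k" "K (1, k) = spheroid_concat g' h' k" if "k \<in> topspace ?C" for k
    using that G(2,3)[OF l_in, of k] H(2,3)[OF r_in, of k]
    unfolding K_def spheroid_concat_def fst_conv snd_conv l_def[of k, symmetric] r_def[of k, symmetric]
    by (cases "k 0 \<le> 1/2"; simp)+
  moreover have "K (t, k) = x" if "t \<in> {0..1}" "k \<in> cube_boundary n" for t k
    using that G(4)[OF that(1) l_bd[of k]] H(4)[OF that(1) r_bd[of k]] cube_boundary_subset[of n]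
    unfolding K_def fst_conv snd_conv by (cases "k 0 \<le> 1/2") auto
  ultimately show ?thesis unfolding spheroid_homotopic by blast
qed

lemma mult_homotopy_group:
  assumes n: "1 \<le> n" and g: "g \<in> spheroids n X x" and h: "h \<in> spheroids n X x"
  shows "homotopy_class n X x g \<otimes>\<^bsub>homotopy_group n X x\<^esub> homotopy_class n X x h =
    homotopy_class n X x (spheroid_concat g h)"
proof -
  have sp: "spheroid_concat g h \<in> spheroids n X x"
    using spheroid_homotopic_concat[OF n g[THEN spheroid_homotopic_refl] h[THEN spheroid_homotopic_refl]]
    by (rule spheroid_homotopic_spheroids)
  have eq: "homotopy_class n X x (spheroid_concat g' h') = homotopy_class n X x (spheroid_concat g h)"
    if "g' \<in> homotopy_class n X x g" "h' \<in> homotopy_class n X x h" for g' h'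
    using homotopy_class_eq_iff[OF sp] spheroid_homotopic_concat[OF n] that
    unfolding mem_homotopy_class by metis
  have ne: "g \<in> homotopy_class n X x g" "h \<in> homotopy_class n X x h"
    unfolding mem_homotopy_class using g h by (simp_all only: spheroid_homotopic_refl)
  have "homotopy_class n X x g \<otimes>\<^bsub>homotopy_group n X x\<^esub> homotopy_class n X x h =
      (\<Union>g'\<in>homotopy_class n X x g. \<Union>h'\<in>homotopy_class n X x h. homotopy_class n X x (spheroid_concat g' h'))"
    by (simp add: homotopy_group_def)
  also have "\<dots> = (\<Union>g'\<in>homotopy_class n X x g. \<Union>h'\<in>homotopy_class n X x h. homotopy_class n X x (spheroid_concat g h))"
    by (intro SUP_cong refl eq)
  also have "\<dots> = homotopy_class n X x (spheroid_concat g h)" using ne by auto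
  finally show ?thesis .
qed

text \<open>
  Surjectivity comes from lifting a cube with the constant lift on its boundary. For injectivity a
  homotopy between \<open>q \<circ> g\<close> and \<open>q \<circ> h\<close> is lifted to a homotopy that is \<open>g\<close> and \<open>h\<close> on the two
  ends of the cylinder and constant on its side; as lifts are exact, nothing has to be corrected
  afterwards.
\<close>

lemma weak_homotopy_equivalence_if_lifts_over:
  fixes X :: "'a topology" and Y :: "'b topology"
  assumes q: "continuous_map X Y q"
    and lift: "\<And>S :: (nat \<Rightarrow> real) set. lifts_over S X Y q"
    and lift_homotopy: "\<And>S :: (real \<times> (nat \<Rightarrow> real)) set. lifts_over S X Y q"
  shows "weak_homotopy_equivalence X Y q"
proof -
  have inj: "spheroid_homotopic n X x g h"
    if g: "g \<in> spheroids n X x" and h: "h \<in> spheroids n X x"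
      and gh: "spheroid_homotopic n Y (q x) (q \<circ> g) (q \<circ> h)" for n x g h
  proof -
    let ?P = "PiE {..<n} (\<lambda>_. {0..1::real})"
    let ?Z = "{0..1::real} \<times> ?P"
    have Z: "prod_topology (top_of_set {0..1}) (cube n) = top_of_set ?Z"
      by (simp add: cube_eq_top_of_set)
    obtain H where H: "continuous_map (top_of_set ?Z) Y H"
      "\<And>k. k \<in> ?P \<Longrightarrow> H (0, k) = q (g k)" "\<And>k. k \<in> ?P \<Longrightarrow> H (1, k) = q (h k)"
      "\<And>t k. t \<in> {0..1} \<Longrightarrow> k \<in> cube_boundary n \<Longrightarrow> H (t, k) = q x"
      using gh unfolding spheroid_homotopic Z topspace_cube by auto
    have gx: "g k = x" "h k = x" if "k \<in> cube_boundary n" for k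
      using g h that by (auto simp: spheroids_def)
    \<comment> \<open>The two ends and the side of the cylinder, on which the lift \<open>b\<close> is prescribed.\<close>
    define E0 where "E0 = {0::real} \<times> ?P"
    define E1 where "E1 = {1::real} \<times> ?P"
    define E2 where "E2 = {0..1::real} \<times> cube_boundary n"
    define B where "B = E0 \<union> E1 \<union> E2"
    define b where "b z = (if fst z = 0 then g (snd z) else if fst z = 1 then h (snd z) else x)" for z :: "real \<times> (nat \<Rightarrow> real)"
    have cl: "closedin (top_of_set ?Z) E0" "closedin (top_of_set ?Z) E1" "closedin (top_of_set ?Z) E2"
      unfolding E0_def E1_def E2_def Z[symmetric]
      using closedin_cube_boundary[of n] closedin_topspace[of "cube n"]
      by (auto simp: closedin_prod_Times_iff topspace_cube intro!: closed_subset)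
    have clB: "closedin (top_of_set ?Z) B" using cl by (auto simp: B_def)
    have sub: "closedin (top_of_set B) E0" "closedin (top_of_set B) E1" "closedin (top_of_set B) E2"
      using cl closedin_subset[OF clB] closedin_subset_trans[of ?Z] unfolding B_def by (metis Un_upper1 Un_upper2 le_sup_iff topspace_euclidean_subtopology)+
    have snd_cont: "continuous_map (top_of_set E) X (u \<circ> snd)"
      if "u \<in> spheroids n X x" "E \<subseteq> ?Z" for u E
    proof (rule continuous_map_compose)
      have "continuous_on E snd" by (rule continuous_on_snd) (rule continuous_on_id)
      moreover have "snd ` E \<subseteq> ?P" using that(2) by force
      ultimately show "continuous_map (top_of_set E) (cube n) snd"
        by (simp only: cube_eq_top_of_set continuous_map_in_subtopology continuous_map_iff_continuous
            topspace_euclidean_subtopology image_subset_iff_funcset)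
      show "continuous_map (cube n) X u" using that(1) by (simp add: spheroids_def)
    qed
    have EZ: "E0 \<subseteq> ?Z" "E1 \<subseteq> ?Z" "E2 \<subseteq> ?Z" using cl[THEN closedin_subset] by auto
    have bE2: "b z = x" if "z \<in> E2" for z 
    proof -
      have "snd z \<in> cube_boundary n" using that unfolding E2_def by auto
      then show ?thesis unfolding b_def using gx[of "snd z"] by simp
    qed
    have b0: "b z = g (snd z)" if "z \<in> E0" for z using that by (simp add: b_def E0_def mem_Times_iff)
    have b1: "b z = h (snd z)" if "z \<in> E1" for z using that by (simp add: b_def E1_def mem_Times_iff)
    have "continuous_map (top_of_set B) X b"
    proof (rule pasting_lemma_closed[where I = "{0,1,2::nat}" and T = "\<lambda>i. [E0, E1, E2] ! i" and
          f = "\<lambda>i. [g \<circ> snd, h \<circ> snd, (\<lambda>_. x)] ! i"])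
      fix i :: nat assume i: "i \<in> {0,1,2}"
      show "closedin (top_of_set B) ([E0, E1, E2] ! i)" using i sub by auto
      have BE: "E0 \<subseteq> B" "E1 \<subseteq> B" "E2 \<subseteq> B" by (auto simp: B_def)
      have x: "E2 \<noteq> {} \<Longrightarrow> x \<in> topspace X"
        using g gx cube_boundary_subset[of n] continuous_map_image_subset_topspace[of "cube n" X g]
        by (force simp: E2_def spheroids_def)
      have const: "continuous_map (top_of_set E2) X (\<lambda>_. x)"
        using x by (cases "E2 = {}") (auto simp: continuous_map_def)
      show "continuous_map (subtopology (top_of_set B) ([E0, E1, E2] ! i)) X ([g \<circ> snd, h \<circ> snd, (\<lambda>_. x)] ! i)"
        using i snd_cont[OF g EZ(1)] snd_cont[OF h EZ(2)] BE const
        by (auto simp: subtopology_subtopology Int_absorb1)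
    next
      fix i j :: nat and z
      assume *: "i \<in> {0,1,2}" "j \<in> {0,1,2}" "z \<in> topspace (top_of_set B) \<inter> [E0, E1, E2] ! i \<inter> [E0, E1, E2] ! j"
      have v: "([g \<circ> snd, h \<circ> snd, (\<lambda>_. x)] ! i) z = b z"
        if iz: "i \<in> {0,1,2}" "z \<in> [E0, E1, E2] ! i" for i :: nat
      proof -
        consider "i = 0" "z \<in> E0" | "i = 1" "z \<in> E1" | "i = 2" "z \<in> E2" using iz by auto
        then show ?thesis
          by cases (simp_all add: b0 b1 bE2)
      qed
      show "([g \<circ> snd, h \<circ> snd, (\<lambda>_. x)] ! i) z = ([g \<circ> snd, h \<circ> snd, (\<lambda>_. x)] ! j) z"
        using v[of i] v[of j] * by (metis IntD1 IntD2)
    next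
      fix z assume "z \<in> topspace (top_of_set B)"
      then consider "z \<in> E0" | "z \<in> E1" | "z \<in> E2" by (auto simp: B_def)
      then show "\<exists>j. j \<in> {0,1,2} \<and> z \<in> [E0, E1, E2] ! j \<and> b z = ([g \<circ> snd, h \<circ> snd, (\<lambda>_. x)] ! j) z"
      proof cases
        case 1 then show ?thesis by (intro exI[of _ 0]) (simp add: b0)
      next
        case 2 then show ?thesis by (intro exI[of _ 1]) (simp add: b1)
      next
        case 3 then show ?thesis by (intro exI[of _ 2]) (simp add: bE2)
      qed
    qed auto
    moreover have "q (b z) = H z" if "z \<in> B" for z
    proof -
      consider "z \<in> E0" | "z \<in> E1" | "z \<in> E2" using \<open>z \<in> B\<close> by (auto simp: B_def)
      then show ?thesis
      proof cases
        case 1 then show ?thesis using H(2)[of "snd z"] b0[OF 1] by (cases z) (simp add: E0_def)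
      next
        case 2 then show ?thesis using H(3)[of "snd z"] b1[OF 2] by (cases z) (simp add: E1_def)
      next
        case 3 then show ?thesis using H(4)[of "fst z" "snd z"] bE2[OF 3] by (cases z) (simp add: E2_def)
      qed
    qed
    ultimately obtain G where G: "continuous_map (top_of_set ?Z) X G" "\<forall>z\<in>B. G z = b z"
      using lift_homotopy[of ?Z] clB H(1) unfolding lifts_over_def by blast
    show ?thesis
      unfolding spheroid_homotopic Z topspace_cube
    proof (intro exI[of _ G] conjI ballI G(1))
      fix k assume k: "k \<in> ?P"
      have "(0, k) \<in> E0" "(1, k) \<in> E1" using k by (auto simp: E0_def E1_def)
      then show "G (0, k) = g k" "G (1, k) = h k" using G(2) b0 b1 by (force simp: B_def)+
    next
      fix t k assume "t \<in> {0..1::real}" "k \<in> cube_boundary n"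
      then have "(t, k) \<in> E2" by (simp add: E2_def)
      then show "G (t, k) = x" using G(2) bE2 by (force simp: B_def)
    qed
  qed
  have surj: "\<exists>G\<in>spheroids n X x. spheroid_homotopic n Y (q x) (q \<circ> G) g"
    if g: "g \<in> spheroids n Y (q x)" and x: "x \<in> topspace X" for n x g
  proof -
    have "closedin (cube n) (cube_boundary n)" by (rule closedin_cube_boundary)
    moreover have "continuous_map (cube n) Y g" "\<forall>k\<in>cube_boundary n. q x = g k"
      using g by (auto simp: spheroids_def)
    ultimately obtain G where G: "continuous_map (cube n) X G" "\<forall>k\<in>topspace (cube n). q (G k) = g k"
      "\<forall>k\<in>cube_boundary n. G k = x"
      using lift[of "topspace (cube n)"] x unfolding lifts_over_def
      by (auto simp: cube_eq_top_of_set dest!: spec[of _ "cube_boundary n"] spec[of _ g] spec[of _ "\<lambda>_. x"])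
    then have Gs: "G \<in> spheroids n X x" by (auto simp: spheroids_def)
    have "spheroid_homotopic n Y (q x) (q \<circ> G) g"
      using spheroids_compose[OF q Gs] G(2) by (intro spheroid_homotopic_if_equal_on_cube) auto
    then show ?thesis using Gs by blast
  qed
  have bij: "bij_betw (induced_map n Y q x) (carrier (homotopy_group n X x)) (carrier (homotopy_group n Y (q x)))"
    if x: "x \<in> topspace X" for n x
  proof (rule bij_betw_imageI)
    show "inj_on (induced_map n Y q x) (carrier (homotopy_group n X x))"
    proof (rule inj_onI)
      fix C D assume "C \<in> carrier (homotopy_group n X x)" "D \<in> carrier (homotopy_group n X x)"
        and eq: "induced_map n Y q x C = induced_map n Y q x D"
      then obtain g h where gh: "g \<in> spheroids n X x" "h \<in> spheroids n X x"
        "C = homotopy_class n X x g" "D = homotopy_class n X x h"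
        by (auto simp: homotopy_group_def)
      then have "spheroid_homotopic n Y (q x) (q \<circ> g) (q \<circ> h)"
        using eq homotopy_class_eq_iff[OF spheroids_compose[OF q]] by (simp add: induced_map_homotopy_class[OF q])
      then show "C = D" using inj gh homotopy_class_eq_iff by metis
    qed
    show "induced_map n Y q x ` carrier (homotopy_group n X x) = carrier (homotopy_group n Y (q x))"
    proof
      show "induced_map n Y q x ` carrier (homotopy_group n X x) \<subseteq> carrier (homotopy_group n Y (q x))"
        using spheroids_compose[OF q] by (auto simp: homotopy_group_def induced_map_homotopy_class[OF q])
      show "carrier (homotopy_group n Y (q x)) \<subseteq> induced_map n Y q x ` carrier (homotopy_group n X x)"
      proof
        fix D assume "D \<in> carrier (homotopy_group n Y (q x))"
        then obtain g where g: "g \<in> spheroids n Y (q x)" "D = homotopy_class n Y (q x) g"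
          by (auto simp: homotopy_group_def)
        then obtain G where G: "G \<in> spheroids n X x" "spheroid_homotopic n Y (q x) (q \<circ> G) g"
          using surj x by blast
        then have "D = induced_map n Y q x (homotopy_class n X x G)"
          using g(2) G(2) homotopy_class_eq_iff[OF spheroids_compose[OF q G(1)]]
          by (metis induced_map_homotopy_class[OF q G(1)])
        then show "D \<in> induced_map n Y q x ` carrier (homotopy_group n X x)"
          using G(1) by (auto simp: homotopy_group_def)
      qed
    qed
  qed
  have "induced_map n Y q x \<in> hom (homotopy_group n X x) (homotopy_group n Y (q x))"
    if x: "x \<in> topspace X" and n: "1 \<le> n" for n x
  proof (rule homI)
    fix C D assume "C \<in> carrier (homotopy_group n X x)" and "D \<in> carrier (homotopy_group n X x)"
    then obtain g h where gh: "g \<in> spheroids n X x" "h \<in> spheroids n X x"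
        "C = homotopy_class n X x g" "D = homotopy_class n X x h"
      by (auto simp: homotopy_group_def)
    show "induced_map n Y q x C \<in> carrier (homotopy_group n Y (q x))"
      using bij[OF x, of n] \<open>C \<in> _\<close> bij_betwE by blast
    have "spheroid_concat g h \<in> spheroids n X x"
      using spheroid_homotopic_concat[OF n gh(1,2)[THEN spheroid_homotopic_refl]]
      by (rule spheroid_homotopic_spheroids)
    moreover have "q \<circ> spheroid_concat g h = spheroid_concat (q \<circ> g) (q \<circ> h)"
      by (auto simp: spheroid_concat_def)
    ultimately show "induced_map n Y q x (C \<otimes>\<^bsub>homotopy_group n X x\<^esub> D) =
        induced_map n Y q x C \<otimes>\<^bsub>homotopy_group n Y (q x)\<^esub> induced_map n Y q x D"
      using gh spheroids_compose[OF q]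
      by (simp add: mult_homotopy_group[OF n] induced_map_homotopy_class[OF q])
  qed
  then show ?thesis
    using q bij by (simp add: weak_homotopy_equivalence_def iso_def)
qed

section \<open>Ordinary differential equations with Lipschitz right-hand side\<close>

text \<open>
  The Picard operator is a contraction with factor \<open>L * h\<close> on bounded continuous curves. To have
  curves that are defined on the whole line, time is clamped to the interval from \<open>-h\<close> to \<open>h\<close>.
\<close>

lemma picard_solution:
  fixes F :: "'e::euclidean_space \<Rightarrow> 'e"
  assumes lip: "\<And>x y. norm (F x - F y) \<le> L * norm (x - y)"
    and h: "0 < h" "L * h \<le> 1/2" and L: "0 \<le> L" and bnd: "\<And>x. norm (F x) \<le> B"
  obtains u where "u 0 = y" 
    "\<And>t. \<bar>t\<bar> < h \<Longrightarrow> (u has_vector_derivative F (u t)) (at t)"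
proof -
  define cl where "cl t = max (-h) (min h t)" for t :: real
  have cl: "cl t \<in> {-h..h}" "\<bar>t\<bar> \<le> h \<Longrightarrow> cl t = t" "continuous_on S cl" for t S
    using h unfolding cl_def by (auto intro!: continuous_intros)
  have contF: "continuous_on S F" for S
  proof (rule continuous_on_subset[of UNIV])
    have "L-lipschitz_on UNIV F" using lip L by (auto intro!: lipschitz_onI simp: dist_norm)
    then show "continuous_on UNIV F" by (rule lipschitz_on_continuous_on)
  qed auto
  \<comment> \<open>The integral of \<open>g\<close> from \<open>0\<close> to \<open>t\<close>, for \<open>t\<close> of either sign.\<close>
  define I where "I g t = integral {-h..t} g - integral {-h..0} g" for g :: "real \<Rightarrow> 'e" and t
  have I_bound: "norm (I g t) \<le> K * h"
    if g: "continuous_on UNIV g" "\<And>s. norm (g s) \<le> K" and t: "t \<in> {-h..h}" for g K t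
  proof -
    have ii: "g integrable_on {a..b}" for a b using g(1) by (auto intro!: integrable_continuous_interval intro: continuous_on_subset)
    have K: "0 \<le> K" using g(2)[of 0] norm_ge_zero order_trans by blast
    have nb: "norm (integral {a..b} g) \<le> K * h" if "a \<le> b" "b - a \<le> h" for a b
    proof -
      have "norm (integral {a..b} g) \<le> K * (b - a)"
        using integral_bound[of a b g K] g that by (auto intro: continuous_on_subset)
      also have "\<dots> \<le> K * h" using K that by (intro mult_left_mono) auto
      finally show ?thesis .
    qed
    show ?thesis
    proof (cases "0 \<le> t")
      case True
      then have "I g t = integral {0..t} g"
        using Henstock_Kurzweil_Integration.integral_combine[of "-h" 0 t g] h ii unfolding I_def by (simp add: algebra_simps)
      then show ?thesis using nb[of 0 t] True t by auto
    next
      case False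
      then have "I g t = - integral {t..0} g"
        using Henstock_Kurzweil_Integration.integral_combine[of "-h" t 0 g] t ii unfolding I_def by (simp add: algebra_simps)
      then show ?thesis using nb[of t 0] False t by auto
    qed
  qed
  have I_deriv: "(I g has_vector_derivative g t) (at t)"
    if g: "continuous_on UNIV g" and t: "\<bar>t\<bar> < h" for g t
  proof -
    have "((\<lambda>t. integral {-h..t} g) has_vector_derivative g t) (at t within {-h..h})"
      using t g by (intro integral_has_vector_derivative) (auto intro: continuous_on_subset)
    then have "((\<lambda>t. integral {-h..t} g) has_vector_derivative g t) (at t within {-h<..<h})"
      by (rule has_vector_derivative_within_subset) auto
    then have "((\<lambda>t. integral {-h..t} g) has_vector_derivative g t) (at t)"
      using t by (subst (asm) has_vector_derivative_within_open) auto
    then show ?thesis unfolding I_def by (auto intro!: derivative_eq_intros)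
  qed
  have I_cont: "continuous_on {-h..h} (I g)" if "continuous_on UNIV g" for g
    unfolding I_def using that
    by (intro continuous_intros indefinite_integral_continuous_1 integrable_continuous_interval)
       (auto intro: continuous_on_subset)
  define T :: "(real \<Rightarrow>\<^sub>C 'e) \<Rightarrow> real \<Rightarrow> 'e" where "T w t = y + I (\<lambda>s. F (w s)) (cl t)" for w t
  have contFw: "continuous_on UNIV (\<lambda>s. F (apply_bcontfun w s))" for w
    by (rule continuous_on_compose2[OF contF[of UNIV]]) auto
  have T: "T w \<in> bcontfun" for w
  proof -
    have "continuous_on UNIV (T w)" unfolding T_def
      by (intro continuous_intros continuous_on_compose2[OF I_cont[OF contFw] cl(3)]) (use cl in auto)
    moreover have "bounded (range (T w))"
    proof (rule boundedI)
      fix x assume "x \<in> range (T w)"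
      then obtain t where "x = T w t" by auto
      then show "norm x \<le> norm y + B * h"
        using I_bound[OF contFw[of w] bnd cl(1)[of t]] norm_triangle_ineq[of y] unfolding T_def
        by (metis add_left_mono order_trans)
    qed
    ultimately show ?thesis by (simp add: bcontfun_def)
  qed
  have "\<exists>!w. Bcontfun (T w) = w"
  proof (rule banach_fix_type)
    show "\<forall>w w'. dist (Bcontfun (T w)) (Bcontfun (T w')) \<le> (1/2) * dist w w'"
    proof (intro allI dist_bound)
      fix w w' t
      have "T w t - T w' t = I (\<lambda>s. F (w s) - F (w' s)) (cl t)"
        unfolding T_def I_def
        by (subst (1 2) integral_diff)
           (auto intro!: integrable_continuous_interval continuous_on_subset[OF contFw])
      moreover have "norm (I (\<lambda>s. F (w s) - F (w' s)) (cl t)) \<le> (L * dist w w') * h"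
      proof (rule I_bound[OF _ _ cl(1)])
        show "continuous_on UNIV (\<lambda>s. F (w s) - F (w' s))" by (intro continuous_intros contFw)
        show "norm (F (w s) - F (w' s)) \<le> L * dist w w'" for s
          using lip[of "w s" "w' s"] mult_left_mono[OF dist_bounded[of w s w'] L] 
          by (simp add: dist_norm)
      qed
      moreover have "(L * dist w w') * h \<le> (1/2) * dist w w'"
        using mult_right_mono[OF h(2), of "dist w w'"] by (simp add: mult_ac)
      ultimately show "dist (Bcontfun (T w) t) (Bcontfun (T w') t) \<le> (1/2) * dist w w'"
        by (simp add: Bcontfun_inverse[OF T] dist_norm)
    qed
  qed auto
  then obtain w where w: "Bcontfun (T w) = w" by blast
  have wT: "w t = T w t" for t using Bcontfun_inverse[OF T, of w] w by simp
  show ?thesis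
  proof (rule that[of "apply_bcontfun w"])
    show "w 0 = y" using wT[of 0] cl(2)[of 0] h by (simp add: T_def I_def)
    fix t assume t: "\<bar>t\<bar> < h"
    have "((\<lambda>t. y + I (\<lambda>s. F (w s)) t) has_vector_derivative F (w t)) (at t)"
      using has_vector_derivative_add[OF has_vector_derivative_const I_deriv[OF contFw t], of y] by simp
    then show "(w has_vector_derivative F (w t)) (at t)"
    proof (rule has_vector_derivative_transform_within_open[of _ _ _ "{-h<..<h}"])
      show "y + I (\<lambda>s. F (w s)) s = w s" if "s \<in> {-h<..<h}" for s
        unfolding wT[of s] T_def using that cl(2)[of s] by auto
    qed (use t in auto)
  qed
qed

text \<open>
  The squared distance \<open>N\<close> of two solutions satisfies \<open>\<bar>N'\<bar> \<le> 2 L N\<close>, so \<open>exp (-2Lt) N(t)\<close> decreases and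
  \<open>exp (2Lt) N(t)\<close> increases. This gives both the uniqueness of solutions and their continuous
  dependence on the initial point.
\<close>

lemma gronwall_distance:
  fixes F :: "'e::euclidean_space \<Rightarrow> 'e"
  assumes lip: "\<And>x y. x \<in> X \<Longrightarrow> y \<in> X \<Longrightarrow> norm (F x - F y) \<le> L * norm (x - y)"
    and J: "is_interval J" "s \<in> J" "t \<in> J"
    and u: "\<And>t. t \<in> J \<Longrightarrow> (u has_vector_derivative F (u t)) (at t)" "\<And>t. t \<in> J \<Longrightarrow> u t \<in> X"
    and w: "\<And>t. t \<in> J \<Longrightarrow> (w has_vector_derivative F (w t)) (at t)" "\<And>t. t \<in> J \<Longrightarrow> w t \<in> X"
  shows "norm (u t - w t) \<le> exp (L * \<bar>t - s\<bar>) * norm (u s - w s)"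
proof -
  define N where "N t = (u t - w t) \<bullet> (u t - w t)" for t
  define N' where "N' t = 2 * ((u t - w t) \<bullet> (F (u t) - F (w t)))" for t
  have N: "(N has_real_derivative N' t) (at t)" if "t \<in> J" for t
    unfolding N_def N'_def has_real_derivative_iff_has_vector_derivative
    using u(1)[OF that] w(1)[OF that]
    by (auto intro!: derivative_eq_intros simp: has_vector_derivative_def inner_diff algebra_simps inner_commute)
  have N'b: "\<bar>N' t\<bar> \<le> 2 * L * N t" if "t \<in> J" for t
  proof -
    have "\<bar>(u t - w t) \<bullet> (F (u t) - F (w t))\<bar> \<le> norm (u t - w t) * norm (F (u t) - F (w t))"
      by (rule Cauchy_Schwarz_ineq2)
    also have "\<dots> \<le> norm (u t - w t) * (L * norm (u t - w t))"
      using lip u(2) w(2) that by (intro mult_left_mono) auto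
    finally show ?thesis unfolding N_def N'_def by (simp add: dot_square_norm power2_eq_square algebra_simps)
  qed
  have E: "((\<lambda>t. exp (c * t) * N t) has_real_derivative exp (c * t) * (c * N t + N' t)) (at t)" if "t \<in> J" for c t
    using N[OF that] by (auto intro!: derivative_eq_intros simp: algebra_simps)
  have sq: "N t \<le> exp (2 * L * \<bar>t - s\<bar>) * N s"
  proof (cases "s \<le> t")
    case True
    have "exp ((-2*L) * t) * N t \<le> exp ((-2*L) * s) * N s"
    proof (rule DERIV_nonpos_imp_nonincreasing[OF True])
      fix x assume "s \<le> x" "x \<le> t"
      then have "x \<in> J" using J mem_is_interval_1_I by blast
      then show "\<exists>y. ((\<lambda>t. exp ((-2*L) * t) * N t) has_real_derivative y) (at x) \<and> y \<le> 0"
        using E[of x "-2*L"] N'b[of x]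
        by (intro exI[of _ "exp ((-2*L) * x) * ((-2*L) * N x + N' x)"]) (auto intro: mult_nonneg_nonpos)
    qed
    then have "exp (2 * L * t) * (exp (-(2 * L * t)) * N t) \<le> exp (2 * L * t) * (exp (-(2 * L * s)) * N s)"
      by (intro mult_left_mono) auto
    then show ?thesis using True
      by (simp only: mult.assoc[symmetric] exp_add[symmetric]) (simp add: right_diff_distrib)
  next
    case False
    have "exp ((2*L) * t) * N t \<le> exp ((2*L) * s) * N s"
    proof (rule DERIV_nonneg_imp_nondecreasing[of t s])
      fix x assume "t \<le> x" "x \<le> s"
      then have "x \<in> J" using J mem_is_interval_1_I by blast
      then show "\<exists>y. ((\<lambda>t. exp ((2*L) * t) * N t) has_real_derivative y) (at x) \<and> y \<ge> 0"
        using E[of x "2*L"] N'b[of x]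
        by (intro exI[of _ "exp ((2*L) * x) * ((2*L) * N x + N' x)"]) auto
    qed (use False in auto)
    then have "exp (-(2 * L * t)) * (exp (2 * L * t) * N t) \<le> exp (-(2 * L * t)) * (exp (2 * L * s) * N s)"
      by (intro mult_left_mono) auto
    then show ?thesis using False
      by (simp only: mult.assoc[symmetric] exp_add[symmetric]) (simp add: right_diff_distrib)
  qed
  have "(norm (u t - w t))\<^sup>2 \<le> (exp (L * \<bar>t - s\<bar>) * norm (u s - w s))\<^sup>2"
    using sq unfolding N_def
    by (simp add: dot_square_norm power_mult_distrib exp_double[symmetric] mult.assoc)
  then show ?thesis by (rule power2_le_imp_le) simp
qed

section \<open>Smooth maps in coordinates\<close>

lemma smooth_on_has_derivative:
  assumes "smooth_on S g" "open S" "x \<in> S"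
  shows "(g has_derivative frechet_derivative g (at x)) (at x)"
proof -
  have "Ck_on 1 S g" using assms(1) by (simp add: smooth_on_def)
  then have "g differentiable_on S" by simp
  then have "g differentiable (at x within S)" using assms(3) by (simp add: differentiable_on_def)
  then have "g differentiable at x" by (simp only: at_within_open[OF assms(3,2)])
  then show ?thesis by (simp add: frechet_derivative_works)
qed

lemma smooth_on_frechet_derivative:
  assumes "smooth_on S g"
  shows "smooth_on S (\<lambda>x. frechet_derivative g (at x) u)"
  unfolding smooth_on_def
proof
  fix k
  have "Ck_on (Suc k) S g" using assms by (simp only: smooth_on_def)
  then show "Ck_on k S (\<lambda>x. frechet_derivative g (at x) u)" by simp
qed

lemma smooth_on_continuous_on: "smooth_on S g \<Longrightarrow> continuous_on S g"
  unfolding smooth_on_def by (metis Ck_on.simps(1))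

lemma linear_expand_Basis:
  fixes D :: "'e::euclidean_space \<Rightarrow> 'b::real_vector"
  assumes "linear D"
  shows "D u = (\<Sum>b\<in>Basis. (u \<bullet> b) *\<^sub>R D b)"
proof -
  have "D u = D (\<Sum>b\<in>Basis. (u \<bullet> b) *\<^sub>R b)" by (simp add: euclidean_representation)
  also have "\<dots> = (\<Sum>b\<in>Basis. (u \<bullet> b) *\<^sub>R D b)"
    using assms by (simp add: linear_sum linear_scale)
  finally show ?thesis .
qed

lemma smooth_on_locally_lipschitz:
  fixes g :: "'e::euclidean_space \<Rightarrow> 'b::real_normed_vector"
  assumes g: "smooth_on S g" and S: "cball x r \<subseteq> S" "open S"
  shows "\<exists>L\<ge>0. \<forall>y\<in>cball x r. \<forall>z\<in>cball x r. norm (g y - g z) \<le> L * norm (y - z)"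
proof -
  have "\<exists>B\<ge>0. \<forall>y\<in>cball x r. norm (frechet_derivative g (at y) b) \<le> B" for b
  proof -
    have "continuous_on (cball x r) (\<lambda>y. frechet_derivative g (at y) b)"
      using smooth_on_continuous_on[OF smooth_on_frechet_derivative[OF g]] S(1) by (rule continuous_on_subset)
    then have "bounded ((\<lambda>y. frechet_derivative g (at y) b) ` cball x r)"
      by (intro compact_imp_bounded compact_continuous_image) auto
    then obtain B where "\<forall>y\<in>cball x r. norm (frechet_derivative g (at y) b) \<le> B"
      unfolding bounded_iff by auto
    then show ?thesis by (intro exI[of _ "max 0 B"]) (auto simp: le_max_iff_disj)
  qed
  then obtain B where B: "\<And>b. 0 \<le> B b" "\<And>b y. y \<in> cball x r \<Longrightarrow> norm (frechet_derivative g (at y) b) \<le> B b"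
    by metis
  define L where "L = sum B Basis"
  show ?thesis
  proof (intro exI[of _ L] conjI ballI)
    show "0 \<le> L" unfolding L_def using B(1) by (simp add: sum_nonneg)
    fix y z assume yz: "y \<in> cball x r" "z \<in> cball x r"
    show "norm (g y - g z) \<le> L * norm (y - z)"
    proof (rule differentiable_bound[OF convex_cball _ _ yz])
      fix w assume w: "w \<in> cball x r"
      have d: "(g has_derivative frechet_derivative g (at w)) (at w)"
        using smooth_on_has_derivative[OF g S(2)] S(1) w by blast
      then show "(g has_derivative frechet_derivative g (at w)) (at w within cball x r)"
        by (rule has_derivative_at_withinI)
      show "onorm (frechet_derivative g (at w)) \<le> L"
      proof (rule onorm_bound)
        fix u
        have "norm (frechet_derivative g (at w) u) \<le> (\<Sum>b\<in>Basis. norm ((u \<bullet> b) *\<^sub>R frechet_derivative g (at w) b))"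
          unfolding linear_expand_Basis[OF has_derivative_linear[OF d], of u] by (rule norm_sum)
        also have "\<dots> \<le> (\<Sum>b\<in>Basis. norm u * B b)"
          using B w by (intro sum_mono) (auto intro!: mult_mono Basis_le_norm)
        also have "\<dots> = L * norm u" by (simp add: L_def sum_distrib_left mult.commute)
        finally show "norm (frechet_derivative g (at w) u) \<le> L * norm u" .
      qed (use \<open>0 \<le> L\<close> in auto)
    qed
  qed
qed

section \<open>Charts and integral curves\<close>

locale smooth_field =
  fixes M :: "'a topology" and A :: "('a, 'e::euclidean_space) chart set"
    and v :: "'a \<Rightarrow> ('a, 'e) tangent_vector"
  assumes manifold: "smooth_manifold M A" and field: "smooth_vector_field M A v"
begin

lemma Hausdorff: "Hausdorff_space M"
  using manifold by (simp add: smooth_manifold_def)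

lemma chart:
  assumes c: "c \<in> A"
  shows "openin M (chart_dom c)" "open (chart_im c)"
    "homeomorphic_map (subtopology M (chart_dom c)) (top_of_set (chart_im c)) (chart_map c)"
    "chart_dom c \<subseteq> topspace M"
  using manifold c openin_subset unfolding smooth_manifold_def is_chart_def by blast+

lemma inj_on_chart_map: "c \<in> A \<Longrightarrow> inj_on (chart_map c) (chart_dom c)"
  using homeomorphic_imp_injective_map[OF chart(3)[of c]] chart(4)[of c]
  by (simp add: topspace_subtopology Int_absorb1)

lemma chart_inv_map [simp]: "c \<in> A \<Longrightarrow> p \<in> chart_dom c \<Longrightarrow> chart_inv c (chart_map c p) = p"
  by (simp add: inv_into_f_f inj_on_chart_map)

lemma chart_map_inv [simp]: "x \<in> chart_im c \<Longrightarrow> chart_map c (chart_inv c x) = x"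
  by (rule f_inv_into_f)

lemma chart_inv_in [simp]: "x \<in> chart_im c \<Longrightarrow> chart_inv c x \<in> chart_dom c"
  by (rule inv_into_into)

lemma openin_chart_preimage:
  assumes "c \<in> A" "open W"
  shows "openin M {p \<in> chart_dom c. chart_map c p \<in> W}"
proof -
  have "openin (subtopology M (chart_dom c)) {p \<in> topspace (subtopology M (chart_dom c)). chart_map c p \<in> chart_im c \<inter> W}"
    by (rule openin_continuous_map_preimage[OF homeomorphic_imp_continuous_map[OF chart(3)[OF assms(1)]]])
       (use assms(2) in \<open>auto simp: openin_open\<close>)
  moreover have "{p \<in> topspace (subtopology M (chart_dom c)). chart_map c p \<in> chart_im c \<inter> W} =
      {p \<in> chart_dom c. chart_map c p \<in> W}"
    using chart(4)[OF assms(1)] by auto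
  ultimately show ?thesis using openin_trans_full chart(1)[OF assms(1)] by metis
qed

lemma open_chart_image:
  assumes "c \<in> A" "openin M U"
  shows "open (chart_map c ` (U \<inter> chart_dom c))"
proof -
  have "openin (subtopology M (chart_dom c)) (U \<inter> chart_dom c)"
    using assms by (auto simp: openin_subtopology)
  then have "openin (top_of_set (chart_im c)) (chart_map c ` (U \<inter> chart_dom c))"
    using homeomorphic_imp_open_map[OF chart(3)[OF assms(1)]] by (simp add: open_map_def)
  then show ?thesis using chart(2)[OF assms(1)] by (simp add: openin_open_eq)
qed

lemma continuous_chart_map: "c \<in> A \<Longrightarrow> continuous_map (subtopology M (chart_dom c)) euclidean (chart_map c)"
  using homeomorphic_imp_continuous_map[OF chart(3)] by (simp add: continuous_map_in_subtopology)

lemma continuous_chart_inv: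
  assumes c: "c \<in> A"
  shows "continuous_map (top_of_set (chart_im c)) M (chart_inv c)"
  unfolding continuous_map_def
proof (intro conjI allI impI)
  show "chart_inv c \<in> topspace (top_of_set (chart_im c)) \<rightarrow> topspace M"
    using chart(4)[OF c] chart_inv_in by fastforce
  fix U assume U: "openin M U"
  have "{x \<in> topspace (top_of_set (chart_im c)). chart_inv c x \<in> U} = chart_map c ` (U \<inter> chart_dom c)"
    using c by (auto simp: image_iff)
  then show "openin (top_of_set (chart_im c)) {x \<in> topspace (top_of_set (chart_im c)). chart_inv c x \<in> U}"
    using open_chart_image[OF c U] by (auto simp: openin_open intro!: exI[of _ "chart_map c ` (U \<inter> chart_dom c)"])
qed

lemma transition_has_derivative:
  assumes "c \<in> A" "d \<in> A" "p \<in> chart_dom c" "p \<in> chart_dom d"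
  shows "(chart_map d \<circ> chart_inv c has_derivative
      frechet_derivative (chart_map d \<circ> chart_inv c) (at (chart_map c p))) (at (chart_map c p))"
proof (rule smooth_on_has_derivative)
  show "smooth_on (chart_map c ` (chart_dom c \<inter> chart_dom d)) (chart_map d \<circ> chart_inv c)"
  proof -
    have "\<forall>c\<in>A. \<forall>d\<in>A. smooth_on (chart_map c ` (chart_dom c \<inter> chart_dom d)) (chart_map d \<circ> chart_inv c)"
      using manifold unfolding smooth_manifold_def by (elim conjE)
    then show ?thesis using assms by simp
  qed
  show "open (chart_map c ` (chart_dom c \<inter> chart_dom d))"
    using open_chart_image[OF assms(1) chart(1)[OF assms(2)]] by (simp add: Int_commute)
qed (use assms in auto)

abbreviation local_field :: "('a, 'e) chart \<Rightarrow> 'e \<Rightarrow> 'e" where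
  "local_field c \<equiv> \<lambda>x. v (chart_inv c x) c"

lemma smooth_local_field: "c \<in> A \<Longrightarrow> smooth_on (chart_im c) (local_field c)"
  using field by (simp add: smooth_vector_field_def)

lemma field_transform:
  assumes "c \<in> A" "d \<in> A" "p \<in> chart_dom c" "p \<in> chart_dom d"
  shows "v p d = frechet_derivative (chart_map d \<circ> chart_inv c) (at (chart_map c p)) (v p c)"
proof -
  have "v p \<in> tangent_space A p" using field assms chart(4)[of c] by (auto simp: smooth_vector_field_def)
  then show ?thesis unfolding tangent_space_def using assms by blast
qed

lemma chart_at:
  assumes "p \<in> topspace M"
  shows "chart_at A p \<in> A" "p \<in> chart_dom (chart_at A p)"
proof -
  have "\<exists>c. c \<in> A \<and> p \<in> chart_dom c"
    using manifold assms unfolding smooth_manifold_def by blast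
  then have "chart_at A p \<in> A \<and> p \<in> chart_dom (chart_at A p)"
    unfolding chart_at_def by (rule someI_ex)
  then show "chart_at A p \<in> A" "p \<in> chart_dom (chart_at A p)" by auto
qed

abbreviation curve :: "real set \<Rightarrow> (real \<Rightarrow> 'a) \<Rightarrow> bool" where
  "curve \<equiv> integral_curve M A v"

lemma curve_preimage_open:
  assumes "curve J \<gamma>" "openin M U"
  shows "open {t \<in> J. \<gamma> t \<in> U}"
proof -
  have "open J" "continuous_map (top_of_set J) M \<gamma>" using assms by (auto simp: integral_curve_def)
  then show ?thesis
    using openin_continuous_map_preimage[OF _ assms(2)] by (fastforce simp: openin_open_eq)
qed

lemma curve_in_topspace: "curve J \<gamma> \<Longrightarrow> t \<in> J \<Longrightarrow> \<gamma> t \<in> topspace M"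
  unfolding integral_curve_def by (metis Pi_iff continuous_map_funspace topspace_euclidean_subtopology)

lemma curve_chart_derivative:
  assumes "curve J \<gamma>" "c \<in> A" "t \<in> J" "\<gamma> t \<in> chart_dom c"
  shows "((chart_map c \<circ> \<gamma>) has_vector_derivative local_field c ((chart_map c \<circ> \<gamma>) t)) (at t)"
  using assms unfolding integral_curve_def by simp

lemma curve_of_chart_solution:
  assumes c: "c \<in> A" and J: "open J" "is_interval J"
    and u: "\<And>t. t \<in> J \<Longrightarrow> u t \<in> chart_im c"
      "\<And>t. t \<in> J \<Longrightarrow> (u has_vector_derivative local_field c (u t)) (at t)"
  shows "curve J (chart_inv c \<circ> u)"
  unfolding integral_curve_def
proof (intro conjI ballI impI J)
  have "continuous_on J u"
    using u(2) by (intro continuous_at_imp_continuous_on) (auto intro: has_vector_derivative_continuous)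
  then have "continuous_map (top_of_set J) (top_of_set (chart_im c)) u"
    using u(1) by (auto simp: continuous_map_in_subtopology)
  then show "continuous_map (top_of_set J) M (chart_inv c \<circ> u)"
    using continuous_chart_inv[OF c] by (rule continuous_map_compose)
  fix t d assume t: "t \<in> J" and d: "d \<in> A" "(chart_inv c \<circ> u) t \<in> chart_dom d"
  let ?p = "chart_inv c (u t)"
  have p: "chart_map c ?p = u t" "?p \<in> chart_dom c" using u(1)[OF t] by auto
  have tr: "(chart_map d \<circ> chart_inv c has_derivative
      frechet_derivative (chart_map d \<circ> chart_inv c) (at (u t))) (at (u t))"
    using transition_has_derivative[OF c d(1) p(2)] d(2) p(1) by simp
  have "((chart_map d \<circ> chart_inv c) \<circ> u has_vector_derivative
      frechet_derivative (chart_map d \<circ> chart_inv c) (at (u t)) (local_field c (u t))) (at t)"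
    by (rule vector_derivative_diff_chain_within[OF u(2)[OF t] has_derivative_at_withinI[OF tr]])
  then show "((chart_map d \<circ> (chart_inv c \<circ> u)) has_vector_derivative v ((chart_inv c \<circ> u) t) d) (at t)"
    using field_transform[OF c d(1) p(2)] d(2) p(1) by (simp add: comp_assoc)
qed

text \<open>
  In a chart the field is Lipschitz on a small closed ball. Composed with the nearest-point projection
  onto this ball it becomes globally Lipschitz and bounded, so that solutions exist for a uniform time;
  when they start in the ball of half the radius and the time is short, they do not leave the ball, on which the
  modified field is the original one.
\<close>

lemma local_flow:
  assumes p: "p \<in> topspace M"
  obtains c r \<epsilon> L where "c \<in> A" "p \<in> chart_dom c" "0 < r" "0 < \<epsilon>" "cball (chart_map c p) r \<subseteq> chart_im c"
    "0 \<le> L" "\<And>y z. y \<in> cball (chart_map c p) r \<Longrightarrow> z \<in> cball (chart_map c p) r \<Longrightarrow>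
        norm (local_field c y - local_field c z) \<le> L * norm (y - z)"
    "\<And>y. y \<in> ball (chart_map c p) (r/2) \<Longrightarrow>
      \<exists>u. u 0 = y \<and> (\<forall>t\<in>{-\<epsilon><..<\<epsilon>}. u t \<in> cball (chart_map c p) r \<and> (u has_vector_derivative local_field c (u t)) (at t))"
proof -
  let ?c = "chart_at A p"
  let ?V = "local_field ?c"
  note c = chart_at[OF p]
  define x0 where "x0 = chart_map ?c p"
  have "x0 \<in> chart_im ?c" using c by (simp add: x0_def)
  then obtain r where r: "0 < r" "cball x0 r \<subseteq> chart_im ?c"
    using open_contains_cball chart(2)[OF c(1)] by blast
  obtain L where L: "0 \<le> L" "\<And>y z. y \<in> cball x0 r \<Longrightarrow> z \<in> cball x0 r \<Longrightarrow> norm (?V y - ?V z) \<le> L * norm (y - z)"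
    using smooth_on_locally_lipschitz[OF smooth_local_field[OF c(1)] r(2) chart(2)[OF c(1)]] by blast
  define P where "P = closest_point (cball x0 r)"
  define B where "B = norm (?V x0) + L * r"
  \<comment> \<open>The first bound makes the Picard operator contracting, the second keeps the solutions in the ball.\<close>
  define h where "h = min (1 / (2 * (L + 1))) (r / (2 * (B + 1)))"
  have P: "P x \<in> cball x0 r" "x \<in> cball x0 r \<Longrightarrow> P x = x" for x
    using r(1) closest_point_in_set[of "cball x0 r" x] closest_point_self[of x "cball x0 r"] by (auto simp: P_def)
  have P_lip: "norm (P x - P y) \<le> norm (x - y)" for x y
    using closest_point_lipschitz[of "cball x0 r" x y] r(1) by (simp add: P_def dist_norm)
  have lip: "norm (?V (P x) - ?V (P y)) \<le> L * norm (x - y)" for x y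
    using L(2)[OF P(1)[of x] P(1)[of y]] mult_left_mono[OF P_lip L(1), of x y] by linarith
  have bnd: "norm (?V (P x)) \<le> B" for x
  proof -
    have "norm (P x - x0) \<le> r" using P(1)[of x] by (simp add: dist_norm norm_minus_commute)
    then have "L * norm (P x - x0) \<le> L * r" using L(1) by (rule mult_left_mono)
    moreover have "norm (?V (P x) - ?V x0) \<le> L * norm (P x - x0)" using L(2)[OF P(1)[of x], of x0] r(1) by auto
    ultimately show ?thesis using norm_triangle_ineq2[of "?V (P x)" "?V x0"] unfolding B_def by linarith
  qed
  have B0: "0 \<le> B" using norm_ge_zero[of "?V (P x0)"] bnd[of x0] by linarith
  have h: "0 < h" "L * h \<le> 1/2" "B * h \<le> r/2"
  proof -
    show "0 < h" using r(1) L(1) B0 by (simp add: h_def)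
    have "L * h \<le> L * (1 / (2 * (L + 1)))" using L(1) by (intro mult_left_mono) (auto simp: h_def)
    also have "\<dots> \<le> 1/2" using L(1) by (simp add: field_simps)
    finally show "L * h \<le> 1/2" .
    have "B * h \<le> B * (r / (2 * (B + 1)))" using B0 by (intro mult_left_mono) (auto simp: h_def)
    also have "\<dots> \<le> r/2" using B0 r(1) by (simp add: field_simps)
    finally show "B * h \<le> r/2" .
  qed
  show ?thesis
  proof (rule that[of ?c r h L])
    show "\<exists>u. u 0 = y \<and> (\<forall>t\<in>{-h<..<h}. u t \<in> cball (chart_map ?c p) r \<and> (u has_vector_derivative ?V (u t)) (at t))"
      if y: "y \<in> ball (chart_map ?c p) (r/2)" for y
    proof -
      obtain u where u: "u 0 = y" "\<And>t. \<bar>t\<bar> < h \<Longrightarrow> (u has_vector_derivative ?V (P (u t))) (at t)"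
        using picard_solution[of "\<lambda>x. ?V (P x)", OF lip h(1,2) L(1) bnd] by blast
      have in_ball: "u t \<in> cball x0 r" if t: "\<bar>t\<bar> < h" for t
      proof -
        have "norm (u t - u 0) \<le> B * norm (t - 0)"
        proof (rule differentiable_bound[of "{-h<..<h}"])
          fix s assume "s \<in> {-h<..<h}"
          then show "(u has_derivative (\<lambda>a. a *\<^sub>R ?V (P (u s)))) (at s within {-h<..<h})"
            using u(2)[of s] by (auto simp: has_vector_derivative_def intro: has_derivative_at_withinI)
          show "onorm (\<lambda>a. a *\<^sub>R ?V (P (u s))) \<le> B"
          proof (rule onorm_bound[OF B0])
            show "norm (a *\<^sub>R ?V (P (u s))) \<le> B * norm a" for a
              using mult_left_mono[OF bnd[of "u s"], of "\<bar>a\<bar>"] by (simp add: mult.commute)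
          qed
        qed (use t in auto)
        also have "\<dots> \<le> B * h" using t B0 by (intro mult_left_mono) auto
        finally have "norm (u t - y) \<le> r/2" using h(3) u(1) by simp
        moreover have "dist x0 y < r/2" using y by (simp add: x0_def)
        moreover have "dist x0 (u t) \<le> dist x0 y + dist y (u t)" by (rule dist_triangle)
        ultimately show ?thesis by (simp add: dist_norm norm_minus_commute)
      qed
      have "\<forall>t\<in>{-h<..<h}. u t \<in> cball x0 r \<and> (u has_vector_derivative ?V (u t)) (at t)"
      proof
        fix t assume "t \<in> {-h<..<h}"
        then have t: "\<bar>t\<bar> < h" by auto
        show "u t \<in> cball x0 r \<and> (u has_vector_derivative ?V (u t)) (at t)"
          using u(2)[OF t] in_ball[OF t] P(2)[OF in_ball[OF t]] by simp
      qed
      then show ?thesis using u(1) unfolding x0_def by blast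
    qed
  qed (use c r h L in \<open>auto simp: x0_def\<close>)
qed

lemma curve_eq_near:
  assumes \<gamma>: "curve J \<gamma>" and \<delta>: "curve K \<delta>" and t: "t \<in> J" "t \<in> K" "\<gamma> t = \<delta> t"
  shows "\<exists>\<epsilon>>0. \<forall>s. \<bar>s - t\<bar> < \<epsilon> \<longrightarrow> s \<in> J \<inter> K \<and> \<gamma> s = \<delta> s"
proof -
  obtain c r L where c: "c \<in> A" "\<gamma> t \<in> chart_dom c" "0 < r" "cball (chart_map c (\<gamma> t)) r \<subseteq> chart_im c"
    "\<And>y z. y \<in> cball (chart_map c (\<gamma> t)) r \<Longrightarrow> z \<in> cball (chart_map c (\<gamma> t)) r \<Longrightarrow>
        norm (local_field c y - local_field c z) \<le> L * norm (y - z)"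
    using local_flow[OF curve_in_topspace[OF \<gamma> t(1)]] by metis
  define U where "U = {p \<in> chart_dom c. chart_map c p \<in> ball (chart_map c (\<gamma> t)) r}"
  have U: "openin M U" unfolding U_def by (rule openin_chart_preimage[OF c(1)]) auto
  have "open ({t \<in> J. \<gamma> t \<in> U} \<inter> {t \<in> K. \<delta> t \<in> U})"
    using curve_preimage_open[OF \<gamma> U] curve_preimage_open[OF \<delta> U] by auto
  moreover have "t \<in> {t \<in> J. \<gamma> t \<in> U} \<inter> {t \<in> K. \<delta> t \<in> U}" using t c by (auto simp: U_def)
  ultimately obtain \<epsilon> where \<epsilon>: "0 < \<epsilon>" "ball t \<epsilon> \<subseteq> {t \<in> J. \<gamma> t \<in> U} \<inter> {t \<in> K. \<delta> t \<in> U}"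
    by (meson openE)
  have "s \<in> J \<inter> K \<and> \<gamma> s = \<delta> s" if s: "\<bar>s - t\<bar> < \<epsilon>" for s
  proof -
    have sb: "s \<in> ball t \<epsilon>" using s by (auto simp: dist_real_def)
    have "norm ((chart_map c \<circ> \<gamma>) s - (chart_map c \<circ> \<delta>) s) \<le>
        exp (L * \<bar>s - t\<bar>) * norm ((chart_map c \<circ> \<gamma>) t - (chart_map c \<circ> \<delta>) t)"
    proof (rule gronwall_distance[where X = "cball (chart_map c (\<gamma> t)) r" and J = "ball t \<epsilon>" and F = "local_field c"])
      show "is_interval (ball t \<epsilon>)" by (simp add: is_interval_convex_1)
      fix a assume "a \<in> ball t \<epsilon>"
      then have a: "a \<in> J" "\<gamma> a \<in> U" "a \<in> K" "\<delta> a \<in> U" using \<epsilon>(2) by auto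
      show "(chart_map c \<circ> \<gamma>) a \<in> cball (chart_map c (\<gamma> t)) r" "(chart_map c \<circ> \<delta>) a \<in> cball (chart_map c (\<gamma> t)) r"
        using a by (auto simp: U_def)
      show "((chart_map c \<circ> \<gamma>) has_vector_derivative local_field c ((chart_map c \<circ> \<gamma>) a)) (at a)"
        using a by (intro curve_chart_derivative[OF \<gamma> c(1)]) (auto simp: U_def)
      show "((chart_map c \<circ> \<delta>) has_vector_derivative local_field c ((chart_map c \<circ> \<delta>) a)) (at a)"
        using a by (intro curve_chart_derivative[OF \<delta> c(1)]) (auto simp: U_def)
    qed (use c(5) \<epsilon> sb in auto)
    then have "chart_map c (\<gamma> s) = chart_map c (\<delta> s)" using t(3) by simp
    moreover have "\<gamma> s \<in> chart_dom c" "\<delta> s \<in> chart_dom c" using \<epsilon>(2) sb by (auto simp: U_def)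
    ultimately have "\<gamma> s = \<delta> s" using inj_onD[OF inj_on_chart_map[OF c(1)]] by blast
    then show ?thesis using \<epsilon>(2) sb by auto
  qed
  then show ?thesis using \<epsilon>(1) by blast
qed

text \<open>
  The set where two curves agree is open by local uniqueness and closed because \<open>M\<close> is Hausdorff.
\<close>

lemma curve_unique:
  assumes \<gamma>: "curve J \<gamma>" and \<delta>: "curve K \<delta>" and t: "t \<in> J \<inter> K" "\<gamma> t = \<delta> t" and s: "s \<in> J \<inter> K"
  shows "\<gamma> s = \<delta> s"
proof -
  define E where "E = {t \<in> J \<inter> K. \<gamma> t = \<delta> t}"
  have "connected (J \<inter> K)"
    using \<gamma> \<delta> unfolding integral_curve_def by (intro is_interval_connected is_interval_Int) auto
  moreover have "openin (top_of_set (J \<inter> K)) E"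
  proof (rule openin_subset_trans[of UNIV])
    show "openin (top_of_set UNIV) E"
      unfolding open_openin[symmetric] subtopology_UNIV open_contains_ball
    proof
      fix a assume "a \<in> E"
      then obtain \<epsilon> where "\<epsilon> > 0" "\<forall>s. \<bar>s - a\<bar> < \<epsilon> \<longrightarrow> s \<in> J \<inter> K \<and> \<gamma> s = \<delta> s"
        using curve_eq_near[OF \<gamma> \<delta>] by (auto simp: E_def)
      then show "\<exists>\<epsilon>>0. ball a \<epsilon> \<subseteq> E"
        by (intro exI[of _ \<epsilon>]) (auto simp: E_def dist_real_def abs_minus_commute)
    qed
  qed (auto simp: E_def)
  moreover have "closedin (top_of_set (J \<inter> K)) E"
  proof -
    have "continuous_map (top_of_set (J \<inter> K)) M \<gamma>" "continuous_map (top_of_set (J \<inter> K)) M \<delta>"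
      using \<gamma> \<delta> unfolding integral_curve_def by (auto intro: continuous_map_from_subtopology_mono)
    from closedin_continuous_maps_eq[OF Hausdorff this] show ?thesis by (simp add: E_def)
  qed
  moreover have "E \<noteq> {}" using t by (auto simp: E_def)
  ultimately have "E = J \<inter> K" unfolding connected_clopen by blast
  then show ?thesis using s by (auto simp: E_def)
qed

lemma curve_locally:
  assumes J: "open J" "is_interval J"
    and loc: "\<And>t. t \<in> J \<Longrightarrow> \<exists>K \<delta>. curve K \<delta> \<and> t \<in> K \<and> K \<subseteq> J \<and> (\<forall>s\<in>K. \<gamma> s = \<delta> s)"
  shows "curve J \<gamma>"
  unfolding integral_curve_def
proof (intro conjI J ballI impI)
  show "continuous_map (top_of_set J) M \<gamma>"
    unfolding continuous_map_def
  proof (intro conjI allI impI)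
    show "\<gamma> \<in> topspace (top_of_set J) \<rightarrow> topspace M"
      using loc curve_in_topspace by fastforce
    fix U assume U: "openin M U"
    show "openin (top_of_set J) {t \<in> topspace (top_of_set J). \<gamma> t \<in> U}"
    proof (subst openin_subopen, safe)
      fix t assume t: "t \<in> topspace (top_of_set J)" "\<gamma> t \<in> U"
      then obtain K \<delta> where K: "curve K \<delta>" "t \<in> K" "K \<subseteq> J" "\<forall>s\<in>K. \<gamma> s = \<delta> s"
        using loc[of t] by auto
      then have "open {s \<in> K. \<delta> s \<in> U}" using curve_preimage_open U by blast
      then show "\<exists>T. openin (top_of_set J) T \<and> t \<in> T \<and> T \<subseteq> {t \<in> topspace (top_of_set J). \<gamma> t \<in> U}"
        using K t J(1) by (intro exI[of _ "{s \<in> K. \<delta> s \<in> U}"]) (auto simp: openin_open_eq)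
    qed
  qed
  fix t c assume t: "t \<in> J" and c: "c \<in> A" "\<gamma> t \<in> chart_dom c"
  obtain K \<delta> where K: "curve K \<delta>" "t \<in> K" "K \<subseteq> J" "\<forall>s\<in>K. \<gamma> s = \<delta> s" using loc[OF t] by auto
  have "((chart_map c \<circ> \<delta>) has_vector_derivative v (\<delta> t) c) (at t)"
    using K c unfolding integral_curve_def by simp
  then show "((chart_map c \<circ> \<gamma>) has_vector_derivative v (\<gamma> t) c) (at t)"
    using K has_vector_derivative_transform_within_open[of "chart_map c \<circ> \<delta>" "v (\<delta> t) c" t K "chart_map c \<circ> \<gamma>"]
    by (auto simp: integral_curve_def)
qed

lemma curve_Union:
  assumes F: "\<And>J \<gamma>. (J, \<gamma>) \<in> F \<Longrightarrow> curve J \<gamma> \<and> t0 \<in> J \<and> \<gamma> t0 = x0"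
  obtains \<gamma> where "curve (\<Union>(fst ` F)) \<gamma>" "\<And>J \<delta> t. (J, \<delta>) \<in> F \<Longrightarrow> t \<in> J \<Longrightarrow> \<gamma> t = \<delta> t"
proof -
  define \<gamma> where "\<gamma> t = (SOME y. \<exists>J \<delta>. (J, \<delta>) \<in> F \<and> t \<in> J \<and> y = \<delta> t)" for t
  have \<gamma>: "\<gamma> t = \<delta> t" if J: "(J, \<delta>) \<in> F" "t \<in> J" for J \<delta> t
  proof -
    have "\<exists>y K \<eta>. (K, \<eta>) \<in> F \<and> t \<in> K \<and> y = \<eta> t" using J by blast
    then have "\<exists>K \<eta>. (K, \<eta>) \<in> F \<and> t \<in> K \<and> \<gamma> t = \<eta> t" unfolding \<gamma>_def by (rule someI_ex)
    then obtain K \<eta> where K: "(K, \<eta>) \<in> F" "t \<in> K" "\<gamma> t = \<eta> t" by blast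
    have "curve K \<eta>" "curve J \<delta>" "t0 \<in> K \<inter> J" "\<eta> t0 = \<delta> t0" using F[OF J(1)] F[OF K(1)] by auto
    then have "\<eta> t = \<delta> t" by (rule curve_unique) (use J(2) K(2) in blast)
    then show ?thesis using K by simp
  qed
  have "curve (\<Union>(fst ` F)) \<gamma>"
  proof (rule curve_locally)
    show "open (\<Union>(fst ` F))" using F by (auto simp: integral_curve_def)
    have "connected (\<Union>(fst ` F))"
    proof (rule connected_Union)
      show "connected K" if "K \<in> fst ` F" for K
        using that F by (auto simp: integral_curve_def is_interval_connected)
      have "t0 \<in> \<Inter>(fst ` F)" using F by auto
      then show "\<Inter>(fst ` F) \<noteq> {}" by blast
    qed
    then show "is_interval (\<Union>(fst ` F))" by (simp add: is_interval_connected_1)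
    fix t assume "t \<in> \<Union>(fst ` F)"
    then obtain J \<delta> where "(J, \<delta>) \<in> F" "t \<in> J" by force
    then show "\<exists>K \<delta>. curve K \<delta> \<and> t \<in> K \<and> K \<subseteq> \<Union>(fst ` F) \<and> (\<forall>s\<in>K. \<gamma> s = \<delta> s)"
    proof (intro exI conjI ballI)
      show "curve J \<delta>" using F[OF \<open>(J, \<delta>) \<in> F\<close>] by blast
      show "J \<subseteq> \<Union>(fst ` F)" using \<open>(J, \<delta>) \<in> F\<close> by force
    qed (use \<gamma> \<open>(J, \<delta>) \<in> F\<close> in auto)
  qed
  then show ?thesis using \<gamma> that by blast
qed

lemma curve_shift:
  assumes "curve J \<gamma>"
  shows "curve {t. t + a \<in> J} (\<lambda>t. \<gamma> (t + a))"
  unfolding integral_curve_def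
proof (intro conjI ballI impI)
  have J: "open J" "is_interval J" "continuous_map (top_of_set J) M \<gamma>"
    using assms by (auto simp: integral_curve_def)
  have eq: "{t. t + a \<in> J} = (\<lambda>t. t + a) -` J" by auto
  show "open {t. t + a \<in> J}" unfolding eq
    by (intro open_vimage J continuous_intros)
  show "is_interval {t. t + a \<in> J}"
    unfolding is_interval_1
  proof (intro ballI allI impI)
    fix x y z assume "x \<in> {t. t + a \<in> J}" "y \<in> {t. t + a \<in> J}" "x \<le> z \<and> z \<le> y"
    then show "z \<in> {t. t + a \<in> J}" using mem_is_interval_1_I[OF J(2), of "x + a" "y + a" "z + a"] by simp
  qed
  have "continuous_map (top_of_set {t. t + a \<in> J}) (top_of_set J) (\<lambda>t. t + a)"
    by (auto simp: continuous_map_in_subtopology intro!: continuous_intros)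
  from continuous_map_compose[OF this J(3)]
  show "continuous_map (top_of_set {t. t + a \<in> J}) M (\<lambda>t. \<gamma> (t + a))" by (simp add: o_def)
  fix t c assume t: "t \<in> {t. t + a \<in> J}" and c: "c \<in> A" "\<gamma> (t + a) \<in> chart_dom c"
  have "((chart_map c \<circ> \<gamma>) has_vector_derivative v (\<gamma> (t + a)) c) (at (t + a))"
    using assms t c by (auto simp: integral_curve_def)
  moreover have "((\<lambda>t. t + a) has_vector_derivative 1) (at t)"
    by (auto intro!: derivative_eq_intros)
  ultimately show "((chart_map c \<circ> (\<lambda>t. \<gamma> (t + a))) has_vector_derivative v (\<gamma> (t + a)) c) (at t)"
    using vector_diff_chain_at[of "\<lambda>t. t + a" 1 t "chart_map c \<circ> \<gamma>"] by (simp add: o_def)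
qed

text \<open>
  The orbit relation without maximality of the curve, which makes symmetry and transitivity a matter of
  shifting and joining curves.
\<close>

definition reach :: "'a \<Rightarrow> 'a \<Rightarrow> bool" where
  "reach x y \<longleftrightarrow> (\<exists>J \<gamma>. curve J \<gamma> \<and> 0 \<in> J \<and> \<gamma> 0 = x \<and> y \<in> \<gamma> ` J)"

lemma reachI: "curve J \<gamma> \<Longrightarrow> s \<in> J \<Longrightarrow> t \<in> J \<Longrightarrow> reach (\<gamma> s) (\<gamma> t)"
  unfolding reach_def using curve_shift[of J \<gamma> s]
  by (intro exI[of _ "{t. t + s \<in> J}"] exI[of _ "\<lambda>t. \<gamma> (t + s)"]) (auto intro!: image_eqI[of _ _ "t - s"])

lemma reach_in_topspace: "reach x y \<Longrightarrow> x \<in> topspace M \<and> y \<in> topspace M"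
  unfolding reach_def using curve_in_topspace by blast

lemma reach_sym: "reach x y \<Longrightarrow> reach y x"
  unfolding reach_def[of x y] using reachI by blast

text \<open>
  By uniqueness all integral curves starting at \<open>x\<close> agree where they are both defined, so their union is
  an integral curve, which cannot be extended and contains everything that can be reached from \<open>x\<close>.
\<close>

lemma maximal_curve_exists:
  assumes "reach x x"
  obtains J \<gamma> where "maximal_integral_curve M A v x J \<gamma>" "\<And>y. reach x y \<Longrightarrow> y \<in> \<gamma> ` J"
proof -
  define F where "F = {(J, \<gamma>). curve J \<gamma> \<and> 0 \<in> J \<and> \<gamma> 0 = x}"
  obtain \<gamma> where \<gamma>: "curve (\<Union>(fst ` F)) \<gamma>" "\<And>J \<delta> t. (J, \<delta>) \<in> F \<Longrightarrow> t \<in> J \<Longrightarrow> \<gamma> t = \<delta> t"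
    by (rule curve_Union[of F 0 x]) (auto simp: F_def)
  obtain J0 \<delta>0 where F0: "(J0, \<delta>0) \<in> F" using assms by (auto simp: reach_def F_def)
  have "0 \<in> J0" "\<delta>0 0 = x" using F0 by (auto simp: F_def)
  then have 0: "0 \<in> \<Union>(fst ` F)" "\<gamma> 0 = x" using F0 \<gamma>(2)[OF F0, of 0] by force+
  show ?thesis
  proof
    show "maximal_integral_curve M A v x (\<Union>(fst ` F)) \<gamma>"
      unfolding maximal_integral_curve_def
    proof (intro conjI \<gamma>(1) 0 allI impI)
      fix K \<delta> assume *: "curve K \<delta> \<and> \<Union>(fst ` F) \<subseteq> K \<and> (\<forall>t\<in>\<Union>(fst ` F). \<delta> t = \<gamma> t)"
      then have "0 \<in> K" using 0(1) by blast
      have "\<forall>t\<in>\<Union>(fst ` F). \<delta> t = \<gamma> t" using * by blast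
      from bspec[OF this 0(1)] have "\<delta> 0 = x" using 0(2) by simp
      then have "(K, \<delta>) \<in> F" using * \<open>0 \<in> K\<close> by (simp add: F_def)
      then show "K = \<Union>(fst ` F)" using * by force
    qed
    fix y assume "reach x y"
    then obtain J \<delta> t where J: "(J, \<delta>) \<in> F" "t \<in> J" "y = \<delta> t" by (auto simp: reach_def F_def)
    then show "y \<in> \<gamma> ` \<Union>(fst ` F)" using \<gamma>(2)[OF J(1,2)] by force
  qed
qed

text \<open>
  A curve from \<open>y\<close> to \<open>z\<close> is delayed until the curve from \<open>x\<close> arrives at \<open>y\<close>, and joined to it.
\<close>

lemma reach_trans:
  assumes "reach x y" "reach y z"
  shows "reach x z"
proof -
  obtain J \<gamma> t where J: "curve J \<gamma>" "0 \<in> J" "\<gamma> 0 = x" "t \<in> J" "\<gamma> t = y"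
    using assms(1) by (auto simp: reach_def)
  obtain K \<delta> s where K: "curve K \<delta>" "0 \<in> K" "\<delta> 0 = y" "s \<in> K" "\<delta> s = z"
    using assms(2) by (auto simp: reach_def)
  let ?K = "{a. a + (- t) \<in> K}" and ?\<delta> = "\<lambda>a. \<delta> (a + (- t))"
  have K': "curve ?K ?\<delta>" "t \<in> ?K" "?\<delta> t = y" using curve_shift[OF K(1), of "- t"] K by auto
  obtain \<eta> where \<eta>: "curve (\<Union>(fst ` {(J, \<gamma>), (?K, ?\<delta>)})) \<eta>"
    "\<And>I \<theta> a. (I, \<theta>) \<in> {(J, \<gamma>), (?K, ?\<delta>)} \<Longrightarrow> a \<in> I \<Longrightarrow> \<eta> a = \<theta> a"
    by (rule curve_Union[of "{(J, \<gamma>), (?K, ?\<delta>)}" t y]) (use J K' in auto)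
  have "\<eta> 0 = x" using \<eta>(2)[of J \<gamma> 0] J by simp
  moreover have "\<eta> (s + t) = z" using \<eta>(2)[of ?K ?\<delta> "s + t"] K by simp
  ultimately show ?thesis using reachI[OF \<eta>(1), of 0 "s + t"] J K by simp
qed

lemma reach_refl:
  assumes "p \<in> topspace M"
  shows "reach p p"
proof -
  obtain c r \<epsilon> where c: "c \<in> A" "p \<in> chart_dom c" "0 < r" "0 < \<epsilon>" "cball (chart_map c p) r \<subseteq> chart_im c"
    "\<And>y. y \<in> ball (chart_map c p) (r/2) \<Longrightarrow>
      \<exists>u. u 0 = y \<and> (\<forall>t\<in>{-\<epsilon><..<\<epsilon>}. u t \<in> cball (chart_map c p) r \<and> (u has_vector_derivative local_field c (u t)) (at t))"
    using local_flow[OF assms] by metis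
  then obtain u where u: "u 0 = chart_map c p"
    "\<forall>t\<in>{-\<epsilon><..<\<epsilon>}. u t \<in> cball (chart_map c p) r \<and> (u has_vector_derivative local_field c (u t)) (at t)"
    by (metis centre_in_ball half_gt_zero)
  have "curve {-\<epsilon><..<\<epsilon>} (chart_inv c \<circ> u)"
    by (rule curve_of_chart_solution) (use c u in \<open>auto simp: is_interval_oo\<close>)
  from reachI[OF this, of 0 0] show ?thesis using c u by simp
qed

lemma orbit_eq_reach: "orbit M A v x = {y. reach x y}"
proof
  show "orbit M A v x \<subseteq> {y. reach x y}"
    by (auto simp: orbit_def reach_def maximal_integral_curve_def)
  show "{y. reach x y} \<subseteq> orbit M A v x"
  proof
    fix y assume "y \<in> {y. reach x y}"
    then have y: "reach x y" by simp
    then have "reach x x" using reach_refl reach_in_topspace by blast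
    then obtain J \<gamma> where "maximal_integral_curve M A v x J \<gamma>" "\<And>y. reach x y \<Longrightarrow> y \<in> \<gamma> ` J"
      by (rule maximal_curve_exists) blast
    then have "y \<in> \<gamma> ` J" "maximal_integral_curve M A v x J \<gamma>" using y by auto
    then show "y \<in> orbit M A v x" unfolding orbit_def by blast
  qed
qed

lemma orbit_eq_iff:
  assumes "x \<in> topspace M" "y \<in> topspace M"
  shows "orbit M A v x = orbit M A v y \<longleftrightarrow> reach x y"
  unfolding orbit_eq_reach using assms reach_refl reach_sym reach_trans by blast

end

section \<open>The orbit projection is open\<close>

context smooth_field
begin

text \<open>
  Orbits through points near \<open>y\<close> come arbitrarily close to \<open>x\<close>. That this holds for any two points of one
  orbit means that saturations of open sets are open. The relation is transitive, which reduces the proof to short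
  pieces of an integral curve.
\<close>

definition orbits_near :: "'a \<Rightarrow> 'a \<Rightarrow> bool" where
  "orbits_near y x \<longleftrightarrow>
     (\<forall>U. openin M U \<longrightarrow> x \<in> U \<longrightarrow> (\<exists>W. openin M W \<and> y \<in> W \<and> (\<forall>y'\<in>W. \<exists>z\<in>U. reach y' z)))"

lemma orbits_near_trans:
  assumes "orbits_near x y" "orbits_near y z"
  shows "orbits_near x z"
  unfolding orbits_near_def
proof (intro allI impI)
  fix U assume "openin M U" "z \<in> U"
  then obtain W where W: "openin M W" "y \<in> W" "\<forall>y'\<in>W. \<exists>z\<in>U. reach y' z"
    using assms(2) by (auto simp: orbits_near_def)
  then obtain W' where "openin M W'" "x \<in> W'" "\<forall>y'\<in>W'. \<exists>z\<in>W. reach y' z"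
    using assms(1) by (fastforce simp: orbits_near_def)
  then show "\<exists>W. openin M W \<and> x \<in> W \<and> (\<forall>y'\<in>W. \<exists>z\<in>U. reach y' z)"
    using W(3) reach_trans by meson
qed

text \<open>
  Points close together on a curve are joined within a single chart, where solutions depend
  continuously on their initial points.
\<close>

lemma orbits_near_locally:
  assumes \<gamma>: "curve J \<gamma>" and t0: "t0 \<in> J"
  shows "\<exists>\<tau>>0. \<forall>s t. \<bar>s - t0\<bar> < \<tau> \<longrightarrow> \<bar>t - t0\<bar> < \<tau> \<longrightarrow> s \<in> J \<and> t \<in> J \<and> orbits_near (\<gamma> s) (\<gamma> t)"
proof -
  obtain c r \<epsilon> L where c: "c \<in> A" "\<gamma> t0 \<in> chart_dom c" "0 < r" "0 < \<epsilon>" "cball (chart_map c (\<gamma> t0)) r \<subseteq> chart_im c"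
    and L: "0 \<le> L" "\<And>y z. y \<in> cball (chart_map c (\<gamma> t0)) r \<Longrightarrow> z \<in> cball (chart_map c (\<gamma> t0)) r \<Longrightarrow>
        norm (local_field c y - local_field c z) \<le> L * norm (y - z)"
    and flow: "\<And>y. y \<in> ball (chart_map c (\<gamma> t0)) (r/2) \<Longrightarrow>
      \<exists>u. u 0 = y \<and> (\<forall>t\<in>{-\<epsilon><..<\<epsilon>}. u t \<in> cball (chart_map c (\<gamma> t0)) r \<and> (u has_vector_derivative local_field c (u t)) (at t))"
    using local_flow[OF curve_in_topspace[OF \<gamma> t0]] by blast
  define x0 where "x0 = chart_map c (\<gamma> t0)"
  define U0 where "U0 = {p \<in> chart_dom c. chart_map c p \<in> ball x0 (r/2)}"
  have U0: "openin M U0" unfolding U0_def by (rule openin_chart_preimage[OF c(1)]) auto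
  have "t0 \<in> {t \<in> J. \<gamma> t \<in> U0}" using t0 c by (auto simp: U0_def x0_def)
  then obtain \<tau>' where \<tau>': "0 < \<tau>'" "ball t0 \<tau>' \<subseteq> {t \<in> J. \<gamma> t \<in> U0}"
    using curve_preimage_open[OF \<gamma> U0] by (meson openE)
  define \<tau> where "\<tau> = min \<tau>' (\<epsilon>/2)"
  have \<tau>: "0 < \<tau>" "\<tau> \<le> \<epsilon>/2" using \<tau>' c by (auto simp: \<tau>_def)
  have in_U0: "t \<in> J \<and> \<gamma> t \<in> U0" if "\<bar>t - t0\<bar> < \<tau>" for t
    using \<tau>'(2) that by (auto simp: \<tau>_def dist_real_def abs_minus_commute)
  have "orbits_near (\<gamma> s) (\<gamma> t)" if s: "\<bar>s - t0\<bar> < \<tau>" and t: "\<bar>t - t0\<bar> < \<tau>" for s t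
    unfolding orbits_near_def
  proof (intro allI impI)
    fix U assume U: "openin M U" "\<gamma> t \<in> U"
    define y0 where "y0 = chart_map c (\<gamma> s)"
    have y0: "y0 \<in> ball x0 (r/2)" using in_U0[OF s] by (auto simp: U0_def y0_def)
    then obtain u where u: "u 0 = y0"
      "\<And>t. t \<in> {-\<epsilon><..<\<epsilon>} \<Longrightarrow> u t \<in> cball x0 r"
      "\<And>t. t \<in> {-\<epsilon><..<\<epsilon>} \<Longrightarrow> (u has_vector_derivative local_field c (u t)) (at t)"
      using flow[folded x0_def] by blast
    have ts: "t - s \<in> {-\<epsilon><..<\<epsilon>}" using s t \<tau> by auto
    \<comment> \<open>In the chart, \<open>\<gamma>\<close> shifted by \<open>s\<close> is the solution starting at \<open>y0\<close>.\<close>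
    define I where "I = {-\<epsilon><..<\<epsilon>} \<inter> {t0 - \<tau> - s<..<t0 + \<tau> - s}"
    have "norm (u (t - s) - (chart_map c \<circ> (\<lambda>a. \<gamma> (a + s))) (t - s)) \<le>
        exp (L * \<bar>(t - s) - 0\<bar>) * norm (u 0 - (chart_map c \<circ> (\<lambda>a. \<gamma> (a + s))) 0)"
    proof (rule gronwall_distance[where X = "cball x0 r" and J = I and F = "local_field c"])
      show "is_interval I" by (simp add: I_def is_interval_Int is_interval_oo)
      show "0 \<in> I" using s c(4) by (auto simp: I_def abs_less_iff)
      show "t - s \<in> I" using ts t by (auto simp: I_def abs_less_iff)
      fix a assume a: "a \<in> I"
      show "u a \<in> cball x0 r" "(u has_vector_derivative local_field c (u a)) (at a)"
        using u a by (auto simp: I_def)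
      have a': "a + s \<in> J" "\<gamma> (a + s) \<in> U0" using in_U0[of "a + s"] a by (auto simp: I_def abs_less_iff)
      show "(chart_map c \<circ> (\<lambda>a. \<gamma> (a + s))) a \<in> cball x0 r"
        using a'(2) c(3) by (auto simp: U0_def)
      show "((chart_map c \<circ> (\<lambda>a. \<gamma> (a + s))) has_vector_derivative
          local_field c ((chart_map c \<circ> (\<lambda>a. \<gamma> (a + s))) a)) (at a)"
        using a' by (intro curve_chart_derivative[OF curve_shift[OF \<gamma>] c(1)]) (auto simp: U0_def)
    qed (use L(2) in \<open>auto simp: x0_def\<close>)
    then have u_ts: "u (t - s) = chart_map c (\<gamma> t)" using u(1) by (simp add: y0_def)
    have "open (chart_map c ` (U \<inter> chart_dom c))" by (rule open_chart_image[OF c(1) U(1)])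
    moreover have "chart_map c (\<gamma> t) \<in> chart_map c ` (U \<inter> chart_dom c)"
      using U(2) in_U0[OF t] by (auto simp: U0_def)
    ultimately obtain \<eta> where \<eta>: "0 < \<eta>" "ball (chart_map c (\<gamma> t)) \<eta> \<subseteq> chart_map c ` (U \<inter> chart_dom c)"
      by (meson openE)
    define W where "W = {p \<in> chart_dom c. chart_map c p \<in> ball y0 (\<eta> / exp (L * \<epsilon>)) \<inter> ball x0 (r/2)}"
    have "\<exists>z\<in>U. reach y z" if y: "y \<in> W" for y
    proof -
      obtain w where w: "w 0 = chart_map c y"
        "\<And>t. t \<in> {-\<epsilon><..<\<epsilon>} \<Longrightarrow> w t \<in> cball x0 r"
        "\<And>t. t \<in> {-\<epsilon><..<\<epsilon>} \<Longrightarrow> (w has_vector_derivative local_field c (w t)) (at t)"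
        using flow[folded x0_def, of "chart_map c y"] y unfolding W_def by blast
      have "norm (w (t - s) - u (t - s)) \<le> exp (L * \<bar>(t - s) - 0\<bar>) * norm (w 0 - u 0)"
        by (rule gronwall_distance[where X = "cball x0 r" and J = "{-\<epsilon><..<\<epsilon>}" and F = "local_field c"])
           (use L(2) u w ts c(4) in \<open>auto simp: x0_def is_interval_oo\<close>)
      also have "\<dots> \<le> exp (L * \<epsilon>) * norm (w 0 - u 0)"
        using ts L(1) by (intro mult_right_mono) (auto intro: mult_left_mono)
      also have "\<dots> < \<eta>"
        using y w(1) u(1) by (simp add: W_def dist_norm norm_minus_commute pos_less_divide_eq mult.commute)
      finally have "w (t - s) \<in> ball (chart_map c (\<gamma> t)) \<eta>"
        by (simp add: u_ts dist_norm norm_minus_commute)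
      then obtain z where z: "z \<in> U" "z \<in> chart_dom c" "w (t - s) = chart_map c z" using \<eta>(2) by blast
      have "curve {-\<epsilon><..<\<epsilon>} (chart_inv c \<circ> w)"
        by (rule curve_of_chart_solution) (use c w in \<open>auto simp: is_interval_oo x0_def\<close>)
      from reachI[OF this, of 0 "t - s"] have "reach y z"
        using c y z w(1) ts by (simp add: W_def)
      then show ?thesis using z(1) by blast
    qed
    moreover have "openin M W" unfolding W_def by (rule openin_chart_preimage[OF c(1)]) auto
    moreover have "\<gamma> s \<in> W" using in_U0[OF s] y0 \<eta>(1) by (auto simp: W_def U0_def y0_def)
    ultimately show "\<exists>W. openin M W \<and> \<gamma> s \<in> W \<and> (\<forall>y\<in>W. \<exists>z\<in>U. reach y z)" by blast
  qed
  then show ?thesis using \<tau>(1) in_U0 by blast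
qed

text \<open>
  The local statement spreads along the curve since its time interval is connected.
\<close>

lemma orbits_near_if_reach:
  assumes "reach y x"
  shows "orbits_near y x"
proof -
  obtain J \<gamma> t where J: "curve J \<gamma>" "0 \<in> J" "\<gamma> 0 = y" "t \<in> J" "\<gamma> t = x"
    using assms by (auto simp: reach_def)
  have "connected J" using J(1) by (auto simp: integral_curve_def is_interval_connected)
  then have "orbits_near (\<gamma> 0) (\<gamma> t) \<and> orbits_near (\<gamma> t) (\<gamma> 0)"
    using J(2,4)
  proof (rule connected_equivalence_relation[where R = "\<lambda>s t. orbits_near (\<gamma> s) (\<gamma> t) \<and> orbits_near (\<gamma> t) (\<gamma> s)"])
    fix a assume a: "a \<in> J"
    obtain \<tau> where \<tau>: "\<tau> > 0" "\<forall>s t. \<bar>s - a\<bar> < \<tau> \<longrightarrow> \<bar>t - a\<bar> < \<tau> \<longrightarrow> s \<in> J \<and> t \<in> J \<and> orbits_near (\<gamma> s) (\<gamma> t)"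
      using orbits_near_locally[OF J(1) a] by blast
    have near: "\<bar>x - a\<bar> < \<tau>" if "x \<in> J \<inter> ball a \<tau>" for x
      using that by (auto simp: dist_real_def abs_minus_commute)
    show "\<exists>T. openin (top_of_set J) T \<and> a \<in> T \<and> (\<forall>x\<in>T. orbits_near (\<gamma> a) (\<gamma> x) \<and> orbits_near (\<gamma> x) (\<gamma> a))"
    proof (intro exI[of _ "J \<inter> ball a \<tau>"] conjI ballI)
      show "openin (top_of_set J) (J \<inter> ball a \<tau>)" by (auto simp: openin_open)
      show "a \<in> J \<inter> ball a \<tau>" using a \<tau>(1) by simp
      fix x assume "x \<in> J \<inter> ball a \<tau>"
      then have "\<bar>x - a\<bar> < \<tau>" "\<bar>a - a\<bar> < \<tau>" using near \<tau>(1) by simp_all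
      then show "orbits_near (\<gamma> a) (\<gamma> x)" "orbits_near (\<gamma> x) (\<gamma> a)" using \<tau>(2) by blast+
    qed
  qed (blast intro: orbits_near_trans)+
  then show ?thesis using J by simp
qed

lemma openin_saturation:
  assumes "openin M U"
  shows "openin M {x \<in> topspace M. \<exists>y\<in>U. reach x y}"
proof (subst openin_subopen, safe)
  fix x y assume xy: "x \<in> topspace M" "y \<in> U" "reach x y"
  obtain W where W: "openin M W" "x \<in> W" "\<forall>y'\<in>W. \<exists>z\<in>U. reach y' z"
    using orbits_near_if_reach[OF xy(3), unfolded orbits_near_def, rule_format, OF assms xy(2)] by auto
  show "\<exists>T. openin M T \<and> x \<in> T \<and> T \<subseteq> {x \<in> topspace M. \<exists>y\<in>U. reach x y}"
    using W openin_subset[OF W(1)] by (intro exI[of _ W]) auto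
qed

lemma open_map_orbit: "open_map M (orbit_space M A v) (orbit M A v)"
  unfolding open_map_def
proof (intro allI impI)
  fix U assume U: "openin M U"
  have "{x \<in> topspace M. orbit M A v x \<in> orbit M A v ` U} = {x \<in> topspace M. \<exists>y\<in>U. reach x y}"
    using orbit_eq_iff openin_subset[OF U] by (auto simp: image_iff)
  then show "openin (orbit_space M A v) (orbit M A v ` U)"
    using openin_saturation[OF U] openin_subset[OF U]
    by (simp add: orbit_space_def openin_quotient_topology image_mono)
qed

lemma curve_if_field_vanishes:
  assumes p: "p \<in> topspace M" and v: "\<And>c. c \<in> A \<Longrightarrow> p \<in> chart_dom c \<Longrightarrow> v p c = 0"
  shows "curve UNIV (\<lambda>_. p)"
  unfolding integral_curve_def using p v by (auto simp: o_def)

lemma reach_if_field_vanishes: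
  assumes p: "p \<in> topspace M" and v: "\<And>c. c \<in> A \<Longrightarrow> p \<in> chart_dom c \<Longrightarrow> v p c = 0" and "reach p q"
  shows "q = p"
proof -
  obtain J \<gamma> t where J: "curve J \<gamma>" "0 \<in> J" "\<gamma> 0 = p" "t \<in> J" "\<gamma> t = q"
    using assms(3) by (auto simp: reach_def)
  then show ?thesis
    using curve_unique[OF J(1) curve_if_field_vanishes[OF p v], of 0 t] by auto
qed

end

section \<open>Derivatives and changes of charts\<close>

context smooth_field
begin

lemma has_derivative_change_chart:
  assumes c: "c \<in> A" "p \<in> chart_dom c" and d: "d \<in> A" "p \<in> chart_dom d"
    and G: "(g \<circ> chart_inv d has_derivative G) (at (chart_map d p))"
  shows "(g \<circ> chart_inv c has_derivative
      G \<circ> frechet_derivative (chart_map d \<circ> chart_inv c) (at (chart_map c p))) (at (chart_map c p))"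
proof -
  have "((g \<circ> chart_inv d) \<circ> (chart_map d \<circ> chart_inv c) has_derivative
      G \<circ> frechet_derivative (chart_map d \<circ> chart_inv c) (at (chart_map c p))) (at (chart_map c p))"
    by (rule diff_chain_at[OF transition_has_derivative[OF c(1) d(1) c(2) d(2)]]) (use G c d in simp)
  then show ?thesis
  proof (rule has_derivative_transform_within_open)
    show "open (chart_map c ` (chart_dom d \<inter> chart_dom c))"
      by (rule open_chart_image[OF c(1) chart(1)[OF d(1)]])
  qed (use c d in auto)
qed

text \<open>
  The derivatives of the transition maps carry a coordinate vector in one chart to all other charts,
  consistently by the chain rule. Hence a critical point is one where the derivative of the
  coordinate expression vanishes, in any chart.
\<close>

lemma tangent_vector_exists:
  assumes c: "c \<in> A" "p \<in> chart_dom c"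
  obtains \<xi> where "\<xi> \<in> tangent_space A p" "\<xi> c = w"
proof
  let ?\<xi> = "\<lambda>d. frechet_derivative (chart_map d \<circ> chart_inv c) (at (chart_map c p)) w"
  show "?\<xi> \<in> tangent_space A p"
    unfolding tangent_space_def
  proof (intro CollectI ballI impI)
    fix d d' assume d: "d \<in> A" "p \<in> chart_dom d" and d': "d' \<in> A" "p \<in> chart_dom d'"
    let ?D = "frechet_derivative (chart_map d' \<circ> chart_inv d) (at (chart_map d p))"
    have "(chart_map d' \<circ> chart_inv c has_derivative
        ?D \<circ> frechet_derivative (chart_map d \<circ> chart_inv c) (at (chart_map c p))) (at (chart_map c p))"
      by (rule has_derivative_change_chart[OF c d transition_has_derivative[OF d(1) d'(1) d(2) d'(2)]])
    from frechet_derivative_at[OF this] show "?\<xi> d' = ?D (?\<xi> d)" by (metis comp_apply)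
  qed
  have "(chart_map c \<circ> chart_inv c has_derivative (\<lambda>x. x)) (at (chart_map c p))"
    by (rule has_derivative_transform_within_open[OF has_derivative_ident chart(2)[OF c(1)]])
       (use c in auto)
  from frechet_derivative_at[OF this] show "?\<xi> c = w" by metis
qed

end

section \<open>A function that increases along a gradient field\<close>

locale morse_gradient = smooth_field M A v
  for M :: "'a topology" and A :: "('a, 'e::euclidean_space) chart set" and v +
  fixes f :: "'a \<Rightarrow> real"
  assumes morse: "morse_function M A f" and gradient: "f_gradient M A f v"
begin

abbreviation df :: "('a, 'e) chart \<Rightarrow> 'e \<Rightarrow> 'e \<Rightarrow> real" where
  "df c x \<equiv> frechet_derivative (f \<circ> chart_inv c) (at x)"

abbreviation vf :: "'a \<Rightarrow> real" where
  "vf \<equiv> field_deriv A v f"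

abbreviation critical :: "'a set" where
  "critical \<equiv> critical_points M A f"

lemma smooth_f: "c \<in> A \<Longrightarrow> smooth_on (chart_im c) (f \<circ> chart_inv c)"
  using morse by (simp add: morse_function_def smooth_fun_def)

lemma f_has_derivative: "c \<in> A \<Longrightarrow> x \<in> chart_im c \<Longrightarrow> (f \<circ> chart_inv c has_derivative df c x) (at x)"
  by (rule smooth_on_has_derivative[OF smooth_f chart(2)])

lemma differential_in_chart:
  assumes c: "c \<in> A" "p \<in> chart_dom c" and \<xi>: "\<xi> \<in> tangent_space A p"
  shows "differential A f p \<xi> = df c (chart_map c p) (\<xi> c)"
proof -
  let ?d = "chart_at A p"
  have d: "?d \<in> A" "p \<in> chart_dom ?d" using chart_at chart(4)[OF c(1)] c(2) by auto
  have "\<xi> ?d = frechet_derivative (chart_map ?d \<circ> chart_inv c) (at (chart_map c p)) (\<xi> c)"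
    using \<xi> c d unfolding tangent_space_def by blast
  moreover have "(f \<circ> chart_inv c has_derivative
      df ?d (chart_map ?d p) \<circ> frechet_derivative (chart_map ?d \<circ> chart_inv c) (at (chart_map c p))) (at (chart_map c p))"
    by (rule has_derivative_change_chart[OF c d f_has_derivative]) (use d in auto)
  from frechet_derivative_at[OF this]
  have "df c (chart_map c p) (\<xi> c) =
      df ?d (chart_map ?d p) (frechet_derivative (chart_map ?d \<circ> chart_inv c) (at (chart_map c p)) (\<xi> c))"
    by (metis comp_apply)
  ultimately show ?thesis by (simp add: differential_def Let_def)
qed

lemma vf_in_chart: "c \<in> A \<Longrightarrow> p \<in> chart_dom c \<Longrightarrow> vf p = df c (chart_map c p) (v p c)"
  unfolding field_deriv_def
  by (rule differential_in_chart) (use field chart(4)[of c] in \<open>auto simp: smooth_vector_field_def\<close>)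

lemma df_critical:
  assumes "p \<in> critical" "c \<in> A" "p \<in> chart_dom c"
  shows "df c (chart_map c p) w = 0"
proof -
  obtain \<xi> where \<xi>: "\<xi> \<in> tangent_space A p" "\<xi> c = w" using tangent_vector_exists assms by blast
  then have "differential A f p \<xi> = 0" using assms(1) by (simp add: critical_points_def)
  then show ?thesis using differential_in_chart[OF assms(2,3) \<xi>(1)] \<xi>(2) by simp
qed

lemma vf_critical: "p \<in> critical \<Longrightarrow> vf p = 0"
  using vf_in_chart[OF chart_at, of p] df_critical[OF _ chart_at] by (simp add: critical_points_def)

lemma vf_pos: "p \<in> topspace M \<Longrightarrow> p \<notin> critical \<Longrightarrow> 0 < vf p"
  using gradient by (simp add: f_gradient_def)

lemma vf_nonneg: "p \<in> topspace M \<Longrightarrow> 0 \<le> vf p"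
  using vf_critical vf_pos by force

abbreviation d2f :: "('a, 'e) chart \<Rightarrow> 'e \<Rightarrow> 'e \<Rightarrow> 'e \<Rightarrow> real" where
  "d2f c x b \<equiv> frechet_derivative (\<lambda>x. df c x b) (at x)"

lemma df_has_derivative: "c \<in> A \<Longrightarrow> x \<in> chart_im c \<Longrightarrow> ((\<lambda>x. df c x b) has_derivative d2f c x b) (at x)"
  by (rule smooth_on_has_derivative[OF smooth_on_frechet_derivative[OF smooth_f] chart(2)])

lemma df_expand: "c \<in> A \<Longrightarrow> x \<in> chart_im c \<Longrightarrow> df c x u = (\<Sum>b\<in>Basis. (u \<bullet> b) * df c x b)"
  using linear_expand_Basis[OF has_derivative_linear[OF f_has_derivative]] by fastforce

lemma hessian_expand:
  assumes c: "c \<in> A" "p \<in> chart_dom c"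
  shows "hessian c f p u w = (\<Sum>b\<in>Basis. (u \<bullet> b) * d2f c (chart_map c p) b w)"
proof -
  have im: "chart_map c p \<in> chart_im c" using c by simp
  have "((\<lambda>x. \<Sum>b\<in>Basis. (u \<bullet> b) * df c x b) has_derivative
      (\<lambda>w. \<Sum>b\<in>Basis. (u \<bullet> b) * d2f c (chart_map c p) b w)) (at (chart_map c p))"
    by (intro has_derivative_sum has_derivative_mult_right df_has_derivative c im)
  then have "((\<lambda>x. df c x u) has_derivative
      (\<lambda>w. \<Sum>b\<in>Basis. (u \<bullet> b) * d2f c (chart_map c p) b w)) (at (chart_map c p))"
    by (rule has_derivative_transform_within_open[OF _ chart(2)[OF c(1)] im])
       (simp add: df_expand[OF c(1), of _ u])
  from fun_cong[OF frechet_derivative_at[OF this], of w] show ?thesis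
    unfolding hessian_def by (rule sym)
qed

lemma hessian_nondegenerate:
  assumes "p \<in> critical" "\<And>w. hessian (chart_at A p) f p u w = 0"
  shows "u = 0"
  using assms morse unfolding morse_function_def nondegenerate_critical_point_def by blast

text \<open>
  In coordinates \<open>v(f) = df(v)\<close>. Differentiating at a critical point \<open>p\<close> leaves only the term
  \<open>Hess f (v p, w)\<close>, as \<open>df\<close> vanishes at \<open>p\<close>. Since \<open>p\<close> is also critical for \<open>v(f)\<close>, this is zero for
  all \<open>w\<close>, and \<open>v p = 0\<close> by non-degeneracy.
\<close>

lemma field_vanishes_critical:
  assumes p: "p \<in> critical" and c: "c \<in> A" "p \<in> chart_dom c"
  shows "v p c = 0"
proof -
  let ?d = "chart_at A p" and ?V = "local_field (chart_at A p)"
  have d: "?d \<in> A" "p \<in> chart_dom ?d" using chart_at p by (auto simp: critical_points_def)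
  let ?x = "chart_map ?d p"
  have im: "?x \<in> chart_im ?d" using d by simp
  let ?V' = "frechet_derivative ?V (at ?x)"
  have V: "(?V has_derivative ?V') (at ?x)"
    by (rule smooth_on_has_derivative[OF smooth_local_field[OF d(1)] chart(2)[OF d(1)] im])
  have "((\<lambda>x. \<Sum>b\<in>Basis. (?V x \<bullet> b) * df ?d x b) has_derivative
      (\<lambda>w. \<Sum>b\<in>Basis. (?V ?x \<bullet> b) * d2f ?d ?x b w + (?V' w \<bullet> b) * df ?d ?x b)) (at ?x)"
    by (intro has_derivative_sum has_derivative_mult has_derivative_inner_left V df_has_derivative d im)
  then have "((\<lambda>x. \<Sum>b\<in>Basis. (?V x \<bullet> b) * df ?d x b) has_derivative hessian ?d f p (?V ?x)) (at ?x)"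
    by (simp add: df_critical[OF p d] hessian_expand[OF d, abs_def])
  then have "(vf \<circ> chart_inv ?d has_derivative hessian ?d f p (?V ?x)) (at ?x)"
  proof (rule has_derivative_transform_within_open[OF _ chart(2)[OF d(1)] im])
    fix x assume x: "x \<in> chart_im ?d"
    show "(\<Sum>b\<in>Basis. (?V x \<bullet> b) * df ?d x b) = (vf \<circ> chart_inv ?d) x"
      using vf_in_chart[OF d(1), of "chart_inv ?d x"] df_expand[OF d(1) x, of "?V x"] x by simp
  qed
  from sym[OF frechet_derivative_at[OF this]]
  have deriv: "frechet_derivative (vf \<circ> chart_inv ?d) (at ?x) = hessian ?d f p (?V ?x)" .
  have "hessian ?d f p (?V ?x) w = 0" for w
  proof -
    obtain \<xi> where \<xi>: "\<xi> \<in> tangent_space A p" "\<xi> ?d = w" using tangent_vector_exists d by blast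
    have "p \<in> critical_points M A vf"
      using gradient p by (auto simp: f_gradient_def nondegenerate_critical_point_def)
    then have "differential A vf p \<xi> = 0" using \<xi>(1) by (simp add: critical_points_def)
    then show ?thesis using deriv \<xi>(2) by (simp add: differential_def Let_def)
  qed
  then have "?V ?x = 0" by (rule hessian_nondegenerate[OF p])
  then have "v p ?d = 0" using d by simp
  moreover have "linear (frechet_derivative (chart_map c \<circ> chart_inv ?d) (at ?x))"
    by (rule has_derivative_linear[OF transition_has_derivative[OF d(1) c(1) d(2) c(2)]])
  ultimately show ?thesis using field_transform[OF d(1) c(1) d(2) c(2)] by (simp add: linear_0)
qed

text \<open>
  The coordinate gradient of \<open>f\<close> has an injective derivative \<open>H\<close> at a non-degenerate critical point, so
  it cannot vanish at other nearby points. Non-degeneracy is a statement about the first argument of the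
  Hessian, that is about the adjoint \<open>H'\<close> of \<open>H\<close>; in finite dimensions the injectivity of \<open>H'\<close> implies its
  surjectivity and therefore the injectivity of \<open>H\<close>.
\<close>

lemma critical_isolated:
  assumes p: "p \<in> critical"
  obtains r where "0 < r"
    "\<And>q. q \<in> chart_dom (chart_at A p) \<Longrightarrow> dist (chart_map (chart_at A p) q) (chart_map (chart_at A p) p) < r \<Longrightarrow>
       q \<in> critical \<Longrightarrow> q = p"
proof -
  let ?c = "chart_at A p"
  have c: "?c \<in> A" "p \<in> chart_dom ?c" using chart_at p by (auto simp: critical_points_def)
  let ?x = "chart_map ?c p"
  have im: "?x \<in> chart_im ?c" using c by simp
  define grad where "grad x = (\<Sum>b\<in>Basis. df ?c x b *\<^sub>R b)" for x
  define H where "H w = (\<Sum>b\<in>Basis. d2f ?c ?x b w *\<^sub>R b)" for w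
  define H' where "H' u = (\<Sum>b\<in>Basis. hessian ?c f p u b *\<^sub>R b)" for u
  have d2f_linear: "linear (d2f ?c ?x b)" for b
    by (rule has_derivative_linear[OF df_has_derivative[OF c(1) im]])
  have grad: "(grad has_derivative H) (at ?x)"
    unfolding grad_def H_def
    by (intro has_derivative_sum has_derivative_scaleR_left df_has_derivative c im)
  have H'_linear: "linear H'"
    unfolding H'_def hessian_expand[OF c]
    by (intro linearI) (auto simp: inner_add_left algebra_simps sum.distrib scaleR_sum_right sum_distrib_left scaleR_add_left)
  have adjoint: "H' u \<bullet> w = u \<bullet> H w" for u w
  proof -
    have "H' u \<bullet> w = (\<Sum>a\<in>Basis. (w \<bullet> a) * hessian ?c f p u a)"
      by (simp add: H'_def inner_sum_left inner_commute[of w] mult.commute)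
    also have "\<dots> = (\<Sum>b\<in>Basis. (u \<bullet> b) * (\<Sum>a\<in>Basis. (w \<bullet> a) * d2f ?c ?x b a))"
      unfolding hessian_expand[OF c] sum_distrib_left
      by (subst sum.swap) (simp add: mult.left_commute)
    also have "\<dots> = (\<Sum>b\<in>Basis. (u \<bullet> b) * d2f ?c ?x b w)"
      using linear_expand_Basis[OF d2f_linear, of _ w] by simp
    also have "\<dots> = u \<bullet> H w"
      by (simp add: H_def inner_sum_right mult.commute)
    finally show ?thesis .
  qed
  have "inj H'"
  proof (rule linear_injective_0[OF H'_linear, THEN iffD2], intro allI impI)
    fix u assume "H' u = 0"
    show "u = 0"
    proof (rule hessian_nondegenerate[OF p])
      fix w
      have "hessian ?c f p u w = u \<bullet> H w"
        by (simp add: hessian_expand[OF c] H_def inner_sum_right mult.commute)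
      then show "hessian ?c f p u w = 0" using adjoint[of u w] \<open>H' u = 0\<close> by simp
    qed
  qed
  then have "surj H'" by (rule linear_injective_imp_surjective[OF H'_linear _ refl])
  have "inj H"
  proof (rule linear_injective_0[OF has_derivative_linear[OF grad], THEN iffD2], intro allI impI)
    fix w assume "H w = 0"
    obtain u where "H' u = w" using \<open>surj H'\<close> by (metis surjD)
    then have "w \<bullet> w = 0" using adjoint[of u w] \<open>H w = 0\<close> by simp
    then show "w = 0" by simp
  qed
  then obtain B where B: "0 < B" "\<And>w. B * norm w \<le> norm (H w)"
    using linear_inj_bounded_below_pos[OF has_derivative_linear[OF grad]] by blast
  then obtain r where r: "0 < r" "\<And>x. norm (x - ?x) < r \<Longrightarrow> norm (grad x - grad ?x - H (x - ?x)) \<le> B/2 * norm (x - ?x)"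
    using grad[unfolded has_derivative_at_alt] by (meson half_gt_zero)
  show ?thesis
  proof
    show "0 < r" by fact
    fix q assume q: "q \<in> chart_dom ?c" "dist (chart_map ?c q) ?x < r" "q \<in> critical"
    let ?w = "chart_map ?c q - ?x"
    have "grad (chart_map ?c q) = 0" "grad ?x = 0"
      using df_critical[OF q(3) c(1) q(1)] df_critical[OF p c] by (simp_all add: grad_def)
    then have "norm (H ?w) \<le> B/2 * norm ?w" using r(2)[of "chart_map ?c q"] q(2) by (simp add: dist_norm)
    then have "B * norm ?w \<le> B/2 * norm ?w" using B(2)[of ?w] by linarith
    then have "norm ?w \<le> 0" using B(1) by (simp add: field_simps)
    then have "chart_map ?c q = ?x" by simp
    then show "q = p" using inj_onD[OF inj_on_chart_map[OF c(1)]] q(1) c(2) by blast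
  qed
qed

lemma continuous_vf_in_chart:
  assumes c: "c \<in> A"
  shows "continuous_on (chart_im c) (\<lambda>x. vf (chart_inv c x))"
proof -
  have "continuous_on (chart_im c) (\<lambda>x. \<Sum>b\<in>Basis. (local_field c x \<bullet> b) * df c x b)"
    by (intro continuous_intros smooth_on_continuous_on[OF smooth_local_field[OF c]]
        smooth_on_continuous_on[OF smooth_on_frechet_derivative[OF smooth_f[OF c]]])
  moreover have "(\<Sum>b\<in>Basis. (local_field c x \<bullet> b) * df c x b) = vf (chart_inv c x)" if "x \<in> chart_im c" for x
    using vf_in_chart[OF c, of "chart_inv c x"] df_expand[OF c that, of "local_field c x"] that by simp
  ultimately show ?thesis by (subst continuous_on_cong[OF refl]) auto
qed

text \<open>
  Around a regular point this is continuity of \<open>v(f)\<close>, around a critical point it is isolation.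
\<close>

lemma vf_pos_punctured_ball:
  assumes y: "y \<in> topspace M"
  obtains r where "0 < r" "cball (chart_map (chart_at A y) y) r \<subseteq> chart_im (chart_at A y)"
    "\<And>x. x \<in> cball (chart_map (chart_at A y) y) r \<Longrightarrow> x \<noteq> chart_map (chart_at A y) y \<Longrightarrow>
       0 < vf (chart_inv (chart_at A y) x)"
proof -
  let ?c = "chart_at A y"
  note c = chart_at[OF y]
  let ?x = "chart_map ?c y"
  have im: "?x \<in> chart_im ?c" using c by simp
  obtain r1 where r1: "0 < r1" "cball ?x r1 \<subseteq> chart_im ?c"
    using chart(2)[OF c(1)] im open_contains_cball by blast
  have "\<exists>r2>0. \<forall>x\<in>chart_im ?c. dist x ?x < r2 \<longrightarrow> x \<noteq> ?x \<longrightarrow> 0 < vf (chart_inv ?c x)"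
  proof (cases "y \<in> critical")
    case True
    then obtain r2 where r2: "0 < r2"
      "\<And>q. q \<in> chart_dom ?c \<Longrightarrow> dist (chart_map ?c q) ?x < r2 \<Longrightarrow> q \<in> critical \<Longrightarrow> q = y"
      using critical_isolated by blast
    have "0 < vf (chart_inv ?c x)" if x: "x \<in> chart_im ?c" "dist x ?x < r2" "x \<noteq> ?x" for x
    proof (rule vf_pos)
      have q: "chart_inv ?c x \<in> chart_dom ?c" "chart_map ?c (chart_inv ?c x) = x" using x(1) by auto
      then show "chart_inv ?c x \<in> topspace M" using chart(4)[OF c(1)] by blast
      show "chart_inv ?c x \<notin> critical" using r2(2)[OF q(1)] q(2) x by metis
    qed
    then show ?thesis using r2(1) by blast
  next
    case False
    then have "0 < vf (chart_inv ?c ?x)" using vf_pos[OF y] c by simp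
    then obtain r2 where "r2 > 0" "\<forall>x\<in>chart_im ?c. dist x ?x < r2 \<longrightarrow> dist (vf (chart_inv ?c x)) (vf (chart_inv ?c ?x)) < vf (chart_inv ?c ?x)"
      using continuous_vf_in_chart[OF c(1)] im unfolding continuous_on_iff by blast
    then show ?thesis by (intro exI[of _ r2]) (force simp: dist_real_def)
  qed
  then obtain r2 where r2: "r2 > 0" "\<And>x. x \<in> chart_im ?c \<Longrightarrow> dist x ?x < r2 \<Longrightarrow> x \<noteq> ?x \<Longrightarrow> 0 < vf (chart_inv ?c x)"
    by blast
  show ?thesis
  proof (rule that[of "min r1 (r2/2)"])
    show sub: "cball ?x (min r1 (r2/2)) \<subseteq> chart_im ?c" using r1(2) by auto
    show "0 < vf (chart_inv ?c x)" if "x \<in> cball ?x (min r1 (r2/2))" "x \<noteq> ?x" for x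
    proof (rule r2(2))
      show "x \<in> chart_im ?c" using that sub by blast
      show "dist x ?x < r2" using that r2(1) by (auto simp: dist_commute)
    qed fact
  qed (use r1 r2 in auto)
qed

lemma f_continuous: "continuous_map M euclideanreal f"
  unfolding continuous_map_def
proof (intro conjI allI impI)
  fix U :: "real set" assume "openin euclidean U"
  then have U: "open U" by simp
  have ope: "open (chart_im c \<inter> (f \<circ> chart_inv c) -` U)" if "c \<in> A" for c
    using continuous_open_preimage[OF smooth_on_continuous_on[OF smooth_f[OF that]] chart(2)[OF that] U] .
  have "{p \<in> topspace M. f p \<in> U} =
      (\<Union>c\<in>A. {p \<in> chart_dom c. chart_map c p \<in> chart_im c \<inter> (f \<circ> chart_inv c) -` U})"
    (is "?L = ?R")
  proof
    show "?L \<subseteq> ?R"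
    proof
      fix p assume p: "p \<in> ?L"
      then have c: "chart_at A p \<in> A" "p \<in> chart_dom (chart_at A p)" using chart_at by auto
      then show "p \<in> ?R" using p by (intro UN_I[OF c(1)]) auto
    qed
    show "?R \<subseteq> ?L"
    proof
      fix p assume "p \<in> ?R"
      then obtain c where c: "c \<in> A" "p \<in> chart_dom c" "(f \<circ> chart_inv c) (chart_map c p) \<in> U" by blast
      have "f p \<in> U" using c by simp
      then show "p \<in> ?L" using chart(4)[OF c(1)] c(2) by blast
    qed
  qed
  moreover have "openin M ?R" by (intro openin_Union) (use openin_chart_preimage ope in blast)
  ultimately show "openin M {p \<in> topspace M. f p \<in> U}" by simp
qed auto

lemma f_curve_derivative:
  assumes \<gamma>: "curve J \<gamma>" and t: "t \<in> J"
  shows "((f \<circ> \<gamma>) has_vector_derivative vf (\<gamma> t)) (at t)"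
proof -
  let ?c = "chart_at A (\<gamma> t)"
  note c = chart_at[OF curve_in_topspace[OF \<gamma> t]]
  have "((f \<circ> chart_inv ?c) \<circ> (chart_map ?c \<circ> \<gamma>) has_vector_derivative
      df ?c ((chart_map ?c \<circ> \<gamma>) t) (local_field ?c ((chart_map ?c \<circ> \<gamma>) t))) (at t)"
    by (rule vector_derivative_diff_chain_within[OF curve_chart_derivative[OF \<gamma> c(1) t c(2)]
          has_derivative_at_withinI[OF f_has_derivative[OF c(1)]]]) (use c in auto)
  then have "((f \<circ> chart_inv ?c) \<circ> (chart_map ?c \<circ> \<gamma>) has_vector_derivative vf (\<gamma> t)) (at t)"
    using vf_in_chart[OF c] c by simp
  then show ?thesis
    by (rule has_vector_derivative_transform_within_open[OF _ curve_preimage_open[OF \<gamma> chart(1)[OF c(1)]]])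
       (use t c in auto)
qed

lemma f_curve_mono:
  assumes \<gamma>: "curve J \<gamma>" and st: "s \<in> J" "t \<in> J" "s \<le> t"
  shows "f (\<gamma> s) \<le> f (\<gamma> t)"
proof -
  have "(f \<circ> \<gamma>) s \<le> (f \<circ> \<gamma>) t"
  proof (rule DERIV_nonneg_imp_nondecreasing[OF st(3)])
    fix x assume x: "s \<le> x" "x \<le> t"
    have "is_interval J" using \<gamma> by (simp add: integral_curve_def)
    then have "x \<in> J" using mem_is_interval_1_I st x by blast
    then show "\<exists>y. ((f \<circ> \<gamma>) has_real_derivative y) (at x) \<and> 0 \<le> y"
      using f_curve_derivative[OF \<gamma>] vf_nonneg curve_in_topspace[OF \<gamma>]
      unfolding has_real_derivative_iff_has_vector_derivative by blast
  qed
  then show ?thesis by simp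
qed

text \<open>
  The orbit of a critical point is a single point. Hence an orbit containing a regular point
  consists of regular points, and \<open>f\<close> increases strictly along it.
\<close>

lemma f_inj_on_orbit:
  assumes "reach y z" "f y = f z"
  shows "y = z"
proof (cases "y \<in> critical")
  case True
  then have "y \<in> topspace M" by (simp add: critical_points_def)
  then show ?thesis
    using reach_if_field_vanishes[OF _ field_vanishes_critical[OF True] assms(1)] by simp
next
  case False
  obtain J \<gamma> t where J: "curve J \<gamma>" "0 \<in> J" "\<gamma> 0 = y" "t \<in> J" "\<gamma> t = z"
    using assms(1) by (auto simp: reach_def)
  have pos: "0 < vf (\<gamma> s)" if s: "s \<in> J" for s
  proof (rule vf_pos[OF curve_in_topspace[OF J(1) s]], rule notI)
    assume crit: "\<gamma> s \<in> critical"
    have r: "reach (\<gamma> s) y" using reachI[OF J(1) s J(2)] J(3) by simp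
    have "y = \<gamma> s"
      by (rule reach_if_field_vanishes[OF curve_in_topspace[OF J(1) s] field_vanishes_critical[OF crit] r])
    then show False using crit False by simp
  qed
  have iv: "is_interval J" using J(1) by (simp add: integral_curve_def)
  have less: "f (\<gamma> a) < f (\<gamma> b)" if ab: "a \<in> J" "b \<in> J" "a < b" for a b
  proof -
    have "(f \<circ> \<gamma>) a < (f \<circ> \<gamma>) b"
    proof (rule DERIV_pos_imp_increasing[OF ab(3)])
      fix x assume "a \<le> x" "x \<le> b"
      then have "x \<in> J" using mem_is_interval_1_I[OF iv] ab by blast
      then show "\<exists>y. ((f \<circ> \<gamma>) has_real_derivative y) (at x) \<and> 0 < y"
        using f_curve_derivative[OF J(1)] pos
        unfolding has_real_derivative_iff_has_vector_derivative by blast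
    qed
    then show ?thesis by simp
  qed
  have "t = 0" using less[OF J(2,4)] less[OF J(4,2)] J(3,5) assms(2) by (cases t "0::real" rule: linorder_cases) auto
  then show ?thesis using J by simp
qed

lemma f_orbit_convex: "convex (f ` {x \<in> topspace M. orbit M A v x = O'})"
  unfolding is_interval_convex_1[symmetric] is_interval_1
proof (intro ballI allI impI)
  fix a b s
  assume "a \<in> f ` {x \<in> topspace M. orbit M A v x = O'}" "b \<in> f ` {x \<in> topspace M. orbit M A v x = O'}"
    and s: "a \<le> s \<and> s \<le> b"
  then obtain x y where x: "x \<in> topspace M" "orbit M A v x = O'" "a = f x"
    and y: "y \<in> topspace M" "orbit M A v y = O'" "b = f y" by auto
  then have "reach x y" using orbit_eq_iff by metis
  then obtain J \<gamma> t where J: "curve J \<gamma>" "0 \<in> J" "\<gamma> 0 = x" "t \<in> J" "\<gamma> t = y"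
    by (auto simp: reach_def)
  have "continuous_on J (f \<circ> \<gamma>)"
    using f_curve_derivative[OF J(1)]
    by (intro continuous_at_imp_continuous_on) (auto intro: has_vector_derivative_continuous)
  then have "is_interval ((f \<circ> \<gamma>) ` J)"
    using J(1) by (simp add: integral_curve_def is_interval_connected_1 connected_continuous_image)
  moreover have "a \<in> (f \<circ> \<gamma>) ` J" "b \<in> (f \<circ> \<gamma>) ` J" using J x y by force+
  ultimately have "s \<in> (f \<circ> \<gamma>) ` J" using s mem_is_interval_1_I by blast
  then obtain u where u: "u \<in> J" "s = f (\<gamma> u)" by auto
  have "reach x (\<gamma> u)" using reachI[OF J(1,2) u(1)] J(3) by simp
  then have "orbit M A v (\<gamma> u) = O'" using orbit_eq_iff[OF x(1) curve_in_topspace[OF J(1) u(1)]] x(2) by simp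
  then show "s \<in> f ` {x \<in> topspace M. orbit M A v x = O'}"
    using u(2) curve_in_topspace[OF J(1) u(1)] by blast
qed

end

section \<open>Orbits near a point stay near it while their level does\<close>

text \<open>
  Here \<open>b\<close> is the first time at which the function reaches \<open>\<beta>\<close>, and \<open>a\<close> the last time before \<open>b\<close> at which
  it is at \<open>\<alpha>\<close>.
\<close>

lemma crossing_interval:
  fixes \<rho> :: "real \<Rightarrow> real"
  assumes \<rho>: "continuous_on {0..T} \<rho>" and T: "0 \<le> T" and \<alpha>\<beta>: "\<rho> 0 \<le> \<alpha>" "\<alpha> < \<beta>" "\<beta> \<le> \<rho> T"
  obtains a b where "0 \<le> a" "a < b" "b \<le> T" "\<rho> a = \<alpha>" "\<rho> b = \<beta>" "\<And>t. t \<in> {a..b} \<Longrightarrow> \<rho> t \<in> {\<alpha>..\<beta>}"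
proof -
  have cont: "continuous_on {x..y} \<rho>" if "0 \<le> x" "y \<le> T" for x y
    using \<rho> by (rule continuous_on_subset) (use that in auto)
  define above where "above = {0..T} \<inter> \<rho> -` {\<beta>..}"
  have "closed above" unfolding above_def using \<rho> by (rule continuous_closed_preimage) auto
  moreover have "bounded above" unfolding above_def by (rule bounded_subset[OF bounded_closed_interval[of 0 T]]) auto
  ultimately have "compact above" by (simp add: compact_eq_bounded_closed)
  moreover have "T \<in> above" using T \<alpha>\<beta> by (simp add: above_def)
  ultimately obtain b where "b \<in> above" "\<forall>t\<in>above. b \<le> t"
    using compact_attains_inf[of above] by blast
  then have b: "b \<in> {0..T}" "\<beta> \<le> \<rho> b" "\<And>t. t \<in> {0..T} \<Longrightarrow> \<beta> \<le> \<rho> t \<Longrightarrow> b \<le> t"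
    by (auto simp: above_def)
  have "\<rho> b = \<beta>"
  proof -
    obtain t where "0 \<le> t" "t \<le> b" "\<rho> t = \<beta>"
      using IVT'[of \<rho> 0 \<beta> b] \<alpha>\<beta> b cont[of 0 b] by auto
    then show ?thesis using b(1) b(3)[of t] by simp
  qed
  define below where "below = {0..b} \<inter> \<rho> -` {..\<alpha>}"
  have "closed below" unfolding below_def using cont[of 0 b] b(1) by (intro continuous_closed_preimage) auto
  moreover have "bounded below" unfolding below_def by (rule bounded_subset[OF bounded_closed_interval[of 0 b]]) auto
  ultimately have "compact below" by (simp add: compact_eq_bounded_closed)
  moreover have "0 \<in> below" using b \<alpha>\<beta> by (simp add: below_def)
  ultimately obtain a where "a \<in> below" "\<forall>t\<in>below. t \<le> a"
    using compact_attains_sup[of below] by blast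
  then have a: "a \<in> {0..b}" "\<rho> a \<le> \<alpha>" "\<And>t. t \<in> {0..b} \<Longrightarrow> \<rho> t \<le> \<alpha> \<Longrightarrow> t \<le> a"
    by (auto simp: below_def)
  have "\<rho> a = \<alpha>"
  proof -
    obtain t where "a \<le> t" "t \<le> b" "\<rho> t = \<alpha>"
      using IVT'[of \<rho> a \<alpha> b] \<alpha>\<beta> a b cont[of a b] by auto
    then show ?thesis using a(1) a(3)[of t] by simp
  qed
  show ?thesis
  proof
    show "0 \<le> a" "b \<le> T" "\<rho> a = \<alpha>" "\<rho> b = \<beta>" using a b \<open>\<rho> a = \<alpha>\<close> \<open>\<rho> b = \<beta>\<close> by auto
    show "a < b" using a(1) \<open>\<rho> a = \<alpha>\<close> \<open>\<rho> b = \<beta>\<close> \<alpha>\<beta>(2) by (cases "a = b") auto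
    fix t assume t: "t \<in> {a..b}"
    have t': "t \<in> {0..T}" "t \<in> {0..b}" using t a(1) b(1) by auto
    have "\<rho> t \<le> \<beta>"
    proof (rule ccontr)
      assume gt: "\<not> \<rho> t \<le> \<beta>"
      then have "t = b" using b(3)[OF t'(1)] t by simp
      then show False using gt \<open>\<rho> b = \<beta>\<close> by simp
    qed
    moreover have "\<alpha> \<le> \<rho> t"
    proof (rule ccontr)
      assume lt: "\<not> \<alpha> \<le> \<rho> t"
      then have "t = a" using a(3)[OF t'(2)] t by simp
      then show False using lt \<open>\<rho> a = \<alpha>\<close> by simp
    qed
    ultimately show "\<rho> t \<in> {\<alpha>..\<beta>}" by simp
  qed
qed

context morse_gradient
begin

text \<open>
  Let \<open>R\<close> be the radius of a coordinate ball around \<open>y\<close> contained in \<open>W\<close>. On the shell \<open>K\<close> around the centre,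
  \<open>v(f) \<ge> \<kappa> > 0\<close> and \<open>\<bar>v\<bar> \<le> S\<close>, so a curve inside \<open>K\<close> whose ends are at distance \<open>d\<close> gains
  height at least \<open>\<kappa> d / S\<close>. A curve from a point \<open>x\<close> of the ball of radius \<open>R/2\<close> to a point outside \<open>W\<close> crosses the shell
  between the radii \<open>R/2\<close> and \<open>5R/8\<close>, which costs at least \<open>\<kappa> R / (8 S)\<close>. As \<open>f\<close> is monotone along
  the curve, this is at most \<open>\<bar>f z - f x\<bar>\<close>, hence less than \<open>2\<delta>\<close>; the choice of \<open>\<delta>\<close> excludes it.
\<close>

lemma orbit_trapping:
  assumes W: "openin M W" "y \<in> W"
  shows "\<exists>W' \<delta>. openin M W' \<and> y \<in> W' \<and> 0 < \<delta> \<and>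
    (\<forall>x\<in>W'. \<forall>z\<in>topspace M. orbit M A v z = orbit M A v x \<and> \<bar>f z - f y\<bar> < \<delta> \<longrightarrow> z \<in> W)"
proof -
  have y: "y \<in> topspace M" using W openin_subset by blast
  let ?c = "chart_at A y" and ?V = "local_field (chart_at A y)"
  note c = chart_at[OF y]
  define x0 where "x0 = chart_map ?c y"
  obtain r where r: "0 < r" "cball x0 r \<subseteq> chart_im ?c"
    "\<And>x. x \<in> cball x0 r \<Longrightarrow> x \<noteq> x0 \<Longrightarrow> 0 < vf (chart_inv ?c x)"
    using vf_pos_punctured_ball[OF y] unfolding x0_def by blast
  have "open (chart_map ?c ` (W \<inter> chart_dom ?c))" by (rule open_chart_image[OF c(1) W(1)])
  moreover have "x0 \<in> chart_map ?c ` (W \<inter> chart_dom ?c)" using W c by (auto simp: x0_def)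
  ultimately obtain R' where R': "0 < R'" "ball x0 R' \<subseteq> chart_map ?c ` (W \<inter> chart_dom ?c)" by (meson openE)
  define R where "R = min r R'"
  have R: "0 < R" "cball x0 R \<subseteq> chart_im ?c" "\<And>x. x \<in> cball x0 R \<Longrightarrow> x \<noteq> x0 \<Longrightarrow> 0 < vf (chart_inv ?c x)"
    using r R' by (auto simp: R_def)
  have R_W: "q \<in> W" if "q \<in> chart_dom ?c" "chart_map ?c q \<in> ball x0 R" for q
  proof -
    have "chart_map ?c q \<in> chart_map ?c ` (W \<inter> chart_dom ?c)" using R'(2) that by (auto simp: R_def)
    then obtain q' where "q' \<in> W" "q' \<in> chart_dom ?c" "chart_map ?c q = chart_map ?c q'" by auto
    then show ?thesis using inj_onD[OF inj_on_chart_map[OF c(1)]] that(1) by metis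
  qed
  define K where "K = cball x0 (3*R/4) - ball x0 (R/2)"
  have K: "compact K" "K \<subseteq> cball x0 R" "x0 \<notin> K"
    using R(1) by (auto simp: K_def compact_diff)
  have KE: "K \<subseteq> chart_im ?c" using K R by blast
  obtain \<kappa> where \<kappa>: "0 < \<kappa>" "\<And>x. x \<in> K \<Longrightarrow> \<kappa> \<le> vf (chart_inv ?c x)"
  proof (cases "K = {}")
    case True then show ?thesis using that[of 1] by auto
  next
    case False
    have "continuous_on K (\<lambda>x. vf (chart_inv ?c x))"
      using continuous_vf_in_chart[OF c(1)] KE by (rule continuous_on_subset)
    then obtain x where x: "x \<in> K" "\<And>x'. x' \<in> K \<Longrightarrow> vf (chart_inv ?c x) \<le> vf (chart_inv ?c x')"
      using continuous_attains_inf[OF K(1) False] by blast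
    moreover have "x \<noteq> x0" using x(1) K(3) by blast
    ultimately show ?thesis using that[of "vf (chart_inv ?c x)"] R(3)[of x] K(2) by blast
  qed
  obtain S where S: "0 < S" "\<And>x. x \<in> K \<Longrightarrow> norm (?V x) \<le> S"
  proof -
    have "continuous_on K ?V"
      using smooth_on_continuous_on[OF smooth_local_field[OF c(1)]] KE by (rule continuous_on_subset)
    then have "bounded (?V ` K)" by (intro compact_imp_bounded compact_continuous_image K(1))
    then show ?thesis using that unfolding bounded_pos by blast
  qed
  define \<delta> where "\<delta> = \<kappa> * R / (32 * S)"
  have \<delta>: "0 < \<delta>" "S / \<kappa> * (2 * \<delta>) = R / 16" using \<kappa>(1) S(1) R(1) by (auto simp: \<delta>_def field_simps)
  define W' where "W' = {q \<in> chart_dom ?c. chart_map ?c q \<in> ball x0 (R/2)} \<inter> {q \<in> topspace M. f q \<in> ball (f y) \<delta>}"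
  have W': "openin M W'" unfolding W'_def
    by (intro openin_Int openin_chart_preimage[OF c(1)] openin_continuous_map_preimage[OF f_continuous]) auto
  \<comment> \<open>The distance to \<open>y\<close> in the chart, capped at \<open>3R/4\<close> to be defined and continuous on all of \<open>M\<close>.\<close>
  define \<rho> where "\<rho> q = (if q \<in> chart_dom ?c \<and> chart_map ?c q \<in> ball x0 R
    then min (dist x0 (chart_map ?c q)) (3*R/4) else 3*R/4)" for q
  have \<rho>_in: "q \<in> chart_dom ?c \<and> chart_map ?c q \<in> ball x0 R \<and> dist x0 (chart_map ?c q) = \<rho> q" if "\<rho> q < 3*R/4" for q
    using that by (auto simp: \<rho>_def split: if_splits)
  have \<rho>_cont: "continuous_map M euclideanreal \<rho>"
  proof (rule pasting_lemma[where I = "UNIV :: bool set"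
        and T = "\<lambda>i. if i then {q \<in> chart_dom ?c. chart_map ?c q \<in> ball x0 R}
              else topspace M - chart_inv ?c ` cball x0 (3*R/4)"
        and f = "\<lambda>i. if i then (\<lambda>q. min (dist x0 (chart_map ?c q)) (3*R/4)) else (\<lambda>_. 3*R/4)"])
    fix i :: bool
    have "closedin M (chart_inv ?c ` cball x0 (3*R/4))"
    proof (rule compactin_imp_closedin[OF Hausdorff], rule image_compactin)
      \<comment> \<open>Compact sets are closed as \<open>M\<close> is Hausdorff, so the cap takes over on an open set.\<close>
      show "compactin (top_of_set (chart_im ?c)) (cball x0 (3*R/4))"
        using R by (auto simp: compactin_subtopology)
      show "continuous_map (top_of_set (chart_im ?c)) M (chart_inv ?c)" by (rule continuous_chart_inv[OF c(1)])
    qed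
    then show "openin M (if i then {q \<in> chart_dom ?c. chart_map ?c q \<in> ball x0 R}
              else topspace M - chart_inv ?c ` cball x0 (3*R/4))"
      using openin_chart_preimage[OF c(1), of "ball x0 R"] by (auto simp: openin_diff)
    have "continuous_map (subtopology M (chart_dom ?c)) euclideanreal ((\<lambda>x. min (dist x0 x) (3*R/4)) \<circ> chart_map ?c)"
      by (rule continuous_map_compose[OF continuous_chart_map[OF c(1)]]) (auto intro!: continuous_intros)
    then have "continuous_map (subtopology M {q \<in> chart_dom ?c. chart_map ?c q \<in> ball x0 R}) euclideanreal
        (\<lambda>q. min (dist x0 (chart_map ?c q)) (3*R/4))"
      unfolding o_def by (rule continuous_map_from_subtopology_mono) auto
    then show "continuous_map (subtopology M (if i then {q \<in> chart_dom ?c. chart_map ?c q \<in> ball x0 R}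
              else topspace M - chart_inv ?c ` cball x0 (3*R/4))) euclideanreal
        (if i then (\<lambda>q. min (dist x0 (chart_map ?c q)) (3*R/4)) else (\<lambda>_. 3*R/4))"
      by (cases i) simp_all
  next
    have far: "3*R/4 < dist x0 (chart_map ?c q)"
      if q: "q \<in> chart_dom ?c" "q \<notin> chart_inv ?c ` cball x0 (3*R/4)" for q
    proof (rule ccontr)
      assume "\<not> 3*R/4 < dist x0 (chart_map ?c q)"
      then have "chart_inv ?c (chart_map ?c q) \<in> chart_inv ?c ` cball x0 (3*R/4)" by auto
      then show False using q c by simp
    qed
    fix i j :: bool and q
    assume "q \<in> topspace M \<inter> (if i then {q \<in> chart_dom ?c. chart_map ?c q \<in> ball x0 R} else topspace M - chart_inv ?c ` cball x0 (3*R/4))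
       \<inter> (if j then {q \<in> chart_dom ?c. chart_map ?c q \<in> ball x0 R} else topspace M - chart_inv ?c ` cball x0 (3*R/4))"
    then show "(if i then (\<lambda>q. min (dist x0 (chart_map ?c q)) (3*R/4)) else (\<lambda>_. 3*R/4)) q =
        (if j then (\<lambda>q. min (dist x0 (chart_map ?c q)) (3*R/4)) else (\<lambda>_. 3*R/4)) q"
      using far[of q] by (cases i; cases j) simp_all
  next
    fix q assume q: "q \<in> topspace M"
    show "\<exists>j. j \<in> UNIV \<and> q \<in> (if j then {q \<in> chart_dom ?c. chart_map ?c q \<in> ball x0 R} else topspace M - chart_inv ?c ` cball x0 (3*R/4))
        \<and> \<rho> q = (if j then (\<lambda>q. min (dist x0 (chart_map ?c q)) (3*R/4)) else (\<lambda>_. 3*R/4)) q"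
    proof (cases "q \<in> chart_dom ?c \<and> chart_map ?c q \<in> ball x0 R")
      case True
      then show ?thesis by (intro exI[of _ True]) (simp add: \<rho>_def)
    next
      case False
      have "q \<notin> chart_inv ?c ` cball x0 (3*R/4)"
      proof
        assume "q \<in> chart_inv ?c ` cball x0 (3*R/4)"
        then obtain x where x: "x \<in> cball x0 (3*R/4)" "q = chart_inv ?c x" by blast
        then have "x \<in> chart_im ?c" "x \<in> ball x0 R" using R by (auto simp: subset_iff)
        then show False using x False by simp
      qed
      then show ?thesis using False q by (intro exI[of _ False]) (auto simp: \<rho>_def)
    qed
  qed
  have "z \<in> W" if x: "x \<in> W'" and z: "z \<in> topspace M" "orbit M A v z = orbit M A v x" "\<bar>f z - f y\<bar> < \<delta>" for x z
  proof (rule ccontr)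
    assume "z \<notin> W"
    have "x \<in> topspace M" using x by (simp add: W'_def)
    then have "reach x z" using orbit_eq_iff[of x z] z(1,2) by simp
    then obtain J \<gamma> T where J: "curve J \<gamma>" "0 \<in> J" "\<gamma> 0 = x" "T \<in> J" "\<gamma> T = z"
      by (auto simp: reach_def)
    have iv: "is_interval J" using J(1) by (simp add: integral_curve_def)
    have "continuous_map (top_of_set J) M \<gamma>" using J(1) unfolding integral_curve_def by blast
    then have "continuous_map (top_of_set J) euclideanreal (\<rho> \<circ> \<gamma>)"
      using \<rho>_cont by (rule continuous_map_compose)
    then have \<rho>\<gamma>: "continuous_on J (\<rho> \<circ> \<gamma>)" by simp
    \<comment> \<open>The curve may run from \<open>x\<close> to \<open>z\<close> forwards or backwards in time.\<close>
    define \<sigma> :: real where "\<sigma> = (if 0 \<le> T then 1 else -1)"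
    have \<sigma>: "\<sigma> * \<bar>T\<bar> = T" "\<sigma> = 1 \<or> \<sigma> = -1" by (auto simp: \<sigma>_def)
    have \<sigma>J: "\<sigma> * s \<in> J" if "s \<in> {0..\<bar>T\<bar>}" for s
      using that mem_is_interval_1_I[OF iv J(2,4), of "\<sigma> * s"] mem_is_interval_1_I[OF iv J(4,2), of "\<sigma> * s"]
      by (auto simp: \<sigma>_def split: if_splits)
    \<comment> \<open>The outer radius is below the cap, so that on the crossing \<open>\<rho>\<close> is the distance to \<open>y\<close>.\<close>
    obtain a b where ab: "0 \<le> a" "a < b" "b \<le> \<bar>T\<bar>" "\<rho> (\<gamma> (\<sigma> * a)) = R/2" "\<rho> (\<gamma> (\<sigma> * b)) = 5*R/8"
      "\<And>s. s \<in> {a..b} \<Longrightarrow> \<rho> (\<gamma> (\<sigma> * s)) \<in> {R/2..5*R/8}"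
    proof (rule crossing_interval[of "\<bar>T\<bar>" "\<lambda>s. \<rho> (\<gamma> (\<sigma> * s))" "R/2" "5*R/8"])
      show "continuous_on {0..\<bar>T\<bar>} (\<lambda>s. \<rho> (\<gamma> (\<sigma> * s)))"
        using continuous_on_compose2[OF \<rho>\<gamma>, of "{0..\<bar>T\<bar>}" "\<lambda>s. \<sigma> * s"] \<sigma>J
        by (force intro!: continuous_intros)
      show "\<rho> (\<gamma> (\<sigma> * 0)) \<le> R/2" using x J(3) R(1) by (auto simp: \<rho>_def W'_def)
      have "\<rho> z = 3*R/4" using R_W[of z] \<open>z \<notin> W\<close> by (auto simp: \<rho>_def)
      then show "5*R/8 \<le> \<rho> (\<gamma> (\<sigma> * \<bar>T\<bar>))" using \<sigma>(1) J(5) R(1) by simp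
    qed (use R(1) in auto)
    define lo where "lo = min (\<sigma> * a) (\<sigma> * b)"
    define hi where "hi = max (\<sigma> * a) (\<sigma> * b)"
    have lohi: "lo < hi" "{lo, hi} = {\<sigma> * a, \<sigma> * b}" using ab(2) \<sigma>(2) by (auto simp: lo_def hi_def)
    have in_K: "t \<in> J \<and> \<gamma> t \<in> chart_dom ?c \<and> chart_map ?c (\<gamma> t) \<in> K" if "t \<in> {lo..hi}" for t
    proof -
      have s: "\<sigma> * t \<in> {a..b}" "\<sigma> * (\<sigma> * t) = t"
        using that \<sigma>(2) ab(2) by (auto simp: lo_def hi_def)
      have "\<sigma> * (\<sigma> * t) \<in> J" by (rule \<sigma>J) (use s(1) ab(1,3) in auto)
      then have "t \<in> J" by (simp only: s(2))
      moreover have "\<rho> (\<gamma> t) \<in> {R/2..5*R/8}" using ab(6)[OF s(1)] s(2) by simp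
      ultimately show ?thesis using \<rho>_in[of "\<gamma> t"] R(1) by (auto simp: K_def)
    qed
    have "norm ((chart_map ?c \<circ> \<gamma>) hi - (chart_map ?c \<circ> \<gamma>) lo) \<le> S / \<kappa> * (f \<circ> \<gamma>) hi - S / \<kappa> * (f \<circ> \<gamma>) lo"
    proof (rule differentiable_bound_general[OF lohi(1)])
      have du: "((chart_map ?c \<circ> \<gamma>) has_vector_derivative ?V ((chart_map ?c \<circ> \<gamma>) t)) (at t)" if "t \<in> {lo..hi}" for t
        using in_K[OF that] by (intro curve_chart_derivative[OF J(1) c(1)]) auto
      have dfc: "((\<lambda>t. S / \<kappa> * (f \<circ> \<gamma>) t) has_vector_derivative S / \<kappa> * vf (\<gamma> t)) (at t)" if "t \<in> {lo..hi}" for t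
        using in_K[OF that] by (intro has_vector_derivative_mult_right f_curve_derivative[OF J(1)]) auto
      show "continuous_on {lo..hi} (chart_map ?c \<circ> \<gamma>)"
        using du by (intro continuous_at_imp_continuous_on) (blast intro: has_vector_derivative_continuous)
      show "continuous_on {lo..hi} (\<lambda>t. S / \<kappa> * (f \<circ> \<gamma>) t)"
        using dfc by (intro continuous_at_imp_continuous_on) (blast intro: has_vector_derivative_continuous)
      fix t assume "lo < t" "t < hi"
      then have t: "t \<in> {lo..hi}" by simp
      show "((chart_map ?c \<circ> \<gamma>) has_vector_derivative ?V ((chart_map ?c \<circ> \<gamma>) t)) (at t)" by (rule du[OF t])
      show "((\<lambda>t. S / \<kappa> * (f \<circ> \<gamma>) t) has_vector_derivative S / \<kappa> * vf (\<gamma> t)) (at t)" by (rule dfc[OF t])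
      have "\<kappa> \<le> vf (\<gamma> t)" using \<kappa>(2)[of "chart_map ?c (\<gamma> t)"] in_K[OF t] c(1) by simp
      then have "S / \<kappa> * \<kappa> \<le> S / \<kappa> * vf (\<gamma> t)" using S(1) \<kappa>(1) by (intro mult_left_mono) auto
      moreover have "norm (?V ((chart_map ?c \<circ> \<gamma>) t)) \<le> S" using S(2) in_K[OF t] by simp
      ultimately show "norm (?V ((chart_map ?c \<circ> \<gamma>) t)) \<le> S / \<kappa> * vf (\<gamma> t)" using \<kappa>(1) by simp
    qed
    also have "\<dots> = S / \<kappa> * (f (\<gamma> hi) - f (\<gamma> lo))" by (simp add: algebra_simps)
    also have "\<dots> \<le> S / \<kappa> * (2 * \<delta>)"
    proof (rule mult_left_mono)
      have "f (\<gamma> hi) - f (\<gamma> lo) \<le> \<bar>f z - f x\<bar>"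
      proof (cases "0 \<le> T")
        case True
        then have "0 \<le> lo" "hi \<le> T" using ab by (auto simp: lo_def hi_def \<sigma>_def)
        then have "f (\<gamma> 0) \<le> f (\<gamma> lo)" "f (\<gamma> hi) \<le> f (\<gamma> T)"
          using f_curve_mono[OF J(1)] J in_K[of lo] in_K[of hi] lohi(1) by auto
        then show ?thesis using J by simp
      next
        case False
        then have "T \<le> lo" "hi \<le> 0" using ab by (auto simp: lo_def hi_def \<sigma>_def)
        then have "f (\<gamma> T) \<le> f (\<gamma> lo)" "f (\<gamma> hi) \<le> f (\<gamma> 0)"
          using f_curve_mono[OF J(1)] J in_K[of lo] in_K[of hi] lohi(1) by auto
        then show ?thesis using J by simp
      qed
      also have "\<dots> \<le> 2 * \<delta>" using z(3) x by (auto simp: W'_def dist_real_def)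
      finally show "f (\<gamma> hi) - f (\<gamma> lo) \<le> 2 * \<delta>" .
    qed (use S(1) \<kappa>(1) in auto)
    also have "\<dots> = R / 16" by (rule \<delta>(2))
    finally have short: "dist (chart_map ?c (\<gamma> hi)) (chart_map ?c (\<gamma> lo)) \<le> R / 16" by (simp add: dist_norm)
    have "dist x0 (chart_map ?c (\<gamma> (\<sigma> * a))) = R/2" "dist x0 (chart_map ?c (\<gamma> (\<sigma> * b))) = 5*R/8"
      using \<rho>_in[of "\<gamma> (\<sigma> * a)"] \<rho>_in[of "\<gamma> (\<sigma> * b)"] ab R(1) by auto
    then have "R/8 \<le> dist (chart_map ?c (\<gamma> (\<sigma> * a))) (chart_map ?c (\<gamma> (\<sigma> * b)))"
      using dist_triangle[of x0 "chart_map ?c (\<gamma> (\<sigma> * b))" "chart_map ?c (\<gamma> (\<sigma> * a))"] by simp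
    then have "R/8 \<le> dist (chart_map ?c (\<gamma> hi)) (chart_map ?c (\<gamma> lo))"
      using lohi(2) by (auto simp: doubleton_eq_iff dist_commute)
    then show False using short R(1) by simp
  qed
  moreover have "y \<in> W'" using y c R(1) \<delta>(1) by (auto simp: W'_def x0_def)
  ultimately show ?thesis using W' \<delta>(1) by blast
qed

lemma lifts_over_orbit_space:
  fixes S :: "'k::{metric_space,second_countable_topology} set"
  shows "lifts_over S M (orbit_space M A v) (orbit M A v)"
proof (rule relative_lifting[OF f_continuous open_map_orbit])
  show "orbit M A v ` topspace M = topspace (orbit_space M A v)"
    by (simp add: orbit_space_def topspace_quotient_topology)
  show "inj_on f {x \<in> topspace M. orbit M A v x = O'}" for O'
    by (intro inj_onI f_inj_on_orbit) (use orbit_eq_iff in auto)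
qed (rule f_orbit_convex orbit_trapping; assumption?)+

end

theorem corollary3p5:
  fixes M :: "'a topology"
    and A :: "('a, 'e::euclidean_space) chart set"
    and f :: "'a \<Rightarrow> real"
    and v :: "'a \<Rightarrow> ('a, 'e) tangent_vector"
  assumes "smooth_manifold M A"
    and "connected_space M"
    and "morse_function M A f"
    and "f_gradient M A f v"
  shows "weak_homotopy_equivalence M (orbit_space M A v) (orbit M A v)"
proof -
  interpret morse_gradient M A v f
    using assms by unfold_locales (auto simp: f_gradient_def)
  have "continuous_map M (orbit_space M A v) (orbit M A v)"
    unfolding orbit_space_def by (rule quotient_imp_continuous_map[OF quotient_map_quotient_topology])
  then show ?thesis by (rule weak_homotopy_equivalence_if_lifts_over) (rule lifts_over_orbit_space)+
qed

end
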